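(* For every instance of the multiplicative assignment problem with upgrades, the polytope $P(k)$ has a vertex that is an optimal solution of the linear program (minimizing $\sum_{(i,j)\in I\times J} b_i d_j x_{i,j} + c_i d_j y_{i,j}$ over $P(k)$) and that is integral. Moreover, such an optimal integral vertex can be computed in polynomial time.
   Context: An instance of the multiplicative assignment problem with upgrades consists of finite sets $I$ (suppliers) and $J$ (customers) with $|I|=|J|$, numbers $0\le b_i\le c_i$ for each $i\in I$ (upgraded and regular cost), demands $d_j\ge 0$ for each $j\in J$, and an integer $k\in\{0,\dots,|I|\}$. The polytope $P(k)$ is the set of all $(x,y)\in\mathbb{R}^{I\times J}\times\mathbb{R}^{I\times J}$ satisfying $\sum_{i\in I}(x_{i,j}+y_{i,j})=1$ for all $j\in J$, $\sum_{j\in J}(x_{i,j}+y_{i,j})=1$ for all $i\in I$, $\sum_{(i,j)\in I\times J}x_{i,j}\le k$, and $x_{i,j}\ge 0$, $y_{i,j}\ge 0$ for all $(i,j)$. (Here $x_{i,j}=1$ means customer $j$ is served by supplier $i$ with $i$ upgraded, at cost $b_id_j$, and $y_{i,j}=1$ means it is served without upgrading $i$, at cost $c_id_j$.) *)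

theory Defs
  imports
    "HOL-Analysis.Analysis"
    "HOL-Computational_Algebra.Polynomial"
    "HOL-Analysis.Finite_Function_Topology"
    "HOL-Library.Log_Nat"
begin

definition map_upgrades_instance ::
  "'i set \<Rightarrow> 'j set \<Rightarrow> ('i \<Rightarrow> real) \<Rightarrow> ('i \<Rightarrow> real) \<Rightarrow> ('j \<Rightarrow> real) \<Rightarrow> nat \<Rightarrow> bool" where
  "map_upgrades_instance I J b c d k \<longleftrightarrow>
     finite I \<and> finite J \<and> card I = card J \<and>
     (\<forall>i\<in>I. 0 \<le> b i \<and> b i \<le> c i) \<and> (\<forall>j\<in>J. 0 \<le> d j) \<and> k \<le> card I"

text \<open>
  For finite \<open>I\<close> and \<open>J\<close>, the space of real vectors indexed by \<open>I \<times> J\<close> is represented by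
  the finitely supported functions vanishing outside \<open>I \<times> J\<close>. These form a real vector
  space, so the library notion of extreme point applies to sets of pairs of them.
\<close>

type_synonym ('i, 'j) mvec = "('i \<times> 'j) \<Rightarrow>\<^sub>0 real"

abbreviation entry :: "('i, 'j) mvec \<Rightarrow> 'i \<times> 'j \<Rightarrow> real" where
  "entry \<equiv> Poly_Mapping.lookup"

definition upgrade_polytope ::
  "'i set \<Rightarrow> 'j set \<Rightarrow> nat \<Rightarrow> (('i, 'j) mvec \<times> ('i, 'j) mvec) set" where
  "upgrade_polytope I J k =
     {(x, y). Poly_Mapping.keys x \<subseteq> I \<times> J \<and> Poly_Mapping.keys y \<subseteq> I \<times> J \<and>
        (\<forall>j\<in>J. (\<Sum>i\<in>I. entry x (i, j) + entry y (i, j)) = 1) \<and>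
        (\<forall>i\<in>I. (\<Sum>j\<in>J. entry x (i, j) + entry y (i, j)) = 1) \<and>
        (\<Sum>(i, j)\<in>I \<times> J. entry x (i, j)) \<le> real k \<and>
        (\<forall>(i, j)\<in>I \<times> J. 0 \<le> entry x (i, j) \<and> 0 \<le> entry y (i, j))}"

definition upgrade_cost ::
  "'i set \<Rightarrow> 'j set \<Rightarrow> ('i \<Rightarrow> real) \<Rightarrow> ('i \<Rightarrow> real) \<Rightarrow> ('j \<Rightarrow> real) \<Rightarrow>
   ('i, 'j) mvec \<times> ('i, 'j) mvec \<Rightarrow> real" where
  "upgrade_cost I J b c d z =
     (\<Sum>(i, j)\<in>I \<times> J. b i * d j * entry (fst z) (i, j) + c i * d j * entry (snd z) (i, j))"

definition lp_optimal ::
  "'i set \<Rightarrow> 'j set \<Rightarrow> ('i \<Rightarrow> real) \<Rightarrow> ('i \<Rightarrow> real) \<Rightarrow> ('j \<Rightarrow> real) \<Rightarrow> nat \<Rightarrow>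
   ('i, 'j) mvec \<times> ('i, 'j) mvec \<Rightarrow> bool" where
  "lp_optimal I J b c d k z \<longleftrightarrow>
     is_arg_min (upgrade_cost I J b c d) (\<lambda>z. z \<in> upgrade_polytope I J k) z"

definition integral_point :: "'i set \<Rightarrow> 'j set \<Rightarrow> ('i, 'j) mvec \<times> ('i, 'j) mvec \<Rightarrow> bool" where
  "integral_point I J z \<longleftrightarrow>
     (\<forall>(i, j)\<in>I \<times> J. entry (fst z) (i, j) \<in> \<int> \<and> entry (snd z) (i, j) \<in> \<int>)"

definition optimal_integral_vertex ::
  "'i set \<Rightarrow> 'j set \<Rightarrow> ('i \<Rightarrow> real) \<Rightarrow> ('i \<Rightarrow> real) \<Rightarrow> ('j \<Rightarrow> real) \<Rightarrow> nat \<Rightarrow>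
   ('i, 'j) mvec \<times> ('i, 'j) mvec \<Rightarrow> bool" where
  "optimal_integral_vertex I J b c d k z \<longleftrightarrow>
     z extreme_point_of upgrade_polytope I J k \<and> lp_optimal I J b c d k z \<and> integral_point I J z"

text \<open>
  Programs are structured programs of a random access machine: the memory is an array of
  unbounded integers, addressed by integers, and addresses can be computed. Time is
  measured by the logarithmic cost criterion: an operation is charged the bit lengths of
  its operands and a memory access those of the address and of the content. Polynomial
  time in this model is the same as polynomial time on Turing machines.
\<close>

type_synonym mem = "int \<Rightarrow> int"

text \<open>Number of binary digits, plus one for the sign.\<close>

definition int_size :: "int \<Rightarrow> nat" where
  "int_size a = 1 + floorlog 2 (nat \<bar>a\<bar>)"

datatype aexp =
    Num int
  | Mem aexp
  | Add aexp aexp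
  | Sub aexp aexp
  | Mul aexp aexp
  | Quot aexp aexp

datatype bexp =
    Less aexp aexp
  | Neg bexp
  | Conj bexp bexp

datatype com =
    Skip
  | Write aexp aexp
  | Seq com com
  | Cond bexp com com
  | While bexp com

fun aval :: "aexp \<Rightarrow> mem \<Rightarrow> int" where
  "aval (Num a) m = a"
| "aval (Mem e) m = m (aval e m)"
| "aval (Add e f) m = aval e m + aval f m"
| "aval (Sub e f) m = aval e m - aval f m"
| "aval (Mul e f) m = aval e m * aval f m"
| "aval (Quot e f) m = aval e m div aval f m"

fun acost :: "aexp \<Rightarrow> mem \<Rightarrow> nat" where
  "acost (Num a) m = int_size a"
| "acost (Mem e) m = acost e m + int_size (aval e m) + int_size (m (aval e m))"
| "acost (Add e f) m = acost e m + acost f m + int_size (aval e m) + int_size (aval f m)"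
| "acost (Sub e f) m = acost e m + acost f m + int_size (aval e m) + int_size (aval f m)"
| "acost (Mul e f) m = acost e m + acost f m + int_size (aval e m) + int_size (aval f m)"
| "acost (Quot e f) m = acost e m + acost f m + int_size (aval e m) + int_size (aval f m)"

fun bval :: "bexp \<Rightarrow> mem \<Rightarrow> bool" where
  "bval (Less e f) m \<longleftrightarrow> aval e m < aval f m"
| "bval (Neg p) m \<longleftrightarrow> \<not> bval p m"
| "bval (Conj p q) m \<longleftrightarrow> bval p m \<and> bval q m"

fun bcost :: "bexp \<Rightarrow> mem \<Rightarrow> nat" where
  "bcost (Less e f) m = acost e m + acost f m + int_size (aval e m) + int_size (aval f m)"
| "bcost (Neg p) m = 1 + bcost p m"
| "bcost (Conj p q) m = 1 + bcost p m + bcost q m"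

text \<open>
  \<open>exec C m t m'\<close>: started in memory \<open>m\<close>, the program \<open>C\<close> halts in memory \<open>m'\<close>, and the
  run costs \<open>t\<close>.
\<close>

inductive exec :: "com \<Rightarrow> mem \<Rightarrow> nat \<Rightarrow> mem \<Rightarrow> bool" where
  Skip: "exec Skip m 1 m"
| Write: "exec (Write e f) m
            (acost e m + acost f m + int_size (aval e m) + int_size (aval f m))
            (m(aval e m := aval f m))"
| Seq: "exec C m t m' \<Longrightarrow> exec D m' u m'' \<Longrightarrow> exec (Seq C D) m (t + u) m''"
| CondTrue: "bval p m \<Longrightarrow> exec C m t m' \<Longrightarrow> exec (Cond p C D) m (1 + bcost p m + t) m'"
| CondFalse: "\<not> bval p m \<Longrightarrow> exec D m t m' \<Longrightarrow> exec (Cond p C D) m (1 + bcost p m + t) m'"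
| WhileFalse: "\<not> bval p m \<Longrightarrow> exec (While p C) m (1 + bcost p m) m"
| WhileTrue: "bval p m \<Longrightarrow> exec C m t m' \<Longrightarrow> exec (While p C) m' u m'' \<Longrightarrow>
              exec (While p C) m (1 + bcost p m + t + u) m''"

inductive_cases exec_SkipE: "exec Skip m t m'"
inductive_cases exec_WriteE: "exec (Write e f) m t m'"
inductive_cases exec_SeqE: "exec (Seq C D) m t m'"
inductive_cases exec_CondE: "exec (Cond p C D) m t m'"
inductive_cases exec_WhileE: "exec (While p C) m t m'"

lemma exec_deterministic:
  "exec C m t m' \<Longrightarrow> exec C m u m'' \<Longrightarrow> t = u \<and> m' = m''"
proof (induction arbitrary: u m'' rule: exec.induct)
  case (Skip m)
  then show ?case by (auto elim: exec_SkipE)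
next
  case (Write e f m)
  then show ?case by (auto elim: exec_WriteE)
next
  case (Seq C m t m' D v n)
  from Seq.prems obtain t' l v' where "exec C m t' l" "exec D l v' m''" "u = t' + v'"
    by (rule exec_SeqE)
  with Seq.IH(1)[of t' l] Seq.IH(2)[of v' m''] show ?case by simp
next
  case (CondTrue p m C t m' D)
  from CondTrue.prems CondTrue.hyps(1) obtain t'
    where "exec C m t' m''" "u = 1 + bcost p m + t'"
    by (auto elim: exec_CondE)
  with CondTrue.IH[of t' m''] show ?case by simp
next
  case (CondFalse p m D t m' C)
  from CondFalse.prems CondFalse.hyps(1) obtain t'
    where "exec D m t' m''" "u = 1 + bcost p m + t'"
    by (auto elim: exec_CondE)
  with CondFalse.IH[of t' m''] show ?case by simp
next
  case (WhileFalse p m C)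
  from WhileFalse.prems WhileFalse.hyps show ?case by (auto elim: exec_WhileE)
next
  case (WhileTrue p m C t m' v n)
  from WhileTrue.prems WhileTrue.hyps(1) obtain t' l v'
    where "exec C m t' l" "exec (While p C) l v' m''" "u = 1 + bcost p m + t' + v'"
    by (auto elim: exec_WhileE)
  with WhileTrue.IH(1)[of t' l] WhileTrue.IH(2)[of v' m''] show ?case by simp
qed

text \<open>The input occupies the addresses from 0 on; all other cells are 0.\<close>

definition load :: "int list \<Rightarrow> mem" where
  "load xs a = (if 0 \<le> a \<and> a < int (length xs) then xs ! nat a else 0)"

text \<open>
  A search problem with instances \<open>X\<close>, encoded as integer lists by \<open>enc\<close>: one program must
  halt on every instance, at a cost bounded by a polynomial in the total
  bit length of the input, with a final memory that represents a solution according to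
  \<open>sol\<close>.
\<close>

definition solvable_in_polynomial_time ::
  "'a set \<Rightarrow> ('a \<Rightarrow> int list) \<Rightarrow> ('a \<Rightarrow> mem \<Rightarrow> bool) \<Rightarrow> bool" where
  "solvable_in_polynomial_time X enc sol \<longleftrightarrow>
     (\<exists>(C :: com) (q :: nat poly). \<forall>a\<in>X. \<exists>t m.
        exec C (load (enc a)) t m \<and> t \<le> poly q (\<Sum>v\<leftarrow>enc a. int_size v) \<and> sol a m)"

text \<open>
  An input \<open>(k, bs, cs, ds)\<close> consists of rational data; suppliers and customers are numbered
  \<open>0, \<dots>, n - 1\<close>, where \<open>n\<close> is the length of the lists.
\<close>

type_synonym map_input = "nat \<times> rat list \<times> rat list \<times> rat list"

definition real_of_list :: "rat list \<Rightarrow> nat \<Rightarrow> real" where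
  "real_of_list qs i = of_rat (qs ! i)"

definition valid_input :: "map_input set" where
  "valid_input = {(k, bs, cs, ds). length cs = length bs \<and> length ds = length bs \<and>
     map_upgrades_instance {..<length bs} {..<length bs}
       (real_of_list bs) (real_of_list cs) (real_of_list ds) k}"

fun encode_input :: "map_input \<Rightarrow> int list" where
  "encode_input (k, bs, cs, ds) =
     [int (length bs), int k] @
     concat (map (\<lambda>q. [fst (quotient_of q), snd (quotient_of q)]) (bs @ cs @ ds))"

text \<open>The entries of \<open>x\<close> and then of \<open>y\<close> are stored row by row from address 0 on.\<close>

definition represents_point :: "nat \<Rightarrow> mem \<Rightarrow> (nat, nat) mvec \<times> (nat, nat) mvec \<Rightarrow> bool" where
  "represents_point n m z \<longleftrightarrow>
     (\<forall>i<n. \<forall>j<n. entry (fst z) (i, j) = of_int (m (int (i * n + j))) \<and>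
                  entry (snd z) (i, j) = of_int (m (int (n * n + i * n + j))))"

fun outputs_optimal_integral_vertex :: "map_input \<Rightarrow> mem \<Rightarrow> bool" where
  "outputs_optimal_integral_vertex (k, bs, cs, ds) m \<longleftrightarrow>
     (\<exists>z. represents_point (length bs) m z \<and>
          optimal_integral_vertex {..<length bs} {..<length bs}
            (real_of_list bs) (real_of_list cs) (real_of_list ds) k z)"

end

theory Submission
  imports Defs
begin

text \<open>
  Existence. If \<open>S\<close> is the set of upgraded suppliers, the best assignment pairs large demands with
  small costs, and its value is a nonnegative combination over thresholds \<open>t\<close> of a convex function
  of the number of suppliers whose cost exceeds \<open>t\<close>; upgrading \<open>i\<close> lowers this number exactly for
  \<open>t\<close> in \<open>[b i, c i)\<close>. Average two upgrade sets. Half upgraded suppliers with nested intervals can be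
  shifted to the larger interval at no cost, and once these intervals form an antichain, every \<open>t\<close>
  meets a contiguous run of them, so that rounding alternately up and down costs nothing. Hence the
  best value with exactly \<open>k\<close> upgrades is convex in \<open>k\<close>. With a subgradient as multiplier of the
  budget constraint the linear program turns into an assignment problem, which is integral.

  Algorithm. Scale the data to integers, make the value function strictly convex by a perturbation
  of the upgrade costs that respects nesting, find by bisection a multiplier whose optimum has
  exactly \<open>k\<close> upgrades, and solve the assignment problems by the Hungarian method.
\<close>

section \<open>Convexity of the value in the number of upgrades\<close>

text \<open>Strict convexity is what makes the search possible. Where the value function is affine
  around \<open>k\<close>, the only multiplier that favours \<open>k\<close> favours its neighbours
  too, and the assignment solver may return any of these sizes. On integer data a perturbation cures
  this: the slopes on both sides of \<open>k\<close> become integers at distance at least 1, so some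
  half-integer lies strictly between them. The weights cannot be arbitrary, since the shift of two
  half upgrades to the larger interval must not raise the weight; hence longer intervals receive
  smaller weights. Base 4 comes from comparing the weight of a set with the mean of two others,
  where the coefficients run from -2 to 2. Existence is about reals and the algorithm about
  integers, so the combinatorial lemmas and the Hungarian method are stated over an ordered integral
  domain. On the machine the obstacle is the bit length of intermediate values: every product in the
  programs has one factor of bounded size, so that lengths grow additively with the number of
  executed commands. That number is read off from ghost bounds on the loops, so the time bound comes
  with the correctness proof.\<close>

lemma step_decomposition:
  fixes V :: "'a::linordered_idom set"
  assumes "finite V" "\<forall>v\<in>V. 0 \<le> v"
  shows "\<exists>T w. finite (T :: 'a set) \<and> (\<forall>t\<in>T. 0 \<le> w t) \<and> (\<forall>t\<in>T. \<exists>v\<in>V. t < v) \<and>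
           (\<forall>v\<in>V. v = (\<Sum>t\<in>T. if t < v then w t else 0))"
  using assms
proof (induction V rule: finite_linorder_max_induct)
  case empty
  show ?case by (rule exI[of _ "{}"]) auto
next
  case (insert v V)
  have "\<forall>v\<in>V. 0 \<le> v" using insert.prems by blast
  from insert.IH[OF this] obtain T w where T: "finite T" "\<forall>t\<in>T. 0 \<le> w t"
      "\<forall>t\<in>T. \<exists>v\<in>V. t < v" "\<forall>v\<in>V. v = (\<Sum>t\<in>T. if t < v then w t else 0)" by blast
  show ?case
  proof (cases "v = 0")
    case True
    with insert have "V = {}" by force
    with True show ?thesis by (intro exI[of _ "{}"]) auto
  next
    case False
    \<comment> \<open>The previous maximum (or 0) becomes a new threshold, weighted by the jump
      \<open>v - m\<close>. The test \<open>t < x\<close> is strict, so older values do not see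
      it.\<close>
    define m where "m = Max (insert 0 V)"
    have m_ge: "0 \<le> m" "x \<le> m" if "x \<in> insert 0 V" for x
      using insert.hyps(1) that by (auto simp: m_def)
    have m_in: "m \<in> insert 0 V" unfolding m_def by (rule Max_in) (use insert.hyps(1) in auto)
    with insert False have mv: "m < v" by force
    have T_lt: "t < m" if "t \<in> T" for t
      using T(3) that m_ge(2) by (meson insertCI less_le_trans)
    then have mT: "m \<notin> T" by blast
    let ?w = "w(m := v - m)"
    have sum_T: "(\<Sum>t\<in>insert m T. if t < x then ?w t else 0) =
        (if m < x then v - m else 0) + (\<Sum>t\<in>T. if t < x then w t else 0)" for x
      using T(1) mT by (auto intro!: sum.cong)
    have v_eq: "v = (\<Sum>t\<in>insert m T. if t < v then ?w t else 0)"
    proof -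
      have "(\<Sum>t\<in>T. if t < v then w t else 0) = (\<Sum>t\<in>T. if t < m then w t else 0)"
        by (rule sum.cong) (use T_lt mv in \<open>auto dest: less_trans\<close>)
      also have "\<dots> = m"
      proof (cases "m \<in> V")
        case True then show ?thesis using bspec[OF T(4) True] by simp
      next
        case F: False
        then have "m = 0" using m_in by auto
        have "T = {}"
        proof (rule ccontr)
          assume "T \<noteq> {}"
          then obtain t where "t \<in> T" by auto
          then obtain x where "x \<in> V" "t < x" using T(3) by auto
          then have "x = 0" using m_ge(2)[of x] insert.prems \<open>m = 0\<close> by force
          with F \<open>m = 0\<close> \<open>x \<in> V\<close> show False by simp
        qed
        with \<open>m = 0\<close> show ?thesis by simp
      qed
      finally show ?thesis using mv by (simp add: sum_T)
    qed
    have "x = (\<Sum>t\<in>insert m T. if t < x then ?w t else 0)" if "x \<in> V" for x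
    proof -
        have "\<not> m < x" using m_ge(2)[of x] that by simp
      then show ?thesis using bspec[OF T(4) that] unfolding sum_T by simp
    qed
    with v_eq have "\<forall>x\<in>insert v V. x = (\<Sum>t\<in>insert m T. if t < x then ?w t else 0)" by blast
    moreover have "finite (insert m T)" using T(1) by simp
    moreover have "\<forall>t\<in>insert m T. 0 \<le> ?w t" using T(2) mv by simp
    moreover have "\<forall>t\<in>insert m T. \<exists>x\<in>insert v V. t < x" using T(3) mv by blast
    ultimately show ?thesis by (intro exI[of _ "insert m T"] exI[of _ ?w]) blast
  qed
qed

lemma sorted_enumeration:
  fixes key :: "'b \<Rightarrow> 'a::linorder"
  assumes "finite A"
  shows "\<exists>f. bij_betw f {..<card A} A \<and>
    (\<forall>p q. p \<le> q \<longrightarrow> q < card A \<longrightarrow> key (f p) \<le> key (f q))"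
proof -
  obtain xs where xs: "set xs = A" "distinct xs" using assms finite_distinct_list by blast
  let ?ys = "sort_key key xs"
  have len: "length ?ys = card A" using distinct_card[OF xs(2)] xs(1) by simp
  have "bij_betw (nth ?ys) {..<card A} A"
    using xs len by (intro bij_betw_nth) auto
  moreover have "key (?ys ! p) \<le> key (?ys ! q)" if "p \<le> q" "q < card A" for p q
    using sorted_nth_mono[OF sorted_sort_key[of key xs], of p q] that len by simp
  ultimately show ?thesis by blast
qed

text \<open>The largest of \<open>r + 1\<close> positions is at least \<open>r\<close>, so removing
  it from \<open>X\<close> peels off a value no smaller than the last one of the initial
  segment.\<close>

lemma sum_smallest_le:
  fixes g :: "nat \<Rightarrow> 'a::linordered_idom"
  assumes "finite X" "X \<subseteq> {..<n}" "\<And>p q. p \<le> q \<Longrightarrow> q < n \<Longrightarrow> g p \<le> g q"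
  shows "sum g {..<card X} \<le> sum g X"
  using assms(1,2)
proof (induction X rule: finite_linorder_max_induct)
  case empty then show ?case by simp
next
  case (insert m X)
  have "card X \<le> m" using insert.hyps by (metis card_lessThan card_mono finite_lessThan lessThan_iff subsetI)
  then have "g (card X) \<le> g m" using insert.prems assms(3) by simp
  moreover have "m \<notin> X" using insert.hyps by blast
  ultimately show ?case using insert by simp
qed

lemma sum_lessThan_convex:
  fixes g :: "nat \<Rightarrow> 'a::linordered_idom"
  assumes "\<And>p q. p \<le> q \<Longrightarrow> q < n \<Longrightarrow> g p \<le> g q" "p \<le> q" "q + k \<le> n"
  shows "sum g {..<p + k} + sum g {..<q} \<le> sum g {..<p} + sum g {..<q + k}"
  using assms(3)
proof (induction k)
  case 0 then show ?case by simp
next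
  case (Suc k)
  have "g (p + k) \<le> g (q + k)" using assms(1,2) Suc.prems by simp
  with Suc show ?case by simp
qed

text \<open>All elements but the first map injectively to their predecessors, which have the other
  parity and stay in the interval.\<close>

lemma card_even_odd_interval:
  fixes a e :: nat
  shows "card {t\<in>{a..<e}. even t} \<le> card {t\<in>{a..<e}. odd t} + 1"
    and "card {t\<in>{a..<e}. odd t} \<le> card {t\<in>{a..<e}. even t} + 1"
proof -
  have inj: "inj_on (\<lambda>t. t - 1) {t\<in>{a<..<e}. P t}" for P
    by (auto simp: inj_on_def)
  have ev: "card {t\<in>{a<..<e}. even t} \<le> card {t\<in>{a..<e}. odd t}"
    by (rule card_inj_on_le[OF inj]) (auto simp: even_diff_nat)
  have od: "card {t\<in>{a<..<e}. odd t} \<le> card {t\<in>{a..<e}. even t}"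
    by (rule card_inj_on_le[OF inj]) (auto simp: even_diff_nat)
  have "card {t\<in>{a..<e}. even t} \<le> card (insert a {t\<in>{a<..<e}. even t})"
    by (rule card_mono) auto
  also have "\<dots> \<le> card {t\<in>{a<..<e}. even t} + 1" by (simp add: card_insert_if)
  finally show "card {t\<in>{a..<e}. even t} \<le> card {t\<in>{a..<e}. odd t} + 1" using ev by simp
  have "card {t\<in>{a..<e}. odd t} \<le> card (insert a {t\<in>{a<..<e}. odd t})"
    by (rule card_mono) auto
  also have "\<dots> \<le> card {t\<in>{a<..<e}. odd t} + 1" by (simp add: card_insert_if)
  finally show "card {t\<in>{a..<e}. odd t} \<le> card {t\<in>{a..<e}. even t} + 1" using od by simp
qed

section \<open>Half-integral upgrade sets and their rounding\<close>

text \<open>The intervals are \<open>[b i, c i)\<close>, \<open>T\<close> and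
  \<open>\<omega>\<close> are weighted thresholds, and \<open>E\<close> is an extra price per
  upgrade. \<open>E_nested\<close> makes an exception for identical intervals, because there either
  of the two can play the larger one.\<close>

locale interval_system =
  fixes I :: "'i set" and b c E :: "'i \<Rightarrow> 'a::linordered_idom"
    and T :: "'a set" and \<omega> :: "'a \<Rightarrow> 'a" and h :: "nat \<Rightarrow> 'a"
  assumes fin_I: "finite I" and b_le_c: "i \<in> I \<Longrightarrow> b i \<le> c i"
    and fin_T: "finite T" and \<omega>_nonneg: "t \<in> T \<Longrightarrow> 0 \<le> \<omega> t"
    and h_mono: "p \<le> q \<Longrightarrow> q \<le> card I \<Longrightarrow> h p \<le> h q"
    and h_convex: "p \<le> q \<Longrightarrow> q + k \<le> card I \<Longrightarrow> h (p + k) + h q \<le> h p + h (q + k)"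
    and E_nested: "i \<in> I \<Longrightarrow> i' \<in> I \<Longrightarrow> b i \<le> b i' \<Longrightarrow> c i' \<le> c i \<Longrightarrow>
      E i \<le> E i' \<or> b i = b i' \<and> c i = c i'"
begin

definition exceed :: "'i set \<Rightarrow> 'a \<Rightarrow> nat" where
  "exceed S t = (\<Sum>i\<in>I. of_bool (t < (if i \<in> S then b i else c i)))"

definition total :: "'i set \<Rightarrow> 'a" where
  "total S = (\<Sum>t\<in>T. \<omega> t * h (exceed S t)) + sum E S"

text \<open>
  A half-integral choice of upgrades is given by the set \<open>U\<close> of fully and the set \<open>X\<close> of half
  upgraded suppliers. Counts and costs are doubled, so that no halves occur.
\<close>

definition exceed2 :: "'i set \<Rightarrow> 'i set \<Rightarrow> 'a \<Rightarrow> nat" where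
  "exceed2 U X t = (\<Sum>i\<in>I. if i \<in> X then of_bool (t < b i) + of_bool (t < c i)
     else 2 * of_bool (t < (if i \<in> U then b i else c i)))"

text \<open>Twice the piecewise linear extension of \<open>h\<close> at \<open>r / 2\<close>: for
  odd \<open>r\<close> it combines the two neighbouring integers.\<close>

definition h2 :: "nat \<Rightarrow> 'a" where
  "h2 r = h (r div 2) + h (r - r div 2)"

definition total2 :: "'i set \<Rightarrow> 'i set \<Rightarrow> 'a" where
  "total2 U X = (\<Sum>t\<in>T. \<omega> t * h2 (exceed2 U X t)) + 2 * sum E U + sum E X"

lemma exceed_le: "exceed S t \<le> card I"
proof -
  have "exceed S t \<le> (\<Sum>i\<in>I. 1)" unfolding exceed_def by (rule sum_mono) auto
  then show ?thesis by simp
qed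

lemma exceed2_le: "exceed2 U X t \<le> 2 * card I"
proof -
  have "exceed2 U X t \<le> (\<Sum>i\<in>I. 2)" unfolding exceed2_def by (rule sum_mono) auto
  then show ?thesis by simp
qed

lemma h2_mono: "p \<le> q \<Longrightarrow> q \<le> 2 * card I \<Longrightarrow> h2 p \<le> h2 q"
  unfolding h2_def by (intro add_mono h_mono) linarith+

text \<open>With their sum fixed, \<open>p\<close> and \<open>q\<close> are moved towards each other
  until they are the two halves of it; convexity lets the value only fall.\<close>

lemma h2_le: assumes "p \<le> card I" "q \<le> card I" shows "h2 (p + q) \<le> h p + h q"
proof -
  have *: "h2 (p + q) \<le> h p + h q" if "p \<le> q" "q \<le> card I" for p q
  proof -
    define r where "r = (p + q) div 2"
    have "h (p + (r - p)) + h (p + q - r) \<le> h p + h (p + q - r + (r - p))"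
      by (rule h_convex) (use that r_def in auto)
    moreover have "p + (r - p) = r" "p + q - r + (r - p) = q" using that r_def by auto
    ultimately show ?thesis by (simp add: h2_def r_def)
  qed
  show ?thesis
  proof (cases "p \<le> q")
    case True then show ?thesis using * assms by blast
  next
    case False then show ?thesis using *[of q p] assms by (simp add: add.commute)
  qed
qed

lemma h2_eq: assumes "p \<le> q + 1" "q \<le> p + 1" shows "h2 (p + q) = h p + h q"
proof -
  consider "p = q" | "p = q + 1" | "q = p + 1" using assms by linarith
  then show ?thesis
  proof cases
    case 1
    then have "(p + q) div 2 = p" "p + q - p = q" by simp_all
    then show ?thesis by (simp add: h2_def)
  next
    case 2
    then have "(p + q) div 2 = q" "p + q - q = p" by simp_all
    then show ?thesis by (simp add: h2_def)
  next
    case 3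
    then have "(p + q) div 2 = p" "p + q - p = q" by simp_all
    then show ?thesis by (simp add: h2_def)
  qed
qed

text \<open>In the average of \<open>S\<close> and \<open>S'\<close> the common members are fully
  upgraded and those of the symmetric difference half. The doubled counts add up exactly, so
  convexity of \<open>h\<close> applies at each threshold.\<close>

lemma total2_le:
  assumes "S \<subseteq> I" "S' \<subseteq> I"
  shows "total2 (S \<inter> S') (S - S' \<union> (S' - S)) \<le> total S + total S'"
proof -
  have ex: "exceed2 (S \<inter> S') (S - S' \<union> (S' - S)) t = exceed S t + exceed S' t" for t
    unfolding exceed2_def exceed_def sum.distrib[symmetric] by (rule sum.cong) auto
  have fin: "finite S" "finite S'" using assms by (auto intro: finite_subset[OF _ fin_I])
  have "sum E S = sum E (S \<inter> S') + sum E (S - S')"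
    by (rule sum.Int_Diff[OF fin(1)])
  moreover have "sum E S' = sum E (S \<inter> S') + sum E (S' - S)"
    using sum.Int_Diff[OF fin(2), of E S] by (simp add: Int_commute)
  moreover have "sum E (S - S' \<union> (S' - S)) = sum E (S - S') + sum E (S' - S)"
    by (rule sum.union_disjoint) (use fin in auto)
  moreover have "(\<Sum>t\<in>T. \<omega> t * h2 (exceed S t + exceed S' t)) \<le>
      (\<Sum>t\<in>T. \<omega> t * (h (exceed S t) + h (exceed S' t)))"
    by (intro sum_mono mult_left_mono h2_le exceed_le \<omega>_nonneg)
  ultimately show ?thesis
    by (simp add: total2_def total_def ex distrib_left sum.distrib)
qed

text \<open>Two half upgrades become a full one of \<open>i\<close> and none of \<open>i'\<close>.
  In the doubled count the second terms \<open>t < b i'\<close> and \<open>t < c i\<close> are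
  replaced by \<open>t < b i\<close> and \<open>t < c i'\<close>, which are harder to
  satisfy.\<close>

lemma total2_shift:
  assumes "U \<subseteq> I" "X \<subseteq> I" "U \<inter> X = {}" "i \<in> X" "i' \<in> X" "i \<noteq> i'"
    and nested: "b i \<le> b i'" "c i' \<le> c i" "E i \<le> E i'"
  shows "total2 (insert i U) (X - {i, i'}) \<le> total2 U X"
proof -
  have fin: "finite U" "finite X" using assms by (auto intro: finite_subset[OF _ fin_I])
  have ex: "exceed2 (insert i U) (X - {i, i'}) t \<le> exceed2 U X t" for t
  proof -
    have "i \<in> I" "i' \<in> I - {i}" using assms by auto
    then have split: "sum f I = f i + (f i' + sum f (I - {i, i'}))" for f :: "'i \<Rightarrow> nat"
      using sum.remove[of I i f] sum.remove[of "I - {i}" i' f] fin_I Diff_insert[of I i' "{i}"]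
      by (simp add: insert_commute)
    have i': "i' \<notin> U" using assms by auto
    have rest: "(\<Sum>x\<in>I - {i, i'}. if x \<in> X - {i, i'} then of_bool (t < b x) + of_bool (t < c x)
         else 2 * of_bool (t < (if x \<in> insert i U then b x else c x))) =
       (\<Sum>x\<in>I - {i, i'}. if x \<in> X then of_bool (t < b x) + of_bool (t < c x)
         else (2::nat) * of_bool (t < (if x \<in> U then b x else c x)))"
      by (rule sum.cong) auto
    show ?thesis unfolding exceed2_def split rest using assms i' by auto
  qed
  have "2 * sum E (insert i U) + sum E (X - {i, i'}) \<le> 2 * sum E U + sum E X"
  proof -
    have "i' \<in> X - {i}" using assms by auto
    then have "sum E X = E i + (E i' + sum E (X - {i, i'}))"
      using sum.remove[of X i E] sum.remove[of "X - {i}" i' E] fin \<open>i \<in> X\<close> Diff_insert[of X i' "{i}"]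
      by (simp add: insert_commute)
    moreover have "i \<notin> U" using assms(3,4) by blast
    then have "sum E (insert i U) = E i + sum E U" using fin by simp
    ultimately show ?thesis using nested by simp
  qed
  moreover have "(\<Sum>t\<in>T. \<omega> t * h2 (exceed2 (insert i U) (X - {i, i'}) t)) \<le>
      (\<Sum>t\<in>T. \<omega> t * h2 (exceed2 U X t))"
    by (intro sum_mono mult_left_mono h2_mono ex exceed2_le \<omega>_nonneg)
  ultimately show ?thesis unfolding total2_def by (simp add: add.assoc add_mono)
qed

text \<open>
  The half upgraded intervals form a chain in which left and right ends increase together, so
  each \<open>t\<close> lies in a contiguous run of them; rounding alternately up and down is balanced.
\<close>

lemma total2_split:
  assumes "U \<subseteq> I" "X \<subseteq> I" "U \<inter> X = {}" "2 * card U + card X = 2 * k"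
    and antichain: "\<And>i i'. i \<in> X \<Longrightarrow> i' \<in> X \<Longrightarrow> i \<noteq> i' \<Longrightarrow> \<not> (b i \<le> b i' \<and> c i' \<le> c i)"
  shows "\<exists>S S'. S \<subseteq> I \<and> S' \<subseteq> I \<and> card S = k \<and> card S' = k \<and> total S + total S' = total2 U X"
proof -
  have fin: "finite U" "finite X" using assms by (auto intro: finite_subset[OF _ fin_I])
  define m where "m = card X"
  obtain f where f: "bij_betw f {..<m} X"
    and f_mono: "\<And>p q. p \<le> q \<Longrightarrow> q < m \<Longrightarrow> b (f p) \<le> b (f q)"
    using sorted_enumeration[OF fin(2), of b] unfolding m_def by blast
  have inj: "inj_on f {..<m}" and im: "f ` {..<m} = X" using f by (auto simp: bij_betw_def)
  \<comment> \<open>Sorting by \<open>b\<close> puts \<open>c\<close> into the same order, as a weak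
    decrease of \<open>c\<close> would be a nesting.\<close>
  have c_mono: "c (f p) \<le> c (f q)" if "p \<le> q" "q < m" for p q
  proof (cases "p = q")
    case False
    then have "f p \<noteq> f q" using inj that by (auto simp: inj_on_def)
    then show ?thesis using antichain[of "f p" "f q"] im that f_mono[of p q] by auto
  qed simp
  define X0 where "X0 = f ` {t\<in>{..<m}. even t}"
  define X1 where "X1 = f ` {t\<in>{..<m}. odd t}"
  have X01: "X0 \<union> X1 = X" "X0 \<inter> X1 = {}"
    using im inj by (auto simp: X0_def X1_def inj_on_def)
  have fin01: "finite X0" "finite X1" by (auto simp: X0_def X1_def)
  \<comment> \<open>The number of half upgrades is even, so even and odd positions are equally many
    and both rounded sets have exactly \<open>k\<close> members.\<close>
  have even_m: "even m" using assms(4) unfolding m_def by presburger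
  have card01: "card X0 = card {t\<in>{..<m}. even t}" "card X1 = card {t\<in>{..<m}. odd t}"
    unfolding X0_def X1_def by (intro card_image inj_on_subset[OF inj]; auto)+
  have "card X0 + card X1 = m" using card_Un_disjoint[OF fin01 X01(2)] X01(1) m_def by simp
  moreover have "card X0 \<le> card X1 + 1" "card X1 \<le> card X0 + 1"
    using card_even_odd_interval[of 0 m] unfolding card01 atLeast0LessThan by auto
  ultimately have "card X0 = card X1" using even_m by presburger
  then have ck: "card U + card X0 = k" "card U + card X1 = k"
    using \<open>card X0 + card X1 = m\<close> assms(4) unfolding m_def by linarith+
  let ?S = "U \<union> X0" and ?S' = "U \<union> X1"
  have card: "card ?S = k" "card ?S' = k"
    using ck fin fin01 X01 assms(3) by (subst card_Un_disjoint; auto)+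
  have ex_sum: "exceed ?S t + exceed ?S' t = exceed2 U X t" for t
    unfolding exceed2_def exceed_def sum.distrib[symmetric]
    by (rule sum.cong) (use X01 assms(3) in auto)
  have hit: "exceed (U \<union> Y) t + card {i\<in>Y. b i \<le> t \<and> t < c i} = exceed U t"
    if "Y \<subseteq> X" for Y t
  proof -
    have "card {i\<in>Y. b i \<le> t \<and> t < c i} = (\<Sum>i\<in>I. of_bool (i \<in> Y \<and> b i \<le> t \<and> t < c i))"
      using that assms(2) fin_I by (auto intro!: arg_cong[where f=card] simp: Int_def)
    moreover have "of_bool (t < (if i \<in> U \<union> Y then b i else c i)) +
        of_bool (i \<in> Y \<and> b i \<le> t \<and> t < c i) =
        (of_bool (t < (if i \<in> U then b i else c i)) :: nat)" if "i \<in> I" for i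
    proof -
      have "b i \<le> t \<or> t < c i" using b_le_c[OF that] by force
      moreover have "i \<in> Y \<Longrightarrow> i \<notin> U" using \<open>Y \<subseteq> X\<close> assms(3) by auto
      moreover have "t < b i \<Longrightarrow> t < c i" using b_le_c[OF that] by force
      ultimately show ?thesis by auto
    qed
    ultimately show ?thesis unfolding exceed_def by (auto simp flip: sum.distrib intro!: sum.cong)
  qed
  have balanced: "exceed ?S t \<le> exceed ?S' t + 1 \<and> exceed ?S' t \<le> exceed ?S t + 1" for t
  proof -
    define W where "W = {p\<in>{..<m}. b (f p) \<le> t \<and> t < c (f p)}"
    have "\<exists>a e. W = {a..<e}"
    proof (cases "W = {}")
      case True then show ?thesis by (intro exI[of _ 0]) simp
    next
      case False
      have finW: "finite W" by (simp add: W_def)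
      have MW: "Max W \<in> W" "Min W \<in> W" using False finW by auto
      \<comment> \<open>Between two positions hit by \<open>t\<close>, left ends are bounded by that
        of the last and right ends by that of the first, so every position in between is hit as
        well.\<close>
      have "W = {Min W..<Suc (Max W)}"
      proof (intro equalityI subsetI)
        fix p assume "p \<in> W" then show "p \<in> {Min W..<Suc (Max W)}"
          using finW by (simp add: less_Suc_eq_le)
      next
        fix p assume p: "p \<in> {Min W..<Suc (Max W)}"
        then have "p < m" "b (f p) \<le> b (f (Max W))" "c (f (Min W)) \<le> c (f p)"
          using MW f_mono c_mono by (auto simp: W_def)
        then show "p \<in> W" using MW by (auto simp: W_def)
      qed
      then show ?thesis by blast
    qed
    then obtain a e where W: "W = {a..<e}" by blast
    have "{i\<in>X0. b i \<le> t \<and> t < c i} = f ` {p\<in>W. even p}"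
         "{i\<in>X1. b i \<le> t \<and> t < c i} = f ` {p\<in>W. odd p}"
      by (auto simp: X0_def X1_def W_def)
    moreover have "inj_on f {p\<in>W. P p}" for P
      by (rule inj_on_subset[OF inj]) (auto simp: W_def)
    ultimately have "card {i\<in>X0. b i \<le> t \<and> t < c i} = card {p\<in>W. even p}"
      "card {i\<in>X1. b i \<le> t \<and> t < c i} = card {p\<in>W. odd p}"
      by (simp_all add: card_image)
    then show ?thesis using hit[of X0 t] hit[of X1 t] X01 card_even_odd_interval[of a e]
      unfolding W by force
  qed
  have "h2 (exceed2 U X t) = h (exceed ?S t) + h (exceed ?S' t)" for t
    using h2_eq balanced[of t] by (simp flip: ex_sum)
  moreover have "sum E ?S = sum E U + sum E X0" "sum E ?S' = sum E U + sum E X1"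
    by (rule sum.union_disjoint; use fin fin01 X01 assms(3) in auto)+
  moreover have "sum E X = sum E X0 + sum E X1"
    using sum.union_disjoint[OF fin01 X01(2), of E] X01(1) by simp
  ultimately have "total ?S + total ?S' = total2 U X"
    by (simp add: total_def total2_def sum.distrib distrib_left)
  then show ?thesis using card assms X01 by (intro exI[of _ ?S] exI[of _ ?S']) auto
qed

text \<open>Each shift removes two half upgraded suppliers, so induction on their number leads to a
  state without shifts, where rounding applies.\<close>

theorem exchange:
  assumes "S1 \<subseteq> I" "S2 \<subseteq> I" "card S1 + card S2 = 2 * k"
  shows "\<exists>S S'. S \<subseteq> I \<and> S' \<subseteq> I \<and> card S = k \<and> card S' = k \<and> total S + total S' \<le> total S1 + total S2"
proof -
  have main: "\<exists>S S'. S \<subseteq> I \<and> S' \<subseteq> I \<and> card S = k \<and> card S' = k \<and> total S + total S' \<le> total2 U X"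
    if "U \<subseteq> I" "X \<subseteq> I" "U \<inter> X = {}" "2 * card U + card X = 2 * k" for U X
    using that
  proof (induction "card X" arbitrary: U X rule: less_induct)
    case less
    have fin: "finite U" "finite X" using less.prems by (auto intro: finite_subset[OF _ fin_I])
    show ?case
    proof (cases "\<exists>i i'. i \<in> X \<and> i' \<in> X \<and> i \<noteq> i' \<and> b i \<le> b i' \<and> c i' \<le> c i \<and> E i \<le> E i'")
      case True
      then obtain i i' where ii: "i \<in> X" "i' \<in> X" "i \<noteq> i'" "b i \<le> b i'" "c i' \<le> c i" "E i \<le> E i'"
        by blast
      have card_X: "card (X - {i, i'}) + 2 = card X"
      proof -
        have "card {i, i'} = 2" using ii by simp
        moreover have "{i, i'} \<subseteq> X" using ii by auto
        ultimately show ?thesis using fin card_Diff_subset[of "{i, i'}" X] card_mono[of X "{i, i'}"]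
          by simp
      qed
      have "i \<notin> U" using ii(1) less.prems(3) by blast
      then have "card (insert i U) = Suc (card U)" using fin by simp
      then have "2 * card (insert i U) + card (X - {i, i'}) = 2 * k"
        using card_X less.prems(4) by linarith
      moreover have "insert i U \<subseteq> I" "X - {i, i'} \<subseteq> I" "insert i U \<inter> (X - {i, i'}) = {}"
        using less.prems(1-3) ii(1) by blast+
      ultimately obtain S S' where "S \<subseteq> I" "S' \<subseteq> I" "card S = k" "card S' = k"
        "total S + total S' \<le> total2 (insert i U) (X - {i, i'})"
        using less.hyps[of "X - {i, i'}" "insert i U"] card_X by (metis less_add_same_cancel1 zero_less_numeral)
      then show ?thesis using total2_shift[OF less.prems(1-3) ii] order_trans by blast
    next
      case False
      \<comment> \<open>If no shift applies, a nested pair can only consist of identical intervals;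
        but then one of the two orders has the smaller weight first and would allow a shift.\<close>
      have anti: "\<not> (b i \<le> b i' \<and> c i' \<le> c i)" if "i \<in> X" "i' \<in> X" "i \<noteq> i'" for i i'
        using E_nested[of i i'] False less.prems(2) that by (metis order_refl subsetD linear)
      show ?thesis proof -
        obtain S S' where "S \<subseteq> I" "S' \<subseteq> I" "card S = k" "card S' = k" "total S + total S' = total2 U X"
          using total2_split[OF less.prems] anti by blast
        then show ?thesis using eq_refl by blast
      qed
    qed
  qed
  have fin: "finite S1" "finite S2" using assms by (auto intro: finite_subset[OF _ fin_I])
  have "card S1 = card (S1 \<inter> S2) + card (S1 - S2)"
    by (rule card_Int_Diff[OF fin(1)])
  moreover have "card S2 = card (S1 \<inter> S2) + card (S2 - S1)"
    using card_Int_Diff[OF fin(2), of S1] by (simp add: Int_commute)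
  moreover have "card (S1 - S2 \<union> (S2 - S1)) = card (S1 - S2) + card (S2 - S1)"
    by (rule card_Un_disjoint) (use fin in auto)
  ultimately have "2 * card (S1 \<inter> S2) + card (S1 - S2 \<union> (S2 - S1)) = 2 * k"
    using assms(3) by linarith
  with main[of "S1 \<inter> S2" "S1 - S2 \<union> (S2 - S1)"] assms(1,2)
  obtain S S' where "S \<subseteq> I" "S' \<subseteq> I" "card S = k" "card S' = k"
    "total S + total S' \<le> total2 (S1 \<inter> S2) (S1 - S2 \<union> (S2 - S1))" by blast
  then show ?thesis using total2_le[OF assms(1,2)] order_trans by blast
qed

end

section \<open>The Hungarian method\<close>

text \<open>
  The columns \<open>J\<close> are extended by a dummy column \<open>r\<close> that holds the row to be
  inserted; \<open>p j\<close> is the row matched to column \<open>j\<close>, or \<open>\<nu>\<close> if \<open>j\<close> is free.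
\<close>

locale assignment =
  fixes R :: "'r set" and J :: "'c set" and r :: 'c and \<nu> :: 'r
    and C :: "'r \<Rightarrow> 'c \<Rightarrow> 'a::linordered_idom"
  assumes fin_R: "finite R" and fin_J: "finite J" and card_R: "card R = card J"
    and r: "r \<notin> J" and \<nu>: "\<nu> \<notin> R"
begin

definition feasible :: "('r \<Rightarrow> 'a) \<Rightarrow> ('c \<Rightarrow> 'a) \<Rightarrow> bool" where
  "feasible u v \<longleftrightarrow> (\<forall>i\<in>R. \<forall>j\<in>J. u i + v j \<le> C i j)"

definition covers :: "'r set \<Rightarrow> 'c set \<Rightarrow> ('c \<Rightarrow> 'r) \<Rightarrow> bool" where
  "covers Q D p \<longleftrightarrow> (\<forall>j\<in>D. p j \<in> Q \<or> p j = \<nu>) \<and> (\<forall>i\<in>Q. \<exists>!j. j \<in> D \<and> p j = i)"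

definition tight :: "'c set \<Rightarrow> ('c \<Rightarrow> 'r) \<Rightarrow> ('r \<Rightarrow> 'a) \<Rightarrow> ('c \<Rightarrow> 'a) \<Rightarrow> bool" where
  "tight D p u v \<longleftrightarrow> (\<forall>j\<in>D. p j \<noteq> \<nu> \<longrightarrow> u (p j) + v j = C (p j) j)"

text \<open>Every tree edge joins the row of the parent to the column and is tight.
  \<open>depth\<close> witnesses that following \<open>way\<close> ends at the root.\<close>

definition linked :: "'c set \<Rightarrow> ('c \<Rightarrow> nat) \<Rightarrow> ('c \<Rightarrow> 'c) \<Rightarrow> ('c \<Rightarrow> 'r) \<Rightarrow> ('r \<Rightarrow> 'a) \<Rightarrow> ('c \<Rightarrow> 'a) \<Rightarrow> bool" where
  "linked W depth way p u v \<longleftrightarrow> (\<forall>j\<in>W - {r}. way j \<in> W \<and> depth (way j) < depth j \<and>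
     p (way j) \<noteq> \<nu> \<and> u (p (way j)) + v j = C (p (way j)) j)"

text \<open>\<open>W\<close> is an alternating tree rooted at \<open>r\<close>, with parent function \<open>way\<close>.\<close>

definition grown :: "'r set \<Rightarrow> 'c set \<Rightarrow> ('c \<Rightarrow> 'c) \<Rightarrow> ('c \<Rightarrow> 'r) \<Rightarrow> ('r \<Rightarrow> 'a) \<Rightarrow> ('c \<Rightarrow> 'a) \<Rightarrow> bool" where
  "grown Q W way p u v \<longleftrightarrow> feasible u v \<and> Q \<subseteq> R \<and> covers Q (insert r J) p \<and> tight J p u v \<and>
     W \<subseteq> insert r J \<and> r \<in> W \<and> (\<exists>depth. linked W depth way p u v)"

text \<open>
  The path found is flipped from its free end: the column \<open>h\<close> is to receive the row of \<open>way h\<close>,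
  and all rows of \<open>Q\<close> are matched to the other columns.
\<close>

definition hole :: "'r set \<Rightarrow> 'c \<Rightarrow> ('c \<Rightarrow> 'c) \<Rightarrow> ('c \<Rightarrow> 'r) \<Rightarrow> ('r \<Rightarrow> 'a) \<Rightarrow> ('c \<Rightarrow> 'a) \<Rightarrow> ('c \<Rightarrow> nat) \<Rightarrow> bool" where
  "hole Q h way p u v depth \<longleftrightarrow> feasible u v \<and> covers Q (insert r J - {h}) p \<and> tight (J - {h}) p u v \<and>
     (\<exists>W. h \<in> W \<and> W \<subseteq> insert r J \<and> linked {j\<in>W. depth j \<le> depth h} depth way p u v)"

lemma covers_inj: "covers Q D p \<Longrightarrow> j \<in> D \<Longrightarrow> j' \<in> D \<Longrightarrow> p j = p j' \<Longrightarrow> p j \<noteq> \<nu> \<Longrightarrow> j = j'"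
  unfolding covers_def by metis

text \<open>Parking the new row in the dummy column makes a one-column tree. Tightness is claimed on
  \<open>J\<close> only, so the dummy edge needs no cost.\<close>

lemma stage_start:
  assumes "feasible u v" "covers Q J p" "tight J p u v" "insert i Q \<subseteq> R" "i \<notin> Q"
  shows "grown (insert i Q) {r} way (p(r := i)) u v"
proof -
  have "covers (insert i Q) (insert r J) (p(r := i))"
    unfolding covers_def
  proof (intro conjI ballI)
    fix j assume "j \<in> insert r J"
    then show "(p(r := i)) j \<in> insert i Q \<or> (p(r := i)) j = \<nu>"
      using assms(2) unfolding covers_def by auto
  next
    fix i' assume i': "i' \<in> insert i Q"
    show "\<exists>!j. j \<in> insert r J \<and> (p(r := i)) j = i'"
    proof (cases "i' = i")
      case True
      have "p j \<noteq> i" if "j \<in> J" for j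
      proof -
        have "p j \<in> Q \<or> p j = \<nu>" using assms(2) that unfolding covers_def by blast
        moreover have "i \<noteq> \<nu>" using assms(4) \<nu> by blast
        ultimately show ?thesis using assms(5) by metis
      qed
      then show ?thesis using True r by (intro ex1I[of _ r]) (auto split: if_splits)
    next
      case False
      then have "i' \<in> Q" using i' by simp
      then obtain j where j: "j \<in> J" "p j = i'" "\<And>j'. j' \<in> J \<Longrightarrow> p j' = i' \<Longrightarrow> j' = j"
        using assms(2) unfolding covers_def by blast
      have "j \<noteq> r" using j(1) r by blast
      show ?thesis
      proof (rule ex1I[of _ j])
        show "j \<in> insert r J \<and> (p(r := i)) j = i'" using j(1,2) \<open>j \<noteq> r\<close> by simp
      next
        fix j' assume a: "j' \<in> insert r J \<and> (p(r := i)) j' = i'"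
        then have "j' \<noteq> r" using False by (cases "j' = r") simp_all
        then show "j' = j" using a j(3)[of j'] by simp
      qed
    qed
  qed
  moreover have "tight J (p(r := i)) u v" unfolding tight_def
  proof (intro ballI impI)
    fix j assume "j \<in> J" "(p(r := i)) j \<noteq> \<nu>"
    moreover from this have "j \<noteq> r" using r by blast
    ultimately show "u ((p(r := i)) j) + v j = C ((p(r := i)) j) j"
      using assms(3) unfolding tight_def by simp
  qed
  moreover have "linked {r} (\<lambda>_. 0) way (p(r := i)) u v" unfolding linked_def by simp
  then have "\<exists>d. linked {r} d way (p(r := i)) u v" by blast
  ultimately show ?thesis using assms(1,4) unfolding grown_def by simp
qed

text \<open>Pigeonhole: the columns of \<open>U\<close> carry distinct rows, so there are at most
  \<open>card J\<close> of them; since one is the dummy, some column of \<open>J\<close> is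
  missing.\<close>

lemma unused_exists:
  assumes "grown Q U way p u v" "\<forall>j\<in>U. p j \<noteq> \<nu>"
  shows "\<exists>j. j \<in> J - U"
proof -
  have cov: "covers Q (insert r J) p" and U: "U \<subseteq> insert r J" "r \<in> U" and Q: "Q \<subseteq> R"
    using assms(1) unfolding grown_def by simp_all
  have fin: "finite U" using finite_subset[OF U(1)] fin_J by simp
  have "inj_on p U"
  proof (rule inj_onI)
    fix x y assume "x \<in> U" "y \<in> U" "p x = p y"
    then show "x = y" using covers_inj[OF cov, of x y] assms(2) U(1) by blast
  qed
  moreover have "p ` U \<subseteq> R"
  proof
    fix i assume "i \<in> p ` U"
    then obtain j where "j \<in> U" "i = p j" by (rule imageE)
    moreover from this have "p j \<noteq> \<nu>" "p j \<in> Q \<or> p j = \<nu>"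
      using assms(2) cov U(1) unfolding covers_def by blast+
    ultimately show "i \<in> R" using Q by auto
  qed
  ultimately have "card U \<le> card J" using card_R card_mono[OF fin_R] card_image[of p U] by metis
  moreover have "card (U - {r}) < card U" using U fin by (intro card_Diff1_less) auto
  ultimately have lt: "card (U - {r}) < card J" by simp
  show ?thesis
  proof (rule ccontr)
    assume "\<nexists>j. j \<in> J - U"
    then have "J \<subseteq> U - {r}" using r by blast
    then have "card J \<le> card (U - {r})" using fin by (intro card_mono) auto
    with lt show False by simp
  qed
qed

text \<open>Rows of the tree rise and its columns fall by the least slack \<open>\<delta>\<close>.
  Sums inside the tree do not change, minimality keeps the edges leaving it feasible, and the edge
  to \<open>j1\<close> becomes tight. The new potentials are prescribed only at actual rows and
  columns, so arrays may hold anything elsewhere.\<close>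

lemma tree_step:
  assumes g: "grown Q U way p u v" and U\<nu>: "\<forall>j\<in>U. p j \<noteq> \<nu>"
    and jw: "jw \<in> U" and j1: "j1 \<in> J" "j1 \<notin> U"
    and \<delta>: "\<delta> = C (p jw) j1 - u (p jw) - v j1"
    and min: "\<And>j' j. j' \<in> U \<Longrightarrow> j \<in> J - U \<Longrightarrow> \<delta> \<le> C (p j') j - u (p j') - v j"
    and u': "\<And>i. i \<in> R \<Longrightarrow> u' i = (if i \<in> p ` U then u i + \<delta> else u i)"
    and v': "\<And>j. j \<in> insert r J \<Longrightarrow> v' j = (if j \<in> U then v j - \<delta> else v j)"
  shows "grown Q (insert j1 U) (way(j1 := jw)) p u' v'"
proof -
  have cov: "covers Q (insert r J) p" and U: "U \<subseteq> insert r J" "r \<in> U" and Q: "Q \<subseteq> R"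
    and feas: "feasible u v" and ti: "tight J p u v"
    using g unfolding grown_def by simp_all
  obtain d where d: "linked U d way p u v" using g unfolding grown_def by blast
  have pR: "p j \<in> R" if "j \<in> insert r J" "p j \<noteq> \<nu>" for j using that cov Q unfolding covers_def by blast
  have \<delta>0: "0 \<le> \<delta>" 
  proof -
    have "p jw \<in> R" using pR[of jw] U\<nu> jw U by blast
    then have "u (p jw) + v j1 \<le> C (p jw) j1" using feas j1 unfolding feasible_def by blast
    then show ?thesis unfolding \<delta> by (simp add: algebra_simps)
  qed
  have "feasible u' v'" unfolding feasible_def
  proof (intro ballI)
    fix i j assume ij: "i \<in> R" "j \<in> J"
    have uv: "u i + v j \<le> C i j" using feas ij unfolding feasible_def by blast
    show "u' i + v' j \<le> C i j"
    proof (cases "i \<in> p ` U \<and> j \<notin> U")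
      case True
      then obtain j' where "j' \<in> U" "p j' = i" by blast
      then show ?thesis using min[of j' j] True ij u' v' by (auto simp: algebra_simps)
    next
      case False
      then show ?thesis using uv \<delta>0 ij u' v' by auto
    qed
  qed
  moreover have "tight J p u' v'" unfolding tight_def
  proof (intro ballI impI)
    fix j assume j: "j \<in> J" "p j \<noteq> \<nu>"
    have "p j \<in> p ` U \<longleftrightarrow> j \<in> U" 
      using covers_inj[OF cov, of j] j U by blast
    then show "u' (p j) + v' j = C (p j) j"
      using ti j u'[OF pR[of j]] v'[of j] unfolding tight_def by (cases "j \<in> U") auto
  qed
  moreover have "linked (insert j1 U) (d(j1 := Suc (d jw))) (way(j1 := jw)) p u' v'"
    unfolding linked_def
  proof (intro ballI)
    fix j assume j: "j \<in> insert j1 U - {r}"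
    show "(way(j1 := jw)) j \<in> insert j1 U \<and> (d(j1 := Suc (d jw))) ((way(j1 := jw)) j) < (d(j1 := Suc (d jw))) j \<and>
      p ((way(j1 := jw)) j) \<noteq> \<nu> \<and> u' (p ((way(j1 := jw)) j)) + v' j = C (p ((way(j1 := jw)) j)) j"
    proof (cases "j = j1")
      case True
      have "jw \<noteq> j1" using jw j1 by blast
      have "u' (p jw) = u (p jw) + \<delta>" "v' j1 = v j1" using u'[OF pR[of jw]] v'[of j1] jw U U\<nu> j1 by auto
      with True \<open>jw \<noteq> j1\<close> show ?thesis using jw U\<nu> by (simp add: \<delta>)
    next
      case False
      then have jU: "j \<in> U" "j \<noteq> r" using j by auto
      then have w: "way j \<in> U" "d (way j) < d j" "p (way j) \<noteq> \<nu>" "u (p (way j)) + v j = C (p (way j)) j"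
        using d unfolding linked_def by auto
      moreover have "way j \<noteq> j1" using w(1) j1 by blast
      moreover have "u' (p (way j)) = u (p (way j)) + \<delta>" "v' j = v j - \<delta>"
        using u'[OF pR[of "way j"]] v'[of j] jU U w by auto
      ultimately show ?thesis using False by simp
    qed
  qed
  ultimately show ?thesis using cov Q U j1 unfolding grown_def by blast
qed

text \<open>The free end of the path is the first hole: it holds no row, so leaving it out of the
  cover loses nothing.\<close>

lemma hole_start:
  assumes "grown Q W way p u v" "j0 \<in> W" "p j0 = \<nu>"
  shows "\<exists>depth. hole Q j0 way p u v depth"
proof -
  obtain d where d: "linked W d way p u v" using assms(1) unfolding grown_def by blast
  have cov: "covers Q (insert r J) p" and W: "W \<subseteq> insert r J"
    and Q: "Q \<subseteq> R" and fe: "feasible u v" and ti: "tight J p u v"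
    using assms(1) unfolding grown_def by simp_all
  have "covers Q (insert r J - {j0}) p" unfolding covers_def
  proof (intro conjI ballI)
    fix j assume "j \<in> insert r J - {j0}"
    then show "p j \<in> Q \<or> p j = \<nu>" using cov unfolding covers_def by blast
  next
    fix i assume i: "i \<in> Q"
    then have "i \<noteq> \<nu>" using Q \<nu> by blast
    with assms(3) have "j \<in> insert r J - {j0} \<and> p j = i \<longleftrightarrow> j \<in> insert r J \<and> p j = i" for j by auto
    then show "\<exists>!j. j \<in> insert r J - {j0} \<and> p j = i" using cov i unfolding covers_def by simp
  qed
  moreover have "linked {j\<in>W. d j \<le> d j0} d way p u v"
    unfolding linked_def
  proof
    fix j assume j: "j \<in> {j\<in>W. d j \<le> d j0} - {r}"
    then have "way j \<in> W" "d (way j) < d j" "p (way j) \<noteq> \<nu>" "u (p (way j)) + v j = C (p (way j)) j"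
      using d unfolding linked_def by auto
    with j show "way j \<in> {j\<in>W. d j \<le> d j0} \<and> d (way j) < d j \<and> p (way j) \<noteq> \<nu> \<and>
        u (p (way j)) + v j = C (p (way j)) j" by simp
  qed
  moreover have "tight (J - {j0}) p u v" using ti unfolding tight_def by blast
  ultimately show ?thesis using fe W assms(2) unfolding hole_def by blast
qed

text \<open>Moving the row of \<open>way h\<close> into \<open>h\<close> turns \<open>way h\<close>
  into the hole. Tree edges are claimed only up to the depth of the hole, because flipping has
  changed rows below it.\<close>

lemma hole_step:
  assumes hole: "hole Q h way p u v depth" and "h \<noteq> r"
  shows "way h \<in> insert r J" "depth (way h) < depth h" "hole Q (way h) way (p(h := p (way h))) u v depth"
proof -
  obtain W where W: "h \<in> W" "W \<subseteq> insert r J" and l: "linked {j\<in>W. depth j \<le> depth h} depth way p u v"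
    using hole unfolding hole_def by blast
  have cov: "covers Q (insert r J - {h}) p" and fe: "feasible u v" and ti: "tight (J - {h}) p u v"
    using hole unfolding hole_def by simp_all
  let ?w = "way h" and ?p = "p(h := p (way h))"
  have w: "?w \<in> W" "depth ?w < depth h" "p ?w \<noteq> \<nu>" "u (p ?w) + v h = C (p ?w) h"
    using l W \<open>h \<noteq> r\<close> unfolding linked_def by auto
  then have wh: "?w \<noteq> h" by auto
  show "way h \<in> insert r J" "depth (way h) < depth h" using w W by auto
  have wD: "?w \<in> insert r J - {h}" using w(1) W(2) wh by blast
  have "covers Q (insert r J - {?w}) ?p" unfolding covers_def
  proof (intro conjI ballI)
    fix j assume "j \<in> insert r J - {?w}"
    then show "?p j \<in> Q \<or> ?p j = \<nu>" using cov wD unfolding covers_def by auto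
  next
    fix i assume i: "i \<in> Q"
    then have "\<exists>!j. j \<in> insert r J - {h} \<and> p j = i" using cov unfolding covers_def by simp
    then obtain j where j: "j \<in> insert r J - {h}" "p j = i" "\<And>j'. j' \<in> insert r J - {h} \<Longrightarrow> p j' = i \<Longrightarrow> j' = j"
      by metis
    show "\<exists>!j. j \<in> insert r J - {?w} \<and> ?p j = i"
    proof (cases "j = ?w")
      case True
      show ?thesis
      proof (rule ex1I[of _ h])
        show "h \<in> insert r J - {?w} \<and> ?p h = i" using True j(2) wh W by auto
      next
        fix j' assume a: "j' \<in> insert r J - {?w} \<and> ?p j' = i"
        show "j' = h"
        proof (rule ccontr)
          assume "j' \<noteq> h"
          then have "j' = ?w" using a j(3)[of j'] True by simp
          then show False using a by blast
        qed
      qed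
    next
      case False
      have "p ?w \<noteq> i" using False j(3)[OF wD] by blast
      show ?thesis
      proof (rule ex1I[of _ j])
        show "j \<in> insert r J - {?w} \<and> ?p j = i" using False j(1,2) by auto
      next
        fix j' assume a: "j' \<in> insert r J - {?w} \<and> ?p j' = i"
        then have "j' \<noteq> h" using \<open>p ?w \<noteq> i\<close> by (cases "j' = h") simp_all
        then show "j' = j" using a j(3)[of j'] by simp
      qed
    qed
  qed
  moreover have "tight (J - {?w}) ?p u v" using ti w(4) unfolding tight_def by auto
  moreover have "linked {j\<in>W. depth j \<le> depth ?w} depth way ?p u v"
    unfolding linked_def
  proof (intro ballI)
    fix j assume j: "j \<in> {j\<in>W. depth j \<le> depth ?w} - {r}"
    then have "j \<in> {j\<in>W. depth j \<le> depth h} - {r}" using w(2) by auto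
    then have *: "way j \<in> W" "depth (way j) < depth j" "p (way j) \<noteq> \<nu>" "u (p (way j)) + v j = C (p (way j)) j"
      using l unfolding linked_def by auto
    moreover have "way j \<noteq> h" using *(2) j w(2) by auto
    ultimately show "way j \<in> {j\<in>W. depth j \<le> depth ?w} \<and> depth (way j) < depth j \<and>
       ?p (way j) \<noteq> \<nu> \<and> u (?p (way j)) + v j = C (?p (way j)) j" using j by auto
  qed
  ultimately show "hole Q ?w way ?p u v depth" using fe w(1) W(2) unfolding hole_def by blast
qed

lemma hole_root:
  "hole Q r way p u v depth \<Longrightarrow> feasible u v \<and> covers Q J p \<and> tight J p u v"
  unfolding hole_def using r by (auto simp: Diff_insert_absorb)

text \<open>All rows occur among the \<open>card J\<close> values of \<open>p\<close>; by counting,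
  no value is left for \<open>\<nu>\<close> or for a repetition.\<close>

lemma covers_all:
  assumes "covers R J p"
  shows "bij_betw p J R"
proof -
  have "R \<subseteq> p ` J" using assms unfolding covers_def by blast
  then have "card R \<le> card (p ` J)" using fin_J by (intro card_mono) auto
  then have card: "card (p ` J) = card J" using card_R card_image_le[OF fin_J, of p] by simp
  have "p ` J = R"
    by (rule card_seteq[symmetric]) (use \<open>R \<subseteq> p ` J\<close> fin_J card card_R in auto)
  moreover have "inj_on p J" using eq_card_imp_inj_on[OF fin_J card] .
  ultimately show ?thesis by (auto simp: bij_betw_def)
qed

text \<open>A dual solution with complementary slackness, that is, a certificate that the assignment
  is optimal.\<close>

definition dual_optimal :: "('c \<Rightarrow> 'r) \<Rightarrow> ('r \<Rightarrow> 'a) \<Rightarrow> ('c \<Rightarrow> 'a) \<Rightarrow> bool" where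
  "dual_optimal p u v \<longleftrightarrow> feasible u v \<and> bij_betw p J R \<and> (\<forall>j\<in>J. u (p j) + v j = C (p j) j)"

lemma dual_optimalI: "feasible u v \<Longrightarrow> covers R J p \<Longrightarrow> tight J p u v \<Longrightarrow> dual_optimal p u v"
  unfolding dual_optimal_def tight_def using covers_all[of p] \<nu> by (auto simp: bij_betw_def)

text \<open>The tree grows until it contains a free column, by induction on the columns outside it;
  then the path is flipped, by induction on the depth of the hole. The program follows the same two
  loops.\<close>

lemma stage_exists:
  assumes "feasible u v" "covers Q J p" "tight J p u v" "insert i Q \<subseteq> R" "i \<notin> Q"
  shows "\<exists>p u v. feasible u v \<and> covers (insert i Q) J p \<and> tight J p u v"
proof -
  have grow: "\<exists>W way u v j. grown (insert i Q) W way p u v \<and> j \<in> W \<and> p j = \<nu>"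
    if "grown (insert i Q) U way p u v" for U way p u v
    using that
  proof (induction "card (J - U)" arbitrary: U way u v rule: less_induct)
    case less
    show ?case
    proof (cases "\<exists>j\<in>U. p j = \<nu>")
      case True then show ?thesis using less.prems by blast
    next
      case False
      then have U\<nu>: "\<forall>j\<in>U. p j \<noteq> \<nu>" by blast
      let ?P = "U \<times> (J - U)"
      let ?s = "\<lambda>(j', j). C (p j') j - u (p j') - v j"
      have "finite U" using less.prems fin_J finite_subset[of U "insert r J"] unfolding grown_def by simp
      then have fin: "finite ?P" using fin_J by blast
      have "r \<in> U" using less.prems unfolding grown_def by blast
      then have "?P \<noteq> {}" using unused_exists[OF less.prems U\<nu>] by blast
      then obtain x where x: "x \<in> ?P" "\<And>y. y \<in> ?P \<Longrightarrow> ?s x \<le> ?s y"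
        using ex_is_arg_min_if_finite[OF fin, of ?s] unfolding is_arg_min_linorder by blast
      obtain jw j1 where [simp]: "x = (jw, j1)" by (cases x)
      have x': "jw \<in> U" "j1 \<in> J" "j1 \<notin> U" using x by auto
      let ?d = "?s x"
      have "grown (insert i Q) (insert j1 U) (way(j1 := jw)) p
         (\<lambda>i. if i \<in> p ` U then u i + ?d else u i) (\<lambda>j. if j \<in> U then v j - ?d else v j)"
        by (rule tree_step[OF less.prems U\<nu> x', of ?d])
           (use x(2) in \<open>auto simp: less_imp_le\<close>)
      moreover have "card (J - insert j1 U) < card (J - U)"
        by (rule psubset_card_mono) (use x' fin_J in auto)
      ultimately show ?thesis using less.hyps by blast
    qed
  qed
  obtain W way u' v' j where "grown (insert i Q) W way (p(r := i)) u' v'" "j \<in> W" "(p(r := i)) j = \<nu>"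
    using grow[OF stage_start[OF assms]] by blast
  then obtain depth where "hole (insert i Q) j way (p(r := i)) u' v' depth" using hole_start by blast
  moreover have "\<exists>p'. hole (insert i Q) r way p' u' v' depth" if "hole (insert i Q) j way p' u' v' depth" for j p'
    using that
  proof (induction "depth j" arbitrary: j p' rule: less_induct)
    case less
    show ?case
    proof (cases "j = r")
      case True then show ?thesis using less.prems by blast
    next
      case False
      show ?thesis
        by (rule less.hyps[OF hole_step(2,3)[OF less.prems False]])
    qed
  qed
  ultimately show ?thesis using hole_root by blast
qed

theorem dual_optimal_exists: "\<exists>p u v. dual_optimal p u v"
proof -
  have "\<exists>p u v. feasible u v \<and> covers Q J p \<and> tight J p u v" if "Q \<subseteq> R" for Q
    using finite_subset[OF that fin_R] that
  proof (induction Q rule: finite_induct)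
    case empty
    let ?u = "\<lambda>i. Min (C i ` J)"
    have "feasible ?u (\<lambda>_. 0)" using fin_J unfolding feasible_def by simp
    moreover have "covers {} J (\<lambda>_. \<nu>)" "tight J (\<lambda>_. \<nu>) u v" for u v
      unfolding covers_def tight_def by auto
    ultimately show ?case by blast
  next
    case (insert i Q)
    then show ?case using stage_exists[of _ _ Q _ i] by blast
  qed
  then show ?thesis using dual_optimalI by blast
qed

text \<open>Weak duality against a doubly stochastic \<open>z\<close>. It gives integrality of the
  assignment problem without decomposing \<open>z\<close> into permutations.\<close>

lemma dual_optimal_le:
  assumes "dual_optimal p u v"
    and z: "\<And>i j. i \<in> R \<Longrightarrow> j \<in> J \<Longrightarrow> 0 \<le> z i j"
    and row: "\<And>i. i \<in> R \<Longrightarrow> (\<Sum>j\<in>J. z i j) = 1" and col: "\<And>j. j \<in> J \<Longrightarrow> (\<Sum>i\<in>R. z i j) = 1"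
  shows "(\<Sum>j\<in>J. C (p j) j) \<le> (\<Sum>i\<in>R. \<Sum>j\<in>J. C i j * z i j)"
proof -
  have fe: "feasible u v" and bij: "bij_betw p J R" and t: "\<And>j. j \<in> J \<Longrightarrow> C (p j) j = u (p j) + v j"
    using assms(1) unfolding dual_optimal_def by auto
  have "(\<Sum>j\<in>J. C (p j) j) = (\<Sum>j\<in>J. u (p j)) + (\<Sum>j\<in>J. v j)"
    unfolding sum.distrib[symmetric] by (rule sum.cong) (auto simp: t)
  also have "(\<Sum>j\<in>J. u (p j)) = (\<Sum>i\<in>R. u i)" by (rule sum.reindex_bij_betw[OF bij])
  also have "\<dots> = (\<Sum>i\<in>R. \<Sum>j\<in>J. u i * z i j)"
    by (rule sum.cong) (auto simp: row simp flip: sum_distrib_left)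
  also have "(\<Sum>j\<in>J. v j) = (\<Sum>j\<in>J. \<Sum>i\<in>R. v j * z i j)"
    by (rule sum.cong) (auto simp: col simp flip: sum_distrib_left)
  also have "\<dots> = (\<Sum>i\<in>R. \<Sum>j\<in>J. v j * z i j)" by (rule sum.swap)
  also have "(\<Sum>i\<in>R. \<Sum>j\<in>J. u i * z i j) + \<dots> = (\<Sum>i\<in>R. \<Sum>j\<in>J. (u i + v j) * z i j)"
    by (simp add: sum.distrib distrib_right)
  also have "\<dots> \<le> (\<Sum>i\<in>R. \<Sum>j\<in>J. C i j * z i j)"
    by (intro sum_mono mult_right_mono) (use fe z in \<open>auto simp: feasible_def\<close>)
  finally show ?thesis .
qed

lemma dual_optimal_bij_le:
  assumes "dual_optimal p u v" and q: "bij_betw q J R"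
  shows "(\<Sum>j\<in>J. C (p j) j) \<le> (\<Sum>j\<in>J. C (q j) j)"
proof -
  have fe: "feasible u v" and bij: "bij_betw p J R" and t: "\<And>j. j \<in> J \<Longrightarrow> C (p j) j = u (p j) + v j"
    using assms(1) unfolding dual_optimal_def by auto
  have "(\<Sum>j\<in>J. C (p j) j) = (\<Sum>j\<in>J. u (p j)) + (\<Sum>j\<in>J. v j)"
    unfolding sum.distrib[symmetric] by (rule sum.cong) (auto simp: t)
  also have "(\<Sum>j\<in>J. u (p j)) = (\<Sum>j\<in>J. u (q j))"
    using sum.reindex_bij_betw[OF bij, of u] sum.reindex_bij_betw[OF q, of u] by simp
  also have "\<dots> + (\<Sum>j\<in>J. v j) \<le> (\<Sum>j\<in>J. C (q j) j)"
    unfolding sum.distrib[symmetric]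
    by (rule sum_mono) (use fe q in \<open>auto simp: feasible_def bij_betw_def\<close>)
  finally show ?thesis .
qed

end

section \<open>Supporting lines of convex sequences\<close>

text \<open>Convexity orders the slopes, so the bounds on the two slopes beside \<open>k\<close>
  pass to all slopes on their side and add up.\<close>

lemma convex_sequence_support:
  fixes v :: "nat \<Rightarrow> 'a::linordered_idom"
  assumes convex: "\<And>k. 0 < k \<Longrightarrow> k < n \<Longrightarrow> 2 * v k \<le> v (k - 1) + v (k + 1)"
    and right: "k < n \<Longrightarrow> v k - v (k + 1) \<le> \<mu>" and left: "0 < k \<Longrightarrow> \<mu> \<le> v (k - 1) - v k"
    and "k \<le> n" "j \<le> n"
  shows "v k + \<mu> * of_nat k \<le> v j + \<mu> * of_nat j"
proof (cases "k \<le> j")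
  case True
  have slope: "v (k + t) - v (k + t + 1) \<le> \<mu>" if "k + t < n" for t
    using that
  proof (induction t)
    case 0 then show ?case using right by simp
  next
    case (Suc t)
    then show ?case using convex[of "k + Suc t"] by (simp add: algebra_simps)
  qed
  have "v k + \<mu> * of_nat k \<le> v (k + t) + \<mu> * of_nat (k + t)" if "k + t \<le> n" for t
    using that
  proof (induction t)
    case (Suc t)
    then show ?case using slope[of t] by (simp add: algebra_simps)
  qed simp
  from this[of "j - k"] True \<open>j \<le> n\<close> show ?thesis by simp
next
  case False
  have slope: "\<mu> \<le> v (k - t - 1) - v (k - t)" if "t < k" for t
    using that
  proof (induction t)
    case 0 then show ?case using left by simp
  next
    case (Suc t)
    \<comment> \<open>The index \<open>a\<close> is \<open>k - t - 2\<close>; naming it avoids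
      truncated subtraction.\<close>
    then obtain a where k: "k = Suc (a + Suc t)" using less_iff_Suc_add[of "Suc t" k] by (auto simp: add.commute)
    have "2 * v (Suc a) \<le> v a + v (Suc a + 1)" using convex[of "Suc a"] k \<open>k \<le> n\<close> by simp
    moreover have "\<mu> \<le> v (Suc a) - v (Suc a + 1)" using Suc k by simp
    ultimately have "\<mu> \<le> v a - v (Suc a)" by linarith
    then show ?case using k by simp
  qed
  have "v k + \<mu> * of_nat k \<le> v (k - t) + \<mu> * of_nat (k - t)" if "t \<le> k" for t
    using that
  proof (induction t)
    case (Suc t)
    then have "v k + \<mu> * of_nat k \<le> v (k - t) + \<mu> * of_nat (k - t)" by simp
    moreover obtain a where k: "k = a + Suc t" using Suc.prems le_Suc_ex[of "Suc t" k] by (auto simp: add.commute)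
    ultimately have "v k + \<mu> * of_nat k \<le> v (Suc a) + \<mu> * of_nat (Suc a)" by simp
    moreover have "\<mu> \<le> v a - v (Suc a)" using slope[of t] k by simp
    moreover have "\<mu> * of_nat (Suc a) = \<mu> * of_nat a + \<mu>" by (simp add: algebra_simps)
    ultimately have "v k + \<mu> * of_nat k \<le> v a + \<mu> * of_nat a" by linarith
    then show ?case using k by simp
  qed simp
  from this[of "k - j"] False show ?thesis by simp
qed

text \<open>Embedding by \<open>Some\<close> leaves \<open>None\<close> as a fresh dummy column and
  as the mark of free columns.\<close>

lemma assignment_duality:
  fixes C :: "'i \<Rightarrow> 'j \<Rightarrow> 'a::linordered_idom"
  assumes fin: "finite I" "finite J" and card: "card I = card J"
  obtains p where "bij_betw p J I"
    "\<And>z. (\<And>i j. i \<in> I \<Longrightarrow> j \<in> J \<Longrightarrow> 0 \<le> z i j) \<Longrightarrow> (\<And>i. i \<in> I \<Longrightarrow> (\<Sum>j\<in>J. z i j) = 1) \<Longrightarrow>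
       (\<And>j. j \<in> J \<Longrightarrow> (\<Sum>i\<in>I. z i j) = 1) \<Longrightarrow>
       (\<Sum>j\<in>J. C (p j) j) \<le> (\<Sum>i\<in>I. \<Sum>j\<in>J. C i j * z i j)"
proof -
  let ?C = "\<lambda>i j. C (the i) (the j)"
  interpret assignment "Some ` I" "Some ` J" None None ?C
    by unfold_locales (use fin card in \<open>auto simp: card_image\<close>)
  obtain p u v where p: "dual_optimal p u v" using dual_optimal_exists by blast
  then have bij: "bij_betw p (Some ` J) (Some ` I)" unfolding dual_optimal_def by blast
  have bS: "bij_betw Some J (Some ` J)" and bT: "bij_betw the (Some ` I) I"
    by (auto simp: bij_betw_def inj_on_def)
  have b: "bij_betw (\<lambda>j. the (p (Some j))) J I"
    using bij_betw_trans[OF bij_betw_trans[OF bS bij] bT] by (simp add: comp_def)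
  show thesis
  proof (rule that[OF b])
    fix z :: "'i \<Rightarrow> 'j \<Rightarrow> 'a"
    assume z: "\<And>i j. i \<in> I \<Longrightarrow> j \<in> J \<Longrightarrow> 0 \<le> z i j" "\<And>i. i \<in> I \<Longrightarrow> (\<Sum>j\<in>J. z i j) = 1"
      "\<And>j. j \<in> J \<Longrightarrow> (\<Sum>i\<in>I. z i j) = 1"
    have "(\<Sum>j\<in>Some ` J. ?C (p j) j) \<le>
        (\<Sum>i\<in>Some ` I. \<Sum>j\<in>Some ` J. ?C i j * z (the i) (the j))"
      by (rule dual_optimal_le[OF p]) (use z in \<open>auto simp: sum.reindex\<close>)
    then show "(\<Sum>j\<in>J. C (the (p (Some j))) j) \<le> (\<Sum>i\<in>I. \<Sum>j\<in>J. C i j * z i j)"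
      by (simp add: sum.reindex)
  qed
qed

section \<open>The value of an upgrade set and its convexity\<close>

locale upgrade_data =
  fixes I :: "'i set" and J :: "'j set" and b c E :: "'i \<Rightarrow> 'a::linordered_idom" and d :: "'j \<Rightarrow> 'a"
  assumes fin_I: "finite I" and fin_J: "finite J" and card_IJ: "card I = card J"
    and b_nonneg: "i \<in> I \<Longrightarrow> 0 \<le> b i" and b_le_c: "i \<in> I \<Longrightarrow> b i \<le> c i"
    and d_nonneg: "j \<in> J \<Longrightarrow> 0 \<le> d j"
    and E_nested: "i \<in> I \<Longrightarrow> i' \<in> I \<Longrightarrow> b i \<le> b i' \<Longrightarrow> c i' \<le> c i \<Longrightarrow>
      E i \<le> E i' \<or> b i = b i' \<and> c i = c i'"
begin

definition plan_cost :: "'i set \<Rightarrow> ('j \<Rightarrow> 'i) \<Rightarrow> 'a" where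
  "plan_cost S p = (\<Sum>j\<in>J. (if p j \<in> S then b (p j) else c (p j)) * d j) + sum E S"

text \<open>At threshold \<open>t\<close> a plan pays for the demands of all customers whose
  supplier costs more than \<open>t\<close>, which is at least the sum \<open>h\<close> of that many
  smallest demands. Pairing increasing demands with decreasing costs attains these bounds for all
  thresholds at once.\<close>

lemma plan_cost_representation:
  obtains T \<omega> h where "interval_system I b c E T \<omega> h"
    "\<And>S p. S \<subseteq> I \<Longrightarrow> bij_betw p J I \<Longrightarrow> interval_system.total I b c E T \<omega> h S \<le> plan_cost S p"
    "\<And>S. S \<subseteq> I \<Longrightarrow> \<exists>p. bij_betw p J I \<and> plan_cost S p = interval_system.total I b c E T \<omega> h S"
proof -
  define n where "n = card J"
  have V: "finite (b ` I \<union> c ` I)" "\<forall>v\<in>b ` I \<union> c ` I. 0 \<le> v"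
    using fin_I b_nonneg order_trans[OF b_nonneg b_le_c] by auto
  obtain T \<omega> where *: "finite T \<and> (\<forall>t\<in>T. 0 \<le> \<omega> t) \<and> (\<forall>t\<in>T. \<exists>v\<in>b ` I \<union> c ` I. t < v) \<and>
      (\<forall>v\<in>b ` I \<union> c ` I. v = (\<Sum>t\<in>T. if t < v then \<omega> t else 0))"
    using step_decomposition[OF V] by (elim exE)
  then have T: "finite T" "\<forall>t\<in>T. 0 \<le> \<omega> t" by simp_all
  have dec: "\<forall>v\<in>b ` I \<union> c ` I. v = (\<Sum>t\<in>T. if t < v then \<omega> t else 0)"
    using * by (elim conjE)
  obtain e where e: "bij_betw e {..<n} J" and "\<forall>p q. p \<le> q \<longrightarrow> q < n \<longrightarrow> d (e p) \<le> d (e q)"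
    using sorted_enumeration[OF fin_J, of d] unfolding n_def by blast
  then have e_mono: "\<And>p q. p \<le> q \<Longrightarrow> q < n \<Longrightarrow> d (e p) \<le> d (e q)" by blast
  have inj_e: "inj_on e {..<n}" and e_in: "\<And>q. q < n \<Longrightarrow> e q \<in> J"
    using e by (auto simp: bij_betw_def)
  define h where "h m = (\<Sum>q<m. d (e q))" for m
  interpret interval_system I b c E T \<omega> h
  proof
    show "h p \<le> h q" if "p \<le> q" "q \<le> card I" for p q
      unfolding h_def by (rule sum_mono2) (use that d_nonneg e_in card_IJ n_def in auto)
    show "h (p + k) + h q \<le> h p + h (q + k)" if "p \<le> q" "q + k \<le> card I" for p q k
      unfolding h_def by (rule sum_lessThan_convex[OF e_mono]) (use that card_IJ n_def in auto)
  qed (use fin_I b_le_c T E_nested in auto)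
  let ?a = "\<lambda>S i. if i \<in> S then b i else c i"
  have cost_eq: "plan_cost S p = (\<Sum>t\<in>T. \<omega> t * (\<Sum>j\<in>{j\<in>J. t < ?a S (p j)}. d j)) + sum E S"
    if "bij_betw p J I" for S p
  proof -
    have a: "?a S (p j) = (\<Sum>t\<in>T. if t < ?a S (p j) then \<omega> t else 0)" if "j \<in> J" for j
    proof -
      have "p j \<in> I" using \<open>bij_betw p J I\<close> that by (auto simp: bij_betw_def)
      then have "?a S (p j) \<in> b ` I \<union> c ` I" by simp
      then show ?thesis by (rule bspec[OF dec])
    qed
    have "(\<Sum>j\<in>J. ?a S (p j) * d j) = (\<Sum>j\<in>J. \<Sum>t\<in>T. \<omega> t * (if t < ?a S (p j) then d j else 0))"
    proof (rule sum.cong[OF refl])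
      fix j assume j: "j \<in> J"
      have "?a S (p j) * d j = (\<Sum>t\<in>T. if t < ?a S (p j) then \<omega> t else 0) * d j"
        using a[OF j] by presburger
      also have "\<dots> = (\<Sum>t\<in>T. \<omega> t * (if t < ?a S (p j) then d j else 0))"
        unfolding sum_distrib_right by (rule sum.cong) auto
      finally show "?a S (p j) * d j = \<dots>" .
    qed
    also have "\<dots> = (\<Sum>t\<in>T. \<Sum>j\<in>J. \<omega> t * (if t < ?a S (p j) then d j else 0))" by (rule sum.swap)
    also have "\<dots> = (\<Sum>t\<in>T. \<omega> t * (\<Sum>j\<in>{j\<in>J. t < ?a S (p j)}. d j))"
      unfolding sum_distrib_left[symmetric]
      by (rule sum.cong[OF refl]) (simp add: sum.inter_filter[OF fin_J])
    finally show ?thesis unfolding plan_cost_def by simp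
  qed
  have card_eq: "card {j\<in>J. t < ?a S (p j)} = exceed S t" if "bij_betw p J I" for S t p
  proof -
    have "card {j\<in>J. t < ?a S (p j)} = (\<Sum>j\<in>J. of_bool (t < ?a S (p j)))"
      using fin_J by (simp add: Int_def)
    also have "\<dots> = exceed S t" unfolding exceed_def
      by (rule sum.reindex_bij_betw[OF that, of "\<lambda>i. of_bool (t < ?a S i)"])
    finally show ?thesis .
  qed
  have h_le: "h (card Z) \<le> sum d Z" if "Z \<subseteq> J" for Z
  proof -
    define X where "X = {q\<in>{..<n}. e q \<in> Z}"
    have Z: "Z = e ` X" using e that by (auto simp: X_def bij_betw_def)
    have inj: "inj_on e X" by (rule inj_on_subset[OF inj_e]) (auto simp: X_def)
    have "(\<Sum>q<card X. d (e q)) \<le> (\<Sum>q\<in>X. d (e q))"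
      by (rule sum_smallest_le[where n = n]) (use e_mono in \<open>auto simp: X_def\<close>)
    then show ?thesis unfolding h_def Z by (simp add: card_image[OF inj] sum.reindex[OF inj])
  qed
  show thesis
  proof (rule that)
    show "interval_system I b c E T \<omega> h" by (rule interval_system_axioms)
  next
    fix S p assume "S \<subseteq> I" and p: "bij_betw p J I"
    have "\<omega> t * h (exceed S t) \<le> \<omega> t * (\<Sum>j\<in>{j\<in>J. t < ?a S (p j)}. d j)" if "t \<in> T" for t
      unfolding card_eq[OF p, symmetric] by (intro mult_left_mono h_le) (use T that in auto)
    then show "total S \<le> plan_cost S p" unfolding total_def cost_eq[OF p]
      by (intro add_right_mono sum_mono)
  next
    fix S assume "S \<subseteq> I"
    obtain f where f: "bij_betw f {..<n} I" and "\<forall>p q. p \<le> q \<longrightarrow> q < n \<longrightarrow> - ?a S (f p) \<le> - ?a S (f q)"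
      using sorted_enumeration[OF fin_I, of "\<lambda>i. - ?a S i"] unfolding n_def card_IJ by blast
    then have f_anti: "\<And>p q. p \<le> q \<Longrightarrow> q < n \<Longrightarrow> ?a S (f q) \<le> ?a S (f p)" using neg_le_iff_le by blast
    let ?p = "f \<circ> the_inv_into {..<n} e"
    have p: "bij_betw ?p J I" using bij_betw_trans[OF bij_betw_the_inv_into[OF e] f] .
    have pe: "?p (e q) = f q" if "q < n" for q using that inj_e by (simp add: the_inv_into_f_f)
    have "(\<Sum>j\<in>{j\<in>J. t < ?a S (?p j)}. d j) = h (exceed S t)" for t
    proof -
      define X where "X = {q\<in>{..<n}. t < ?a S (f q)}"
      have Z: "{j\<in>J. t < ?a S (?p j)} = e ` X"
      proof (intro equalityI subsetI)
        fix j assume j: "j \<in> {j\<in>J. t < ?a S (?p j)}"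
        then obtain q where "q < n" "j = e q" using e by (auto simp: bij_betw_def)
        then show "j \<in> e ` X" using j pe[of q] unfolding X_def by auto
      next
        fix j assume "j \<in> e ` X"
        then obtain q where "q < n" "j = e q" "t < ?a S (f q)" unfolding X_def by auto
        then show "j \<in> {j\<in>J. t < ?a S (?p j)}" using pe[of q] e_in by auto
      qed
      have inj: "inj_on e X" by (rule inj_on_subset[OF inj_e]) (auto simp: X_def)
      \<comment> \<open>Costs decrease along \<open>f\<close>, so those above \<open>t\<close>
        occupy an initial segment, and this segment carries the smallest demands.\<close>
      have X: "X = {..<card X}"
      proof -
        have down: "q' \<in> X" if "q \<in> X" "q' \<le> q" for q q'
          using that f_anti[of q' q] unfolding X_def by auto
        have finX: "finite X" by (simp add: X_def)
        have "q < card X" if "q \<in> X" for q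
        proof -
          have "{..q} \<subseteq> X" using down that by auto
          then have "card {..q} \<le> card X" using finX by (rule card_mono[rotated])
          then show ?thesis by simp
        qed
        then have "X \<subseteq> {..<card X}" by auto
        then show ?thesis by (intro card_subset_eq) auto
      qed
      have "sum d (e ` X) = (\<Sum>q\<in>X. d (e q))" by (simp add: sum.reindex[OF inj])
      also have "\<dots> = (\<Sum>q<card X. d (e q))" by (rule arg_cong[OF X])
      finally have "sum d {j\<in>J. t < ?a S (?p j)} = h (card {j\<in>J. t < ?a S (?p j)})"
        unfolding Z h_def card_image[OF inj] .
      then show ?thesis unfolding card_eq[OF p] .
    qed
    then show "\<exists>p. bij_betw p J I \<and> plan_cost S p = total S"
      using p by (intro exI[of _ ?p]) (simp add: cost_eq[OF p] total_def)
  qed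
qed

text \<open>The exchange theorem turns optimal sets of sizes \<open>k - 1\<close> and
  \<open>k + 1\<close> into two sets of size \<open>k\<close> that are together no more
  expensive.\<close>

theorem convex_value:
  obtains v where
    "\<And>S p. S \<subseteq> I \<Longrightarrow> bij_betw p J I \<Longrightarrow> v (card S) \<le> plan_cost S p"
    "\<And>k. k \<le> card I \<Longrightarrow> \<exists>S p. S \<subseteq> I \<and> card S = k \<and> bij_betw p J I \<and> plan_cost S p = v k"
    "\<And>k. 0 < k \<Longrightarrow> k < card I \<Longrightarrow> 2 * v k \<le> v (k - 1) + v (k + 1)"
proof -
  obtain T \<omega> h where sys: "interval_system I b c E T \<omega> h"
    and le: "\<And>S p. S \<subseteq> I \<Longrightarrow> bij_betw p J I \<Longrightarrow> interval_system.total I b c E T \<omega> h S \<le> plan_cost S p"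
    and eq: "\<And>S. S \<subseteq> I \<Longrightarrow> \<exists>p. bij_betw p J I \<and> plan_cost S p = interval_system.total I b c E T \<omega> h S"
    using plan_cost_representation by blast
  interpret interval_system I b c E T \<omega> h by (rule sys)
  define v where "v k = Min (total ` {S. S \<subseteq> I \<and> card S = k})" for k
  have fin: "finite {S. S \<subseteq> I \<and> card S = k}" for k using fin_I by simp
  have v_le: "v (card S) \<le> total S" if "S \<subseteq> I" for S
    unfolding v_def using that fin by (intro Min_le) auto
  have v_eq: "\<exists>S. S \<subseteq> I \<and> card S = k \<and> total S = v k" if "k \<le> card I" for k
  proof -
    obtain S where "S \<subseteq> I" "card S = k" using obtain_subset_with_card_n[OF \<open>k \<le> card I\<close>] by metis
    then have "v k \<in> total ` {S. S \<subseteq> I \<and> card S = k}"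
      unfolding v_def by (intro Min_in) (use fin in auto)
    then show ?thesis by auto
  qed
  show thesis
  proof (rule that)
    show "v (card S) \<le> plan_cost S p" if "S \<subseteq> I" "bij_betw p J I" for S p
      using v_le le that order_trans by blast
    show "\<exists>S p. S \<subseteq> I \<and> card S = k \<and> bij_betw p J I \<and> plan_cost S p = v k" if "k \<le> card I" for k
      using v_eq[OF that] eq by metis
    show "2 * v k \<le> v (k - 1) + v (k + 1)" if "0 < k" "k < card I" for k
    proof -
      have "k - 1 \<le> card I" "k + 1 \<le> card I" using that by auto
      note v_eq[OF this(1)] v_eq[OF this(2)]
      then obtain S1 S2 where S12: "S1 \<subseteq> I \<and> card S1 = k - 1 \<and> total S1 = v (k - 1)"
        "S2 \<subseteq> I \<and> card S2 = k + 1 \<and> total S2 = v (k + 1)" by (elim exE)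
      then have S1: "S1 \<subseteq> I" "card S1 = k - 1" "total S1 = v (k - 1)"
        and S2: "S2 \<subseteq> I" "card S2 = k + 1" "total S2 = v (k + 1)" by simp_all
      have "card S1 + card S2 = 2 * k" using S1 S2 that by simp
      from exchange[OF S1(1) S2(1) this] obtain S S' where
        S: "S \<subseteq> I" "S' \<subseteq> I" "card S = k" "card S' = k" "total S + total S' \<le> total S1 + total S2" by blast
      have "v k \<le> total S" "v k \<le> total S'" 
        using v_le[OF S(1)] v_le[OF S(2)] S(3,4) by simp_all
      then show ?thesis using S(5) S1(3) S2(3) by linarith
    qed
  qed
qed

end

section \<open>The polytope\<close>

definition plan_point :: "'j set \<Rightarrow> 'i set \<Rightarrow> ('j \<Rightarrow> 'i) \<Rightarrow> ('i, 'j) mvec \<times> ('i, 'j) mvec" where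
  "plan_point J S p =
     (Poly_Mapping.Abs_poly_mapping (\<lambda>(i, j). of_bool (j \<in> J \<and> p j = i \<and> i \<in> S)),
      Poly_Mapping.Abs_poly_mapping (\<lambda>(i, j). of_bool (j \<in> J \<and> p j = i \<and> i \<notin> S)))"

lemma entry_plan_point:
  assumes "finite J"
  shows "entry (fst (plan_point J S p)) (i, j) = of_bool (j \<in> J \<and> p j = i \<and> i \<in> S)"
    and "entry (snd (plan_point J S p)) (i, j) = of_bool (j \<in> J \<and> p j = i \<and> i \<notin> S)"
proof -
  have fin: "finite {x. (\<lambda>(i, j). of_bool (j \<in> J \<and> p j = i \<and> Q i) :: real) x \<noteq> 0}" for Q
    by (rule finite_subset[of _ "(\<lambda>j. (p j, j)) ` J"]) (use assms in auto)
  show "entry (fst (plan_point J S p)) (i, j) = of_bool (j \<in> J \<and> p j = i \<and> i \<in> S)"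
    "entry (snd (plan_point J S p)) (i, j) = of_bool (j \<in> J \<and> p j = i \<and> i \<notin> S)"
    unfolding plan_point_def using fin[of "\<lambda>i. i \<in> S"] fin[of "\<lambda>i. i \<notin> S"] by simp_all
qed

lemma upgrade_polytope_entry_le_1:
  assumes "(x, y) \<in> upgrade_polytope I J k" "finite I" "i \<in> I" "j \<in> J"
  shows "entry x (i, j) \<le> 1" "entry y (i, j) \<le> 1"
proof -
  have nn: "0 \<le> entry x (i', j)" "0 \<le> entry y (i', j)" if "i' \<in> I" for i'
    using assms(1,4) that unfolding upgrade_polytope_def by auto
  have "entry x (i, j) + entry y (i, j) \<le> (\<Sum>i\<in>I. entry x (i, j) + entry y (i, j))"
    by (rule member_le_sum) (use assms nn in auto)
  also have "\<dots> = 1" using assms(1,4) unfolding upgrade_polytope_def by simp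
  finally show "entry x (i, j) \<le> 1" "entry y (i, j) \<le> 1" using nn[OF assms(3)] by simp_all
qed

lemma lookup_scaleR: "Poly_Mapping.lookup (r *\<^sub>R f) i = r *\<^sub>R Poly_Mapping.lookup f i"
proof -
  have "finite {i. r *\<^sub>R Poly_Mapping.lookup f i \<noteq> 0}"
    by (rule finite_subset[OF _ finite_lookup[of f]]) auto
  then show ?thesis unfolding scaleR_poly_mapping_def by simp
qed

lemma convex_combination_01_eq:
  fixes a e :: real
  assumes "0 < u" "u < 1" "0 \<le> a" "a \<le> 1" "0 \<le> e" "e \<le> 1"
    and "(1 - u) * a + u * e = 0 \<or> (1 - u) * a + u * e = 1"
  shows "a = e"
  using assms(7)
proof
  assume 0: "(1 - u) * a + u * e = 0"
  moreover have "0 \<le> (1 - u) * a" "0 \<le> u * e" using assms by simp_all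
  ultimately have "(1 - u) * a = 0" "u * e = 0" by linarith+
  then show ?thesis using assms by simp
next
  assume 1: "(1 - u) * a + u * e = 1"
  have "(1 - u) * (1 - a) + u * (1 - e) = 0" using 1 by (simp add: algebra_simps)
  moreover have "0 \<le> (1 - u) * (1 - a)" "0 \<le> u * (1 - e)" using assms by simp_all
  ultimately have "(1 - u) * (1 - a) = 0" "u * (1 - e) = 0" by linarith+
  then show ?thesis using assms by simp
qed

text \<open>By the column equations all entries lie in \<open>[0, 1]\<close>, so a proper convex
  combination with value 0 or 1 has equal ends. Outside \<open>I \<times> J\<close> all entries
  vanish.\<close>

lemma zero_one_point_extreme:
  assumes P: "z \<in> upgrade_polytope I J k" and fin: "finite I"
    and x01: "\<And>i j. i \<in> I \<Longrightarrow> j \<in> J \<Longrightarrow> entry (fst z) (i, j) \<in> {0, 1}"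
    and y01: "\<And>i j. i \<in> I \<Longrightarrow> j \<in> J \<Longrightarrow> entry (snd z) (i, j) \<in> {0, 1}"
  shows "z extreme_point_of upgrade_polytope I J k"
  unfolding extreme_point_of_def
proof (intro conjI ballI notI)
  show "z \<in> upgrade_polytope I J k" by (rule P)
next
  fix a e assume a: "a \<in> upgrade_polytope I J k" and e: "e \<in> upgrade_polytope I J k" and "z \<in> open_segment a e"
  then obtain u where u: "0 < u" "u < 1" and "a \<noteq> e" and z: "z = (1 - u) *\<^sub>R a + u *\<^sub>R e"
    by (auto simp: in_segment)
  have zf: "entry (fst z) q = (1 - u) * entry (fst a) q + u * entry (fst e) q"
    and zs: "entry (snd z) q = (1 - u) * entry (snd a) q + u * entry (snd e) q" for q
    unfolding z by (simp_all add: lookup_add lookup_scaleR)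
  have off: "entry (fst w) (i, j) = 0" "entry (snd w) (i, j) = 0"
    if "w \<in> upgrade_polytope I J k" "(i, j) \<notin> I \<times> J" for w i j
  proof -
    have "Poly_Mapping.keys (fst w) \<subseteq> I \<times> J" "Poly_Mapping.keys (snd w) \<subseteq> I \<times> J"
      using that(1) unfolding upgrade_polytope_def by auto
    then have "(i, j) \<notin> Poly_Mapping.keys (fst w)" "(i, j) \<notin> Poly_Mapping.keys (snd w)"
      using that(2) by blast+
    then show "entry (fst w) (i, j) = 0" "entry (snd w) (i, j) = 0" by (simp_all add: in_keys_iff)
  qed
  have on: "0 \<le> entry (fst w) (i, j)" "0 \<le> entry (snd w) (i, j)" "entry (fst w) (i, j) \<le> 1" "entry (snd w) (i, j) \<le> 1"
    if "w \<in> upgrade_polytope I J k" "i \<in> I" "j \<in> J" for w i j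
    using that upgrade_polytope_entry_le_1[of "fst w" "snd w" I J k i j] fin unfolding upgrade_polytope_def by auto
  have "entry (fst a) (i, j) = entry (fst e) (i, j) \<and> entry (snd a) (i, j) = entry (snd e) (i, j)" for i j
  proof (cases "(i, j) \<in> I \<times> J")
    case True
    then have ij: "i \<in> I" "j \<in> J" by auto
    show ?thesis
    proof
      show "entry (fst a) (i, j) = entry (fst e) (i, j)"
        by (rule convex_combination_01_eq[OF u]) (use on[OF a ij] on[OF e ij] x01[OF ij] zf in auto)
      show "entry (snd a) (i, j) = entry (snd e) (i, j)"
        by (rule convex_combination_01_eq[OF u]) (use on[OF a ij] on[OF e ij] y01[OF ij] zs in auto)
    qed
  next
    case False
    then show ?thesis using off[OF a] off[OF e] by simp
  qed
  then have "fst a = fst e" "snd a = snd e" by (auto intro!: poly_mapping_eqI)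
  with \<open>a \<noteq> e\<close> show False by (simp add: prod_eq_iff)
qed

section \<open>Optimality of plans in the linear program\<close>

locale upgrade_problem =
  fixes I :: "'i set" and J :: "'j set" and b c :: "'i \<Rightarrow> real" and d :: "'j \<Rightarrow> real" and k :: nat
  assumes inst: "map_upgrades_instance I J b c d k"
begin

sublocale upgrade_data I J b c "\<lambda>_. 0" d
  by unfold_locales (use inst in \<open>auto simp: map_upgrades_instance_def\<close>)

lemma k_le: "k \<le> card I" using inst by (simp add: map_upgrades_instance_def)

lemma plan_point_in_polytope:
  assumes "S \<subseteq> I" "card S \<le> k" "bij_betw p J I"
  shows "plan_point J S p \<in> upgrade_polytope I J k"
proof -
  have inj: "inj_on p J" and im: "p ` J = I" using assms(3) by (auto simp: bij_betw_def)
  have e: "entry (fst (plan_point J S p)) (i, j) + entry (snd (plan_point J S p)) (i, j) =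
      of_bool (j \<in> J \<and> p j = i)" for i j
    by (auto simp: entry_plan_point[OF fin_J])
  have "(\<Sum>i\<in>I. of_bool (j \<in> J \<and> p j = i)) = (1::real)" if "j \<in> J" for j
  proof -
    have "p j \<in> I" using that im by auto
    then show ?thesis using that fin_I by (simp add: of_bool_def)
  qed
  moreover have "(\<Sum>j\<in>J. of_bool (j \<in> J \<and> p j = i)) = (1::real)" if "i \<in> I" for i
  proof -
    have "i \<in> p ` J" using that im by simp
    then obtain j where "j \<in> J" "p j = i" by blast
    then have "{j \<in> J. p j = i} = {j}" using inj by (auto simp: inj_on_def)
    then show ?thesis using fin_J by (simp add: Int_def)
  qed
  moreover have "(\<Sum>(i, j)\<in>I \<times> J. entry (fst (plan_point J S p)) (i, j)) \<le> real k"
  proof -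
    have "(\<Sum>(i, j)\<in>I \<times> J. entry (fst (plan_point J S p)) (i, j)) =
        (\<Sum>i\<in>I. \<Sum>j\<in>J. of_bool (p j = i \<and> i \<in> S))"
      unfolding sum.cartesian_product by (rule sum.cong) (auto simp: entry_plan_point[OF fin_J])
    also have "\<dots> = (\<Sum>j\<in>J. \<Sum>i\<in>I. of_bool (p j = i \<and> i \<in> S))" by (rule sum.swap)
    also have "\<dots> = (\<Sum>j\<in>J. of_bool (p j \<in> S))"
    proof (rule sum.cong[OF refl])
      fix j assume "j \<in> J"
      then have "{i \<in> I. p j = i \<and> i \<in> S} = (if p j \<in> S then {p j} else {})" using im by auto
      then show "(\<Sum>i\<in>I. of_bool (p j = i \<and> i \<in> S)) = (of_bool (p j \<in> S) :: real)"
        using fin_I by (simp add: Int_def)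
    qed
    also have "\<dots> = (\<Sum>i\<in>I. of_bool (i \<in> S))"
      by (rule sum.reindex_bij_betw[OF assms(3), of "\<lambda>i. of_bool (i \<in> S)"])
    also have "\<dots> = real (card S)" using fin_I assms(1) by (simp add: Int_absorb1)
    finally show ?thesis using assms(2) by simp
  qed
  moreover have "Poly_Mapping.keys (fst (plan_point J S p)) \<subseteq> I \<times> J"
    "Poly_Mapping.keys (snd (plan_point J S p)) \<subseteq> I \<times> J"
    using im by (auto simp: in_keys_iff entry_plan_point[OF fin_J])
  ultimately show ?thesis unfolding upgrade_polytope_def case_prod_beta
    by (simp add: e) (simp add: entry_plan_point[OF fin_J])
qed

lemma upgrade_cost_plan_point:
  assumes "bij_betw p J I"
  shows "upgrade_cost I J b c d (plan_point J S p) = plan_cost S p"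
proof -
  have im: "p ` J = I" using assms(1) by (auto simp: bij_betw_def)
  have "upgrade_cost I J b c d (plan_point J S p) =
     (\<Sum>i\<in>I. \<Sum>j\<in>J. of_bool (p j = i) * ((if i \<in> S then b i else c i) * d j))"
    unfolding upgrade_cost_def sum.cartesian_product
    by (rule sum.cong) (auto simp: entry_plan_point[OF fin_J])
  also have "\<dots> = (\<Sum>j\<in>J. \<Sum>i\<in>I. of_bool (p j = i) * ((if i \<in> S then b i else c i) * d j))"
    by (rule sum.swap)
  also have "\<dots> = (\<Sum>j\<in>J. (if p j \<in> S then b (p j) else c (p j)) * d j)"
  proof (rule sum.cong[OF refl])
    fix j assume "j \<in> J"
    then have "p j \<in> I" using im by auto
    then show "(\<Sum>i\<in>I. of_bool (p j = i) * ((if i \<in> S then b i else c i) * d j)) =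
        (if p j \<in> S then b (p j) else c (p j)) * d j"
      using fin_I by (subst sum.remove[of I "p j"]) (auto intro!: sum.neutral)
  qed
  finally show ?thesis by (simp add: plan_cost_def)
qed

text \<open>
  The multiplier of the budget constraint is a subgradient at \<open>k\<close> of the value function, which is
  convex on the integers; the relaxed problem is an assignment problem, hence integral.
\<close>

lemma upgrade_cost_lower_bound:
  assumes "z \<in> upgrade_polytope I J k"
  shows "\<exists>S p. S \<subseteq> I \<and> card S = k \<and> bij_betw p J I \<and> plan_cost S p \<le> upgrade_cost I J b c d z"
proof -
  obtain x y where z: "z = (x, y)" by (cases z)
  have nn: "0 \<le> entry x (i, j)" "0 \<le> entry y (i, j)" if "i \<in> I" "j \<in> J" for i j
    using assms that unfolding upgrade_polytope_def z by auto
  have col: "(\<Sum>i\<in>I. entry x (i, j) + entry y (i, j)) = 1" if "j \<in> J" for j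
    using assms that unfolding upgrade_polytope_def z by auto
  have row: "(\<Sum>j\<in>J. entry x (i, j) + entry y (i, j)) = 1" if "i \<in> I" for i
    using assms that unfolding upgrade_polytope_def z by auto
  have budget: "(\<Sum>i\<in>I. \<Sum>j\<in>J. entry x (i, j)) \<le> real k"
    using assms unfolding upgrade_polytope_def z sum.cartesian_product by auto
  obtain v where v_le: "\<And>S p. S \<subseteq> I \<Longrightarrow> bij_betw p J I \<Longrightarrow> v (card S) \<le> plan_cost S p"
    and v_eq: "\<And>k. k \<le> card I \<Longrightarrow> \<exists>S p. S \<subseteq> I \<and> card S = k \<and> bij_betw p J I \<and> plan_cost S p = v k"
    and v_convex: "\<And>k. 0 < k \<Longrightarrow> k < card I \<Longrightarrow> 2 * v k \<le> v (k - 1) + v (k + 1)"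
    using convex_value by blast
  \<comment> \<open>Another upgrade never raises the cost. This makes the multiplier nonnegative, as
    the inequality in the budget constraint requires.\<close>
  have v_anti: "v (Suc m) \<le> v m" if "m < card I" for m
  proof -
    obtain S p where S: "S \<subseteq> I" "card S = m" "bij_betw p J I" "plan_cost S p = v m"
      using v_eq[of m] \<open>m < card I\<close> by auto
    then obtain i where i: "i \<in> I" "i \<notin> S" using \<open>m < card I\<close> by (metis less_irrefl subsetI subset_antisym)
    have "card (insert i S) = Suc m" using S i fin_I finite_subset by (metis card_insert_disjoint)
    then have "v (Suc m) \<le> plan_cost (insert i S) p" using v_le[of "insert i S" p] S i by simp
    also have "\<dots> \<le> plan_cost S p"
    proof -
      have "p j \<in> I" if "j \<in> J" for j using S(3) that by (auto simp: bij_betw_def)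
      then show ?thesis unfolding plan_cost_def
        by (auto intro!: sum_mono mult_right_mono d_nonneg b_le_c)
    qed
    finally show ?thesis using S by simp
  qed
  \<comment> \<open>The slope to the right of \<open>k\<close> is the least subgradient; at
    \<open>k = card I\<close> there is no such slope and 0 serves.\<close>
  define \<mu> where "\<mu> = (if k < card I then v k - v (Suc k) else 0)"
  have \<mu>0: "0 \<le> \<mu>" using v_anti unfolding \<mu>_def by simp
  have left: "\<mu> \<le> v (k - 1) - v k" if "0 < k"
  proof (cases "k < card I")
    case True then show ?thesis using v_convex[of k] that unfolding \<mu>_def by simp
  next
    case False
    then have "k - 1 < card I" using k_le that by simp
    then show ?thesis using v_anti[of "k - 1"] that False unfolding \<mu>_def by simp
  qed
  have support: "v k + \<mu> * real k \<le> v j + \<mu> * real j" if "j \<le> card I" for j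
    using convex_sequence_support[of "card I" v k \<mu> j] v_convex left k_le that unfolding \<mu>_def by simp
  \<comment> \<open>With a price \<open>\<mu>\<close> on upgraded service each cell uses its cheaper
    mode, so the two variables of a cell merge into one variable of an ordinary assignment
    problem.\<close>
  let ?C = "\<lambda>i j. min (b i * d j + \<mu>) (c i * d j)"
  obtain p where p: "bij_betw p J I"
    and dual: "\<And>z. (\<And>i j. i \<in> I \<Longrightarrow> j \<in> J \<Longrightarrow> 0 \<le> z i j) \<Longrightarrow> (\<And>i. i \<in> I \<Longrightarrow> (\<Sum>j\<in>J. z i j) = 1) \<Longrightarrow>
       (\<And>j. j \<in> J \<Longrightarrow> (\<Sum>i\<in>I. z i j) = 1) \<Longrightarrow>
       (\<Sum>j\<in>J. ?C (p j) j) \<le> (\<Sum>i\<in>I. \<Sum>j\<in>J. ?C i j * z i j)"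
    using assignment_duality[OF fin_I fin_J card_IJ, of ?C] by blast
  have inj: "inj_on p J" and im: "p ` J = I" using p by (auto simp: bij_betw_def)
  let ?X = "{j \<in> J. b (p j) * d j + \<mu> \<le> c (p j) * d j}"
  define S where "S = p ` ?X"
  have SI: "S \<subseteq> I" using im unfolding S_def by auto
  have card_S: "card S = card ?X" unfolding S_def
    by (rule card_image) (rule inj_on_subset[OF inj], auto)
  have mem: "p j \<in> S \<longleftrightarrow> b (p j) * d j + \<mu> \<le> c (p j) * d j" if "j \<in> J" for j
    using inj that unfolding S_def by (auto simp: inj_on_def)
  have "v k + \<mu> * real k \<le> v (card S) + \<mu> * real (card S)"
    by (rule support) (rule card_mono[OF fin_I SI])
  also have "\<dots> \<le> plan_cost S p + \<mu> * real (card S)" using v_le[OF SI p] by simp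
  also have "\<dots> = (\<Sum>j\<in>J. ?C (p j) j)"
  proof -
    have "real (card S) = (\<Sum>j\<in>J. of_bool (b (p j) * d j + \<mu> \<le> c (p j) * d j))"
      unfolding card_S using fin_J by (simp add: Int_def)
    then have "plan_cost S p + \<mu> * real (card S) = (\<Sum>j\<in>J. (if p j \<in> S then b (p j) else c (p j)) * d j +
        \<mu> * of_bool (b (p j) * d j + \<mu> \<le> c (p j) * d j))"
      by (simp only: plan_cost_def sum.distrib sum_distrib_left sum.neutral_const add_0_right)
    also have "\<dots> = (\<Sum>j\<in>J. ?C (p j) j)"
      by (rule sum.cong) (auto simp: mem min_def)
    finally show ?thesis .
  qed
  also have "\<dots> \<le> (\<Sum>i\<in>I. \<Sum>j\<in>J. ?C i j * (entry x (i, j) + entry y (i, j)))"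
    by (rule dual) (use nn row col in auto)
  also have "\<dots> \<le> (\<Sum>i\<in>I. \<Sum>j\<in>J. b i * d j * entry x (i, j) + c i * d j * entry y (i, j) + \<mu> * entry x (i, j))"
  proof (intro sum_mono)
    fix i j assume ij: "i \<in> I" "j \<in> J"
    have "?C i j * entry x (i, j) \<le> (b i * d j + \<mu>) * entry x (i, j)"
      "?C i j * entry y (i, j) \<le> c i * d j * entry y (i, j)"
      using nn[OF ij] by (intro mult_right_mono; simp)+
    then show "?C i j * (entry x (i, j) + entry y (i, j)) \<le>
        b i * d j * entry x (i, j) + c i * d j * entry y (i, j) + \<mu> * entry x (i, j)"
      by (simp add: distrib_left distrib_right)
  qed
  also have "\<dots> = upgrade_cost I J b c d z + \<mu> * (\<Sum>i\<in>I. \<Sum>j\<in>J. entry x (i, j))"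
    unfolding upgrade_cost_def z sum.cartesian_product[symmetric]
    by (simp add: sum.distrib sum_distrib_left)
  also have "\<dots> \<le> upgrade_cost I J b c d z + \<mu> * real k"
    using mult_left_mono[OF budget \<mu>0] by simp
  finally have "v k \<le> upgrade_cost I J b c d z" by simp
  then show ?thesis using v_eq[OF k_le] by metis
qed

text \<open>Comparison with plans of exactly \<open>k\<close> upgrades suffices, because below the
  cost of every point of the polytope there is such a plan.\<close>

theorem plan_point_optimal:
  assumes S: "S \<subseteq> I" "card S = k" "bij_betw p J I"
    and min: "\<And>S' p'. S' \<subseteq> I \<Longrightarrow> card S' = k \<Longrightarrow> bij_betw p' J I \<Longrightarrow> plan_cost S p \<le> plan_cost S' p'"
  shows "optimal_integral_vertex I J b c d k (plan_point J S p)"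
proof -
  have P: "plan_point J S p \<in> upgrade_polytope I J k"
    using plan_point_in_polytope S by simp
  have "plan_point J S p extreme_point_of upgrade_polytope I J k"
    by (rule zero_one_point_extreme[OF P fin_I]) (auto simp: entry_plan_point[OF fin_J])
  moreover have "lp_optimal I J b c d k (plan_point J S p)"
    unfolding lp_optimal_def is_arg_min_linorder
  proof (intro conjI allI impI P)
    fix z assume "z \<in> upgrade_polytope I J k"
    then obtain S' p' where "S' \<subseteq> I" "card S' = k" "bij_betw p' J I" "plan_cost S' p' \<le> upgrade_cost I J b c d z"
      using upgrade_cost_lower_bound by blast
    then show "upgrade_cost I J b c d (plan_point J S p) \<le> upgrade_cost I J b c d z"
      using min[of S' p'] by (simp add: upgrade_cost_plan_point[OF S(3)])
  qed
  moreover have "integral_point I J (plan_point J S p)"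
    unfolding integral_point_def by (simp add: entry_plan_point[OF fin_J])
  ultimately show ?thesis unfolding optimal_integral_vertex_def by simp
qed

theorem optimal_integral_vertex_exists: "\<exists>z. optimal_integral_vertex I J b c d k z"
proof -
  obtain v where v_le: "\<And>S p. S \<subseteq> I \<Longrightarrow> bij_betw p J I \<Longrightarrow> v (card S) \<le> plan_cost S p"
    and v_eq: "\<And>k. k \<le> card I \<Longrightarrow> \<exists>S p. S \<subseteq> I \<and> card S = k \<and> bij_betw p J I \<and> plan_cost S p = v k"
    and "\<And>k. 0 < k \<Longrightarrow> k < card I \<Longrightarrow> 2 * v k \<le> v (k - 1) + v (k + 1)"
    using convex_value by blast
  obtain S p where S: "S \<subseteq> I" "card S = k" "bij_betw p J I" and eq: "plan_cost S p = v k"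
    using v_eq[OF k_le] by blast
  have "optimal_integral_vertex I J b c d k (plan_point J S p)"
  proof (rule plan_point_optimal[OF S])
    fix S' p' assume "S' \<subseteq> I" "card S' = k" "bij_betw p' J I"
    then show "plan_cost S p \<le> plan_cost S' p'" using v_le[of S' p'] eq by simp
  qed
  then show ?thesis by blast
qed

end

section \<open>Strict convexity by perturbation\<close>

lemma sum_powers_less:
  fixes r :: "'i \<Rightarrow> nat"
  assumes "finite S" "inj_on r S" "\<And>i. i \<in> S \<Longrightarrow> r i < n"
  shows "(\<Sum>i\<in>S. 4 ^ r i) < (4 ^ n :: int)"
proof -
  have "(\<Sum>i\<in>S. 4 ^ r i) = (\<Sum>q\<in>r ` S. (4 ^ q :: int))" by (simp add: sum.reindex[OF assms(2)])
  also have "\<dots> \<le> (\<Sum>q<n. 4 ^ q)" by (rule sum_mono2) (use assms in auto)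
  also have "\<dots> < 4 ^ n"
  proof -
    have "3 * (\<Sum>q<n. 4 ^ q :: int) < 4 ^ n" by (induction n) auto
    moreover have "0 \<le> (\<Sum>q<n. 4 ^ q :: int)" by (simp add: sum_nonneg)
    ultimately show ?thesis by linarith
  qed
  finally show ?thesis .
qed

text \<open>The term with the least exponent must be divisible by the next power of 4. Its
  coefficient is then a multiple of 4 of absolute value at most 2, hence 0.\<close>

lemma powers_of_4_independent:
  fixes r :: "'i \<Rightarrow> nat" and g :: "'i \<Rightarrow> int"
  assumes "finite A" "inj_on r A" "\<And>i. i \<in> A \<Longrightarrow> \<bar>g i\<bar> \<le> 2" "(\<Sum>i\<in>A. g i * 4 ^ r i) = 0"
  shows "\<forall>i\<in>A. g i = 0"
  using assms
proof (induction "card A" arbitrary: A rule: less_induct)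
  case less
  show ?case
  proof (cases "A = {}")
    case False
    obtain i where i: "i \<in> A" "\<And>i'. i' \<in> A \<Longrightarrow> r i \<le> r i'"
      using ex_is_arg_min_if_finite[OF less.prems(1) False, of r] unfolding is_arg_min_linorder by blast
    have "4 ^ Suc (r i) dvd g i' * 4 ^ r i'" if "i' \<in> A - {i}" for i'
    proof -
      have "r i \<noteq> r i'" using that i(1) less.prems(2) by (auto simp: inj_on_def)
      then have "Suc (r i) \<le> r i'" using i(2)[of i'] that by auto
      then show ?thesis by (intro dvd_mult le_imp_power_dvd)
    qed
    then have "4 ^ Suc (r i) dvd (\<Sum>i'\<in>A - {i}. g i' * 4 ^ r i')" by (rule dvd_sum)
    moreover have split: "(\<Sum>i'\<in>A. g i' * 4 ^ r i') = g i * 4 ^ r i + (\<Sum>i'\<in>A - {i}. g i' * 4 ^ r i')"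
      by (rule sum.remove[OF less.prems(1) i(1)])
    moreover from split less.prems(4) have "g i * 4 ^ r i = - (\<Sum>i'\<in>A - {i}. g i' * 4 ^ r i')" by simp
    ultimately have "4 ^ Suc (r i) dvd g i * 4 ^ r i" by (simp only: dvd_minus_iff)
    then have "4 dvd g i" by simp
    then have "g i = 0" using less.prems(3)[OF i(1)] zdvd_imp_le[of 4 "\<bar>g i\<bar>"] by force
    moreover have "\<forall>i'\<in>A - {i}. g i' = 0"
    proof (rule less.hyps)
      show "card (A - {i}) < card A" using less.prems(1) i(1) by (intro card_Diff1_less)
      show "finite (A - {i})" using less.prems(1) by simp
      show "inj_on r (A - {i})" using less.prems(2) by (rule inj_on_subset) auto
      show "\<bar>g i'\<bar> \<le> 2" if "i' \<in> A - {i}" for i' using less.prems(3) that by blast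
      show "(\<Sum>i'\<in>A - {i}. g i' * 4 ^ r i') = 0" using split less.prems(4) \<open>g i = 0\<close> by simp
    qed
    ultimately show ?thesis by blast
  qed simp
qed

text \<open>
  Integral data, perturbed by the weights \<open>4 ^ rank i\<close>: after scaling by a larger power of 4 they
  only break ties, and they make the value function strictly convex.
\<close>

locale perturbed_data =
  fixes I :: "'i set" and J :: "'j set" and B C :: "'i \<Rightarrow> int" and D :: "'j \<Rightarrow> int" and rank :: "'i \<Rightarrow> nat"
    and k :: nat
  assumes fin_I: "finite I" and fin_J: "finite J" and card_IJ: "card I = card J"
    and B_nonneg: "i \<in> I \<Longrightarrow> 0 \<le> B i" and B_le_C: "i \<in> I \<Longrightarrow> B i \<le> C i"
    and D_nonneg: "j \<in> J \<Longrightarrow> 0 \<le> D j"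
    and rank_inj: "inj_on rank I" and rank_less: "i \<in> I \<Longrightarrow> rank i < card I"
    and rank_nested: "i \<in> I \<Longrightarrow> i' \<in> I \<Longrightarrow> B i \<le> B i' \<Longrightarrow> C i' \<le> C i \<Longrightarrow>
      rank i \<le> rank i' \<or> B i = B i' \<and> C i = C i'"
    and k_le: "k \<le> card I"
begin

text \<open>One power of 4 beyond the bound on weight sums, so that twice such a sum, or the sum of
  two of them, can be recovered modulo \<open>K\<close>.\<close>

abbreviation K :: int where "K \<equiv> 4 ^ Suc (card I)"
abbreviation E :: "'i \<Rightarrow> int" where "E i \<equiv> 4 ^ rank i"

sublocale plain: upgrade_data I J B C "\<lambda>_. 0" D
  by unfold_locales (use fin_I fin_J card_IJ B_nonneg B_le_C D_nonneg in auto)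

sublocale upgrade_data I J "\<lambda>i. K * B i" "\<lambda>i. K * C i" E D
proof
  fix i i' assume "i \<in> I" "i' \<in> I" "K * B i \<le> K * B i'" "K * C i' \<le> K * C i"
  then show "E i \<le> E i' \<or> K * B i = K * B i' \<and> K * C i = K * C i'"
    using rank_nested[of i i'] by auto
qed (use fin_I fin_J card_IJ B_nonneg B_le_C D_nonneg in auto)

lemma plan_cost_eq: "plan_cost S p = K * plain.plan_cost S p + sum E S"
  unfolding plan_cost_def plain.plan_cost_def
  by (auto simp: sum_distrib_left intro!: sum.cong)

lemma sum_E: assumes "S \<subseteq> I" shows "0 \<le> sum E S" "4 * sum E S < K"
proof -
  show "0 \<le> sum E S" by (simp add: sum_nonneg)
  have "finite S" "inj_on rank S" using assms fin_I rank_inj by (auto intro: finite_subset inj_on_subset)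
  then have "sum E S < 4 ^ card I" using assms rank_less by (intro sum_powers_less) auto
  then show "4 * sum E S < K" by simp
qed

text \<open>Membership in \<open>S1\<close> plus membership in \<open>S2\<close> minus twice
  membership in \<open>S\<close> is a coefficient between -2 and 2; all of them vanish, so the sets
  coincide.\<close>

lemma sum_E_midpoint:
  assumes "S \<subseteq> I" "S1 \<subseteq> I" "S2 \<subseteq> I" "2 * sum E S = sum E S1 + sum E S2"
  shows "S1 = S2"
proof -
  let ?g = "\<lambda>i. of_bool (i \<in> S1) + of_bool (i \<in> S2) - 2 * of_bool (i \<in> S) :: int"
  have ind: "sum E X = (\<Sum>i\<in>I. of_bool (i \<in> X) * E i)" if "X \<subseteq> I" for X
    using that fin_I by (simp add: Int_absorb1 Int_absorb2)
  have "\<forall>i\<in>I. ?g i = 0"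
  proof (rule powers_of_4_independent[OF fin_I rank_inj])
    show "(\<Sum>i\<in>I. ?g i * E i) = 0"
      using assms(4) unfolding ind[OF assms(1)] ind[OF assms(2)] ind[OF assms(3)]
      by (simp only: left_diff_distrib distrib_right sum.distrib sum_subtractf mult.assoc sum_distrib_left[symmetric])
  qed auto
  then have "i \<in> S1 \<longleftrightarrow> i \<in> S2" if "i \<in> I" for i using that by (fastforce simp: of_bool_def split: if_splits)
  then show ?thesis using assms by blast
qed

text \<open>A loss of 1 in the integral cost is worth \<open>K\<close> after scaling, more than the
  weights can make up for.\<close>

lemma plain_le:
  assumes "plan_cost S p \<le> plan_cost S' p'" "S \<subseteq> I" "S' \<subseteq> I"
  shows "plain.plan_cost S p \<le> plain.plan_cost S' p'"
proof (rule ccontr)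
  assume "\<not> ?thesis"
  then have "K * (plain.plan_cost S' p' + 1) \<le> K * plain.plan_cost S p" by (intro mult_left_mono) auto
  then have "K * plain.plan_cost S' p' + K \<le> K * plain.plan_cost S p" by (simp only: distrib_left mult_1_right)
  moreover have "K * plain.plan_cost S p + sum E S \<le> K * plain.plan_cost S' p' + sum E S'"
    using assms(1) unfolding plan_cost_eq .
  ultimately show False using sum_E[OF assms(2)] sum_E[OF assms(3)] by linarith
qed

text \<open>The multiplier is \<open>\<mu> + 1/2\<close> and everything is doubled. A half-integer
  is never a slope of an integral value function, so it cannot produce ties between neighbouring
  sizes.\<close>

definition optimal_at :: "int \<Rightarrow> 'i set \<Rightarrow> ('j \<Rightarrow> 'i) \<Rightarrow> bool" where
  "optimal_at \<mu> S p \<longleftrightarrow> S \<subseteq> I \<and> bij_betw p J I \<and> (\<forall>S' p'. S' \<subseteq> I \<longrightarrow> bij_betw p' J I \<longrightarrow>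
     2 * plan_cost S p + (2 * \<mu> + 1) * int (card S) \<le> 2 * plan_cost S' p' + (2 * \<mu> + 1) * int (card S'))"

lemma optimal_at_fixed_card:
  assumes "optimal_at \<mu> S p" "S' \<subseteq> I" "card S' = card S" "bij_betw p' J I"
  shows "plain.plan_cost S p \<le> plain.plan_cost S' p'"
proof (rule plain_le)
  show "S \<subseteq> I" "S' \<subseteq> I" using assms unfolding optimal_at_def by auto
  have "2 * plan_cost S p + (2 * \<mu> + 1) * int (card S) \<le> 2 * plan_cost S' p' + (2 * \<mu> + 1) * int (card S')"
    using assms unfolding optimal_at_def by blast
  then show "plan_cost S p \<le> plan_cost S' p'" using assms(3) by simp
qed

text \<open>A larger multiplier means fewer upgrades. By strict convexity the integral slopes beside
  \<open>k\<close> are at least 1 apart, so \<open>\<mu>\<^sub>0\<close> and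
  \<open>\<mu>\<^sub>0 + 1\<close> both support the value function at \<open>k\<close>. Then
  \<open>\<mu> + 1/2\<close> yields at most \<open>k\<close> upgrades if it exceeds the former and
  at least \<open>k\<close> if it is below the latter.\<close>

theorem multiplier_exists:
  assumes bound: "\<And>S p. S \<subseteq> I \<Longrightarrow> bij_betw p J I \<Longrightarrow> plan_cost S p < H"
  obtains \<mu>\<^sub>0 where "\<bar>\<mu>\<^sub>0\<bar> \<le> H"
    "\<And>\<mu> S p. optimal_at \<mu> S p \<Longrightarrow> \<mu>\<^sub>0 \<le> \<mu> \<Longrightarrow> card S \<le> k"
    "\<And>\<mu> S p. optimal_at \<mu> S p \<Longrightarrow> \<mu> \<le> \<mu>\<^sub>0 \<Longrightarrow> k \<le> card S"
proof -
  obtain v where v_le: "\<And>S p. S \<subseteq> I \<Longrightarrow> bij_betw p J I \<Longrightarrow> v (card S) \<le> plan_cost S p"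
    and v_eq: "\<And>k. k \<le> card I \<Longrightarrow> \<exists>S p. S \<subseteq> I \<and> card S = k \<and> bij_betw p J I \<and> plan_cost S p = v k"
    and v_convex: "\<And>k. 0 < k \<Longrightarrow> k < card I \<Longrightarrow> 2 * v k \<le> v (k - 1) + v (k + 1)"
    using convex_value by blast
  have strict: "2 * v m < v (m - 1) + v (m + 1)" if m: "0 < m" "m < card I" for m
  proof (rule ccontr)
    assume "\<not> ?thesis"
    then have eq: "2 * v m = v (m - 1) + v (m + 1)" using v_convex[OF m] by simp
    have "m \<le> card I" "m - 1 \<le> card I" "m + 1 \<le> card I" using m by auto
    note v_eq[OF this(1)] v_eq[OF this(2)] v_eq[OF this(3)]
    then obtain S p S1 p1 S2 p2 where
      "S \<subseteq> I \<and> card S = m \<and> bij_betw p J I \<and> plan_cost S p = v m"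
      "S1 \<subseteq> I \<and> card S1 = m - 1 \<and> bij_betw p1 J I \<and> plan_cost S1 p1 = v (m - 1)"
      "S2 \<subseteq> I \<and> card S2 = m + 1 \<and> bij_betw p2 J I \<and> plan_cost S2 p2 = v (m + 1)"
      by (elim exE)
    then have S: "S \<subseteq> I" "S1 \<subseteq> I" "S2 \<subseteq> I" "card S1 = m - 1" "card S2 = m + 1"
      and "2 * plan_cost S p = plan_cost S1 p1 + plan_cost S2 p2" using eq by simp_all
    then have eq': "K * (2 * plain.plan_cost S p) + 2 * sum E S =
        K * (plain.plan_cost S1 p1 + plain.plan_cost S2 p2) + (sum E S1 + sum E S2)"
      unfolding plan_cost_eq distrib_left by simp
    \<comment> \<open>Modulo \<open>K\<close> only the weights remain of the two sides.\<close>
    have "(K * (2 * plain.plan_cost S p) + 2 * sum E S) mod K = 2 * sum E S"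
      unfolding mod_mult_self4 using sum_E[OF S(1)] by (intro mod_pos_pos_trivial) linarith+
    moreover have "(K * (plain.plan_cost S1 p1 + plain.plan_cost S2 p2) + (sum E S1 + sum E S2)) mod K =
        sum E S1 + sum E S2"
      unfolding mod_mult_self4 using sum_E[OF S(2)] sum_E[OF S(3)] by (intro mod_pos_pos_trivial) linarith+
    ultimately have "S1 = S2" using sum_E_midpoint[OF S(1-3)] eq' by metis
    then show False using S m by simp
  qed
  have v_range: "0 \<le> v m" "v m < H" if "m \<le> card I" for m
  proof -
    obtain S p where *: "S \<subseteq> I" "bij_betw p J I" "plan_cost S p = v m" using v_eq[OF \<open>m \<le> card I\<close>] by blast
    show "v m < H" using bound[of S p] * by simp
    have "p j \<in> I" if "j \<in> J" for j using *(2) that by (auto simp: bij_betw_def)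
    moreover have "0 \<le> C i" if "i \<in> I" for i using B_nonneg[OF that] B_le_C[OF that] by simp
    ultimately have "0 \<le> plan_cost S p" unfolding plan_cost_def
      using B_nonneg D_nonneg by (auto intro!: add_nonneg_nonneg sum_nonneg mult_nonneg_nonneg)
    then show "0 \<le> v m" using * by simp
  qed
  \<comment> \<open>The left slope minus 1, which by strictness is still no smaller than the right
    slope. For \<open>k = 0\<close> the right slope is taken, and 0 if there are no
    suppliers.\<close>
  define \<mu>\<^sub>0 where "\<mu>\<^sub>0 = (if 0 < k then v (k - 1) - v k - 1 else if 0 < card I then v 0 - v 1 else 0)"
  have left: "\<mu>\<^sub>0 + 1 \<le> v (k - 1) - v k" if "0 < k" using that unfolding \<mu>\<^sub>0_def by simp
  have right: "v k - v (k + 1) \<le> \<mu>\<^sub>0" if "k < card I"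
    using that strict[of k] unfolding \<mu>\<^sub>0_def by (cases "0 < k") auto
  have support: "2 * v k + \<nu> * int k \<le> 2 * v j + \<nu> * int j"
    if "k < card I \<Longrightarrow> 2 * (v k - v (k + 1)) \<le> \<nu>" "0 < k \<Longrightarrow> \<nu> \<le> 2 * (v (k - 1) - v k)" "j \<le> card I" for \<nu> j
  proof (rule convex_sequence_support[of "card I" "\<lambda>m. 2 * v m"])
    show "2 * (2 * v m) \<le> 2 * v (m - 1) + 2 * v (m + 1)" if "0 < m" "m < card I" for m
      using v_convex[OF that] by simp
  qed (use that k_le in auto)
  have opt_le: "2 * v (card S) + (2 * \<mu> + 1) * int (card S) \<le> 2 * v k + (2 * \<mu> + 1) * int k"
    if "optimal_at \<mu> S p" for \<mu> S p
  proof -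
    obtain S' p' where "S' \<subseteq> I" "card S' = k" "bij_betw p' J I" "plan_cost S' p' = v k" using v_eq[OF k_le] by blast
    then have "2 * plan_cost S p + (2 * \<mu> + 1) * int (card S) \<le> 2 * v k + (2 * \<mu> + 1) * int k"
      using that unfolding optimal_at_def by metis
    moreover have "v (card S) \<le> plan_cost S p" using that v_le unfolding optimal_at_def by blast
    ultimately show ?thesis by linarith
  qed
  have card_le: "card S \<le> card I" if "optimal_at \<mu> S p" for \<mu> S p
    using that fin_I unfolding optimal_at_def by (meson card_mono)
  show thesis
  proof (rule that)
    have "0 < k \<Longrightarrow> 0 \<le> v (k - 1) \<and> v (k - 1) < H" using v_range[of "k - 1"] k_le by simp
    moreover have "0 \<le> v k \<and> v k < H" using v_range[of k] k_le by simp
    moreover have "0 < card I \<Longrightarrow> 0 \<le> v 1 \<and> v 1 < H" using v_range[of 1] by simp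
    moreover have "0 \<le> v 0 \<and> v 0 < H" using v_range[of 0] by simp
    ultimately show "\<bar>\<mu>\<^sub>0\<bar> \<le> H" unfolding \<mu>\<^sub>0_def by auto
  next
    fix \<mu> S p assume opt: "optimal_at \<mu> S p" and "\<mu>\<^sub>0 \<le> \<mu>"
    have "2 * v k + 2 * \<mu>\<^sub>0 * int k \<le> 2 * v (card S) + 2 * \<mu>\<^sub>0 * int (card S)"
      by (rule support) (use left right card_le[OF opt] in auto)
    \<comment> \<open>Adding the support inequality and the optimality of \<open>S\<close> cancels
      the values of \<open>v\<close>. The first factor is positive, so the second is not.\<close>
    then have "(2 * \<mu> + 1 - 2 * \<mu>\<^sub>0) * (int (card S) - int k) \<le> 0"
      using opt_le[OF opt] by (simp add: algebra_simps)
    then show "card S \<le> k" using \<open>\<mu>\<^sub>0 \<le> \<mu>\<close> by (simp add: mult_le_0_iff)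
  next
    fix \<mu> S p assume opt: "optimal_at \<mu> S p" and "\<mu> \<le> \<mu>\<^sub>0"
    have "2 * v k + (2 * \<mu>\<^sub>0 + 2) * int k \<le> 2 * v (card S) + (2 * \<mu>\<^sub>0 + 2) * int (card S)"
      by (rule support) (use left right card_le[OF opt] in auto)
    then have "(2 * \<mu>\<^sub>0 + 2 - (2 * \<mu> + 1)) * (int k - int (card S)) \<le> 0"
      using opt_le[OF opt] by (simp add: algebra_simps)
    then show "k \<le> card S" using \<open>\<mu> \<le> \<mu>\<^sub>0\<close> by (simp add: mult_le_0_iff)
  qed
qed

text \<open>Doubled, to fit the odd number \<open>2 * \<mu> + 1\<close> that stands for the
  multiplier.\<close>

definition upgraded_entry :: "'i \<Rightarrow> 'j \<Rightarrow> int" where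
  "upgraded_entry i j = 2 * (K * B i * D j + E i)"

definition regular_entry :: "'i \<Rightarrow> 'j \<Rightarrow> int" where
  "regular_entry i j = 2 * (K * C i * D j)"

lemma entries_nonneg:
  assumes "i \<in> I" "j \<in> J" shows "0 \<le> upgraded_entry i j" "0 \<le> regular_entry i j"
  unfolding upgraded_entry_def regular_entry_def
  using B_nonneg[OF assms(1)] B_le_C[OF assms(1)] D_nonneg[OF assms(2)] by auto

lemma plan_cost_entries:
  assumes "S \<subseteq> I" "bij_betw p J I"
  shows "2 * plan_cost S p = (\<Sum>j\<in>J. if p j \<in> S then upgraded_entry (p j) j else regular_entry (p j) j)"
    and "int (card S) = (\<Sum>j\<in>J. of_bool (p j \<in> S))"
proof -
  have fin_S: "finite S" using assms fin_I finite_subset by blast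
  have "sum E S = (\<Sum>i\<in>I. if i \<in> S then E i else 0)"
    using assms(1) fin_I by (simp add: sum.inter_restrict[symmetric] Int_absorb1)
  also have "\<dots> = (\<Sum>j\<in>J. if p j \<in> S then E (p j) else 0)"
    by (rule sum.reindex_bij_betw[OF assms(2), of "\<lambda>i. if i \<in> S then E i else 0", symmetric])
  finally have "plan_cost S p = (\<Sum>j\<in>J. (if p j \<in> S then K * B (p j) else K * C (p j)) * D j +
      (if p j \<in> S then E (p j) else 0))"
    unfolding plan_cost_def by (simp only: sum.distrib)
  then show "2 * plan_cost S p = (\<Sum>j\<in>J. if p j \<in> S then upgraded_entry (p j) j else regular_entry (p j) j)"
    unfolding upgraded_entry_def regular_entry_def by (auto simp: sum_distrib_left intro!: sum.cong)
  have "int (card S) = (\<Sum>i\<in>I. of_bool (i \<in> S))"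
    using assms(1) fin_I by (simp add: Int_absorb1)
  also have "\<dots> = (\<Sum>j\<in>J. of_bool (p j \<in> S))"
    by (rule sum.reindex_bij_betw[OF assms(2), of "\<lambda>i. of_bool (i \<in> S)", symmetric])
  finally show "int (card S) = (\<Sum>j\<in>J. of_bool (p j \<in> S))" .
qed

text \<open>A crude bound that the program can compute by summing all entries; it delimits the
  bisection.\<close>

lemma plan_cost_less:
  assumes "S \<subseteq> I" "bij_betw p J I"
  shows "plan_cost S p < 1 + (\<Sum>i\<in>I. \<Sum>j\<in>J. upgraded_entry i j + regular_entry i j)"
proof -
  have p: "p j \<in> I" if "j \<in> J" for j using assms(2) that by (auto simp: bij_betw_def)
  have "2 * plan_cost S p \<le> (\<Sum>j\<in>J. \<Sum>i\<in>I. upgraded_entry i j + regular_entry i j)"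
    unfolding plan_cost_entries(1)[OF assms]
  proof (rule sum_mono)
    fix j assume j: "j \<in> J"
    have "(if p j \<in> S then upgraded_entry (p j) j else regular_entry (p j) j) \<le>
        upgraded_entry (p j) j + regular_entry (p j) j" using entries_nonneg[OF p[OF j] j] by simp
    also have "\<dots> \<le> (\<Sum>i\<in>I. upgraded_entry i j + regular_entry i j)"
      by (rule member_le_sum[of "p j" I "\<lambda>i. upgraded_entry i j + regular_entry i j"])
         (use p[OF j] entries_nonneg j fin_I in auto)
    finally show "(if p j \<in> S then upgraded_entry (p j) j else regular_entry (p j) j) \<le> \<dots>" .
  qed
  also have "\<dots> = (\<Sum>i\<in>I. \<Sum>j\<in>J. upgraded_entry i j + regular_entry i j)" by (rule sum.swap)
  moreover have "0 \<le> \<dots>" using entries_nonneg by (auto intro!: sum_nonneg)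
  ultimately show ?thesis by linarith
qed

text \<open>For a given assignment the best upgrade set decides each cell separately, so only the
  assignment has to be optimized. Ties go to regular service.\<close>

lemma optimal_atI:
  assumes p: "bij_betw p J I" and \<mu>: "l = 2 * \<mu> + 1"
    and min: "\<And>q. bij_betw q J I \<Longrightarrow>
      (\<Sum>j\<in>J. min (upgraded_entry (p j) j + l) (regular_entry (p j) j)) \<le>
      (\<Sum>j\<in>J. min (upgraded_entry (q j) j + l) (regular_entry (q j) j))"
    and S: "S = p ` {j \<in> J. upgraded_entry (p j) j + l < regular_entry (p j) j}"
  shows "optimal_at \<mu> S p"
  unfolding optimal_at_def
proof (intro conjI allI impI p)
  have inj: "inj_on p J" and im: "p ` J = I" using p by (auto simp: bij_betw_def)
  show SI: "S \<subseteq> I" using im unfolding S by auto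
  fix S' p' assume S': "S' \<subseteq> I" "bij_betw p' J I"
  have total: "2 * plan_cost X q + l * int (card X) =
      (\<Sum>j\<in>J. if q j \<in> X then upgraded_entry (q j) j + l else regular_entry (q j) j)"
    if "X \<subseteq> I" "bij_betw q J I" for X q
    unfolding plan_cost_entries[OF that] sum_distrib_left sum.distrib[symmetric] by (rule sum.cong) auto
  have mem: "p j \<in> S \<longleftrightarrow> upgraded_entry (p j) j + l < regular_entry (p j) j" if "j \<in> J" for j
    using inj that unfolding S by (auto simp: inj_on_def)
  have "2 * plan_cost S p + l * int (card S) =
      (\<Sum>j\<in>J. min (upgraded_entry (p j) j + l) (regular_entry (p j) j))"
    unfolding total[OF SI p] by (rule sum.cong) (auto simp: mem)
  also have "\<dots> \<le> (\<Sum>j\<in>J. min (upgraded_entry (p' j) j + l) (regular_entry (p' j) j))" by (rule min[OF S'(2)])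
  also have "\<dots> \<le> 2 * plan_cost S' p' + l * int (card S')"
    unfolding total[OF S'] by (rule sum_mono) auto
  finally show "2 * plan_cost S p + (2 * \<mu> + 1) * int (card S) \<le> 2 * plan_cost S' p' + (2 * \<mu> + 1) * int (card S')"
    unfolding \<mu> .
qed

end

section \<open>Cost of machine programs\<close>

lemma int_size_le_iff: "int_size a \<le> Suc s \<longleftrightarrow> \<bar>a\<bar> < 2 ^ s"
proof -
  have "int_size a \<le> Suc s \<longleftrightarrow> floorlog 2 (nat \<bar>a\<bar>) \<le> s" by (simp add: int_size_def)
  also have "\<dots> \<longleftrightarrow> nat \<bar>a\<bar> < 2 ^ s" by (simp add: floorlog_le_iff)
  also have "\<dots> \<longleftrightarrow> \<bar>a\<bar> < 2 ^ s" by (simp add: nat_less_iff)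
  finally show ?thesis .
qed

lemma int_size_pos: "0 < int_size a" by (simp add: int_size_def)

lemma abs_less_int_size: "\<bar>a\<bar> < 2 ^ (int_size a - 1)"
  using int_size_le_iff[of a "int_size a - 1"] int_size_pos[of a] by simp

lemma int_size_mono: "\<bar>a\<bar> \<le> \<bar>b\<bar> \<Longrightarrow> int_size a \<le> int_size b"
  using int_size_le_iff[of a "int_size b - 1"] abs_less_int_size[of b] int_size_pos[of b] by simp

lemma int_size_add:
  assumes "int_size a \<le> s" "int_size b \<le> s" shows "int_size (a + b) \<le> Suc s" "int_size (a - b) \<le> Suc s"
proof -
  obtain r where s: "s = Suc r" using assms(1) int_size_pos[of a] by (cases s) auto
  have "\<bar>a\<bar> < 2 ^ r" "\<bar>b\<bar> < 2 ^ r" using assms unfolding s int_size_le_iff by auto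
  then have "\<bar>a + b\<bar> < 2 ^ Suc r" "\<bar>a - b\<bar> < 2 ^ Suc r" by auto
  then show "int_size (a + b) \<le> Suc s" "int_size (a - b) \<le> Suc s" unfolding s int_size_le_iff by blast+
qed

lemma int_size_mult: "int_size (a * b) \<le> int_size a + int_size b"
proof -
  have "\<bar>a * b\<bar> \<le> 2 ^ (int_size a - 1) * 2 ^ (int_size b - 1)"
    unfolding abs_mult using abs_less_int_size[of a] abs_less_int_size[of b] by (intro mult_mono) auto
  also have "\<dots> < 2 ^ (int_size a - 1 + (int_size b - 1) + 1)" by (simp add: power_add)
  finally have "int_size (a * b) \<le> Suc (int_size a - 1 + (int_size b - 1) + 1)" unfolding int_size_le_iff .
  then show ?thesis using int_size_pos[of a] int_size_pos[of b] by simp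
qed

text \<open>Division rounds down, so a negative dividend needs its own estimate; a negative divisor
  is handled by flipping both signs.\<close>

lemma int_size_div: "int_size (a div b) \<le> int_size a"
proof (rule int_size_mono)
  show "\<bar>a div b\<bar> \<le> \<bar>a\<bar>"
  proof (cases "b = 0")
    case False
    have *: "\<bar>x div y\<bar> \<le> \<bar>x\<bar>" if "0 < y" for x y :: int
    proof (cases "0 \<le> x")
      case True
      then have q: "0 \<le> x div y" using that by (simp add: pos_imp_zdiv_nonneg_iff)
      then have "1 * (x div y) \<le> y * (x div y)" using that by (intro mult_right_mono) auto
      also have "\<dots> \<le> x" using that mult_div_mod_eq[of y x] pos_mod_sign[of y x] by linarith
      finally show ?thesis using q by simp
    next
      case False
      then have q: "x div y < 0" using that by (simp add: pos_imp_zdiv_neg_iff)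
      have "x < y * (x div y + 1)"
        using mult_div_mod_eq[of y x] pos_mod_bound[OF that, of x] unfolding distrib_left by linarith
      also have "\<dots> \<le> 1 * (x div y + 1)" using that q by (intro mult_right_mono_neg) auto
      finally show ?thesis using q by simp
    qed
    show ?thesis
    proof (cases "0 < b")
      case True then show ?thesis by (rule *)
    next
      case F: False
      have "a div b = (- a) div (- b)" by simp
      then show ?thesis using *[of "- b" "- a"] F False by simp
    qed
  qed simp
qed

section \<open>Sizes and costs of expressions\<close>

text \<open>Only products are restricted: with two unbounded factors, repeated squaring would double
  the length in each step.\<close>

fun safe_aexp :: "nat \<Rightarrow> mem \<Rightarrow> aexp \<Rightarrow> bool" where
  "safe_aexp g m (Num a) \<longleftrightarrow> True"
| "safe_aexp g m (Mem e) \<longleftrightarrow> safe_aexp g m e"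
| "safe_aexp g m (Add e f) \<longleftrightarrow> safe_aexp g m e \<and> safe_aexp g m f"
| "safe_aexp g m (Sub e f) \<longleftrightarrow> safe_aexp g m e \<and> safe_aexp g m f"
| "safe_aexp g m (Mul e f) \<longleftrightarrow> safe_aexp g m e \<and> safe_aexp g m f \<and> int_size (aval f m) \<le> g"
| "safe_aexp g m (Quot e f) \<longleftrightarrow> safe_aexp g m e \<and> safe_aexp g m f"

fun weight_aexp :: "aexp \<Rightarrow> nat" where
  "weight_aexp (Num a) = int_size a"
| "weight_aexp (Mem e) = weight_aexp e + 1"
| "weight_aexp (Add e f) = weight_aexp e + weight_aexp f + 1"
| "weight_aexp (Sub e f) = weight_aexp e + weight_aexp f + 1"
| "weight_aexp (Mul e f) = weight_aexp e + weight_aexp f + 1"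
| "weight_aexp (Quot e f) = weight_aexp e + weight_aexp f + 1"

text \<open>Sums need one digit more than the longer operand, products add at most \<open>g\<close>,
  and quotients do not grow. Hence the memory bound \<open>Z\<close> enters just once, however large
  the expression.\<close>

lemma int_size_aval:
  assumes "safe_aexp g m e" "0 < g" "\<And>a. int_size (m a) \<le> Z"
  shows "int_size (aval e m) \<le> Z + g * weight_aexp e"
  using assms(1)
proof (induction e)
  case (Num a)
  have "int_size a \<le> g * int_size a" using assms(2) by simp
  then show ?case by (simp only: aval.simps weight_aexp.simps trans_le_add2)
next
  case (Mem e)
  then show ?case using assms(3)[of "aval e m"] by (simp add: trans_le_add1)
next
  case (Add e f)
  let ?X = "Z + g * (weight_aexp e + weight_aexp f)"
  have "int_size (aval e m) \<le> ?X" "int_size (aval f m) \<le> ?X"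
    using Add by (auto simp: distrib_left)
  then have "int_size (aval (Add e f) m) \<le> Suc ?X" by (simp add: int_size_add)
  also have "Suc ?X \<le> Z + g * weight_aexp (Add e f)" using assms(2) by simp
  finally show ?case .
next
  case (Sub e f)
  let ?X = "Z + g * (weight_aexp e + weight_aexp f)"
  have "int_size (aval e m) \<le> ?X" "int_size (aval f m) \<le> ?X"
    using Sub by (auto simp: distrib_left)
  then have "int_size (aval (Sub e f) m) \<le> Suc ?X" by (simp add: int_size_add)
  also have "Suc ?X \<le> Z + g * weight_aexp (Sub e f)" using assms(2) by simp
  finally show ?case .
next
  case (Mul e f)
  then have "int_size (aval e m) \<le> Z + g * weight_aexp e" "int_size (aval f m) \<le> g" by auto
  then show ?case using int_size_mult[of "aval e m" "aval f m"] by (simp add: distrib_left)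
next
  case (Quot e f)
  then show ?case using int_size_div[of "aval e m" "aval f m"] by (simp add: distrib_left)
qed

lemma acost_le:
  assumes "safe_aexp g m e" "0 < g" "\<And>a. int_size (m a) \<le> Z" "Z + g * weight_aexp e \<le> X"
  shows "acost e m \<le> 2 * weight_aexp e * X"
proof -
  have size: "int_size (aval e m) \<le> X" if "safe_aexp g m e" "Z + g * weight_aexp e \<le> X" for e
    using int_size_aval[OF that(1) assms(2,3)] that(2) by simp
  have binary: "acost e m + acost f m + int_size (aval e m) + int_size (aval f m) \<le> 2 * (weight_aexp e + weight_aexp f + 1) * X"
    if "safe_aexp g m e" "safe_aexp g m f" "Z + g * (weight_aexp e + weight_aexp f + 1) \<le> X"
      "Z + g * weight_aexp e \<le> X \<Longrightarrow> acost e m \<le> 2 * weight_aexp e * X"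
      "Z + g * weight_aexp f \<le> X \<Longrightarrow> acost f m \<le> 2 * weight_aexp f * X" for e f
  proof -
    have "Z + g * weight_aexp e \<le> X" "Z + g * weight_aexp f \<le> X" using that(3) by (auto simp: distrib_left)
    then have "acost e m \<le> 2 * weight_aexp e * X" "acost f m \<le> 2 * weight_aexp f * X"
      "int_size (aval e m) \<le> X" "int_size (aval f m) \<le> X" using that size by simp_all
    then show ?thesis by (simp add: algebra_simps)
  qed
  show ?thesis using assms(1,4)
  proof (induction e)
    case (Num a)
    have "0 < g * int_size a" using assms(2) int_size_pos[of a] by simp
    then have "0 < X" using Num.prems(2) unfolding weight_aexp.simps by linarith
    then show ?case by (simp add: trans_le_add1)
  next
    case (Mem e)
    then have le: "Z + g * weight_aexp e \<le> X" and Z: "Z \<le> X" by auto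
    have "int_size (aval e m) \<le> X" using size Mem.prems(1) le by simp
    moreover have "int_size (m (aval e m)) \<le> X" using assms(3) Z order_trans by blast
    ultimately show ?case using Mem le by simp
  qed (use binary in simp_all)
qed

fun safe_bexp :: "nat \<Rightarrow> mem \<Rightarrow> bexp \<Rightarrow> bool" where
  "safe_bexp g m (Less e f) \<longleftrightarrow> safe_aexp g m e \<and> safe_aexp g m f"
| "safe_bexp g m (Neg p) \<longleftrightarrow> safe_bexp g m p"
| "safe_bexp g m (Conj p q) \<longleftrightarrow> safe_bexp g m p \<and> safe_bexp g m q"

fun weight_bexp :: "bexp \<Rightarrow> nat" where
  "weight_bexp (Less e f) = weight_aexp e + weight_aexp f + 1"
| "weight_bexp (Neg p) = weight_bexp p + 1"
| "weight_bexp (Conj p q) = weight_bexp p + weight_bexp q + 1"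

lemma bcost_le:
  assumes "safe_bexp g m p" "0 < g" "\<And>a. int_size (m a) \<le> Z" "Z + g * weight_bexp p \<le> X"
  shows "bcost p m \<le> 2 * weight_bexp p * X"
proof -
  have "0 < X"
  proof -
    have "0 < weight_bexp p" by (cases p) auto
    then have "0 < g * weight_bexp p" using assms(2) by simp
    then show ?thesis using assms(4) by linarith
  qed
  have size: "int_size (aval e m) \<le> X" if "safe_aexp g m e" "Z + g * weight_aexp e \<le> X" for e
    using int_size_aval[OF that(1) assms(2,3)] that(2) by simp
  show ?thesis using assms(1,4)
  proof (induction p)
    case (Less e f)
    then have le: "Z + g * weight_aexp e \<le> X" "Z + g * weight_aexp f \<le> X" by (auto simp: distrib_left)
    have "int_size (aval e m) \<le> X" "int_size (aval f m) \<le> X"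
      using size Less.prems(1) le by simp_all
    moreover have "acost e m \<le> 2 * weight_aexp e * X" "acost f m \<le> 2 * weight_aexp f * X"
      using acost_le[OF _ assms(2,3) le(1)] acost_le[OF _ assms(2,3) le(2)] Less.prems(1) by simp_all
    ultimately show ?case by (simp add: algebra_simps)
  next
    case (Neg p)
    then have "bcost p m \<le> 2 * weight_bexp p * X" by (simp add: distrib_left)
    then show ?case using \<open>0 < X\<close> by (simp add: algebra_simps)
  next
    case (Conj p q)
    then have "bcost p m \<le> 2 * weight_bexp p * X" "bcost q m \<le> 2 * weight_bexp q * X" by (auto simp: distrib_left)
    then show ?case using \<open>0 < X\<close> by (simp add: algebra_simps)
  qed
qed


section \<open>An array language, its weakest preconditions and its compilation\<close>

text \<open>
  Array \<open>0\<close> is the raw memory from address 0 on, which holds input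
  and output; the cells of the arrays \<open>1, \<dots>, 63\<close> are interleaved at negative addresses. The
  first argument of \<open>Wh\<close> is a ghost bound on the number of iterations; it does not occur in the
  compiled program.
\<close>

type_synonym store = "nat \<Rightarrow> int \<Rightarrow> int"

datatype ex = N int | Get nat ex | Plus ex ex | Minus ex ex | Times ex ex | Div ex ex

datatype bx = Lt ex ex | Not bx | And bx bx

datatype cm = Set nat ex ex | Sq cm cm | If bx cm cm | Wh nat bx cm | Nop

primrec ev :: "store \<Rightarrow> ex \<Rightarrow> int" where
  "ev s (N a) = a"
| "ev s (Get f e) = s f (ev s e)"
| "ev s (Plus e e') = ev s e + ev s e'"
| "ev s (Minus e e') = ev s e - ev s e'"
| "ev s (Times e e') = ev s e * ev s e'"
| "ev s (Div e e') = ev s e div ev s e'"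

text \<open>Sizes stay under control because one factor of each product is bounded by \<open>g\<close>.\<close>

primrec ok :: "nat \<Rightarrow> store \<Rightarrow> ex \<Rightarrow> bool" where
  "ok g s (N a) \<longleftrightarrow> True"
| "ok g s (Get f e) \<longleftrightarrow> ok g s e \<and> 0 \<le> ev s e"
| "ok g s (Plus e e') \<longleftrightarrow> ok g s e \<and> ok g s e'"
| "ok g s (Minus e e') \<longleftrightarrow> ok g s e \<and> ok g s e'"
| "ok g s (Times e e') \<longleftrightarrow> ok g s e \<and> ok g s e' \<and> int_size (ev s e') \<le> g"
| "ok g s (Div e e') \<longleftrightarrow> ok g s e \<and> ok g s e'"

primrec evb :: "store \<Rightarrow> bx \<Rightarrow> bool" where
  "evb s (Lt e e') \<longleftrightarrow> ev s e < ev s e'"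
| "evb s (Not p) \<longleftrightarrow> \<not> evb s p"
| "evb s (And p q) \<longleftrightarrow> evb s p \<and> evb s q"

primrec okb :: "nat \<Rightarrow> store \<Rightarrow> bx \<Rightarrow> bool" where
  "okb g s (Lt e e') \<longleftrightarrow> ok g s e \<and> ok g s e'"
| "okb g s (Not p) \<longleftrightarrow> okb g s p"
| "okb g s (And p q) \<longleftrightarrow> okb g s p \<and> okb g s q"

text \<open>Besides total correctness this demands safe evaluation and nonnegative indices. A loop
  is unfolded to \<open>Suc n\<close> tests, which allows at most \<open>n\<close> runs of its
  body.\<close>

primrec wp :: "nat \<Rightarrow> cm \<Rightarrow> (store \<Rightarrow> bool) \<Rightarrow> store \<Rightarrow> bool" where
  "wp g (Set f i e) Q s \<longleftrightarrow> ok g s i \<and> ok g s e \<and> 0 \<le> ev s i \<and> Q (s(f := (s f)(ev s i := ev s e)))"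
| "wp g (Sq c c') Q s \<longleftrightarrow> wp g c (wp g c' Q) s"
| "wp g (If p c c') Q s \<longleftrightarrow> okb g s p \<and> (if evb s p then wp g c Q s else wp g c' Q s)"
| "wp g (Wh n p c) Q s \<longleftrightarrow>
     ((\<lambda>R s. okb g s p \<and> (if evb s p then wp g c R s else Q s)) ^^ Suc n) (\<lambda>_. False) s"
| "wp g Nop Q s \<longleftrightarrow> Q s"

text \<open>The branches of a conditional are added instead of maximized, which keeps the count a
  polynomial expression in the ghost bounds.\<close>

primrec steps :: "cm \<Rightarrow> nat" where
  "steps (Set f i e) = 1"
| "steps (Sq c c') = steps c + steps c'"
| "steps (If p c c') = 1 + steps c + steps c'"
| "steps (Wh n p c) = Suc n * (1 + steps c)"
| "steps Nop = 1"

definition addr :: "nat \<Rightarrow> int \<Rightarrow> int" where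
  "addr f i = (if f = 0 then i else - int f - i * 64)"

primrec fields_ex :: "ex \<Rightarrow> bool" where
  "fields_ex (N a) \<longleftrightarrow> True"
| "fields_ex (Get f e) \<longleftrightarrow> f < 64 \<and> fields_ex e"
| "fields_ex (Plus e e') \<longleftrightarrow> fields_ex e \<and> fields_ex e'"
| "fields_ex (Minus e e') \<longleftrightarrow> fields_ex e \<and> fields_ex e'"
| "fields_ex (Times e e') \<longleftrightarrow> fields_ex e \<and> fields_ex e'"
| "fields_ex (Div e e') \<longleftrightarrow> fields_ex e \<and> fields_ex e'"

primrec fields_bx :: "bx \<Rightarrow> bool" where
  "fields_bx (Lt e e') \<longleftrightarrow> fields_ex e \<and> fields_ex e'"
| "fields_bx (Not p) \<longleftrightarrow> fields_bx p"
| "fields_bx (And p q) \<longleftrightarrow> fields_bx p \<and> fields_bx q"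

primrec fields_cm :: "cm \<Rightarrow> bool" where
  "fields_cm (Set f i e) \<longleftrightarrow> f < 64 \<and> fields_ex i \<and> fields_ex e"
| "fields_cm (Sq c c') \<longleftrightarrow> fields_cm c \<and> fields_cm c'"
| "fields_cm (If p c c') \<longleftrightarrow> fields_bx p \<and> fields_cm c \<and> fields_cm c'"
| "fields_cm (Wh n p c) \<longleftrightarrow> fields_bx p \<and> fields_cm c"
| "fields_cm Nop \<longleftrightarrow> True"

definition comp_addr :: "nat \<Rightarrow> aexp \<Rightarrow> aexp" where
  "comp_addr f a = (if f = 0 then a else Sub (Num (- int f)) (Mul a (Num 64)))"

primrec comp_ex :: "ex \<Rightarrow> aexp" where
  "comp_ex (N a) = Num a"
| "comp_ex (Get f e) = Mem (comp_addr f (comp_ex e))"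
| "comp_ex (Plus e e') = Add (comp_ex e) (comp_ex e')"
| "comp_ex (Minus e e') = Sub (comp_ex e) (comp_ex e')"
| "comp_ex (Times e e') = Mul (comp_ex e) (comp_ex e')"
| "comp_ex (Div e e') = Quot (comp_ex e) (comp_ex e')"

primrec comp_bx :: "bx \<Rightarrow> bexp" where
  "comp_bx (Lt e e') = Less (comp_ex e) (comp_ex e')"
| "comp_bx (Not p) = Neg (comp_bx p)"
| "comp_bx (And p q) = Conj (comp_bx p) (comp_bx q)"

primrec compile :: "cm \<Rightarrow> com" where
  "compile (Set f i e) = Write (comp_addr f (comp_ex i)) (comp_ex e)"
| "compile (Sq c c') = Seq (compile c) (compile c')"
| "compile (If p c c') = Cond (comp_bx p) (compile c) (compile c')"
| "compile (Wh n p c) = While (comp_bx p) (compile c)"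
| "compile Nop = Skip"

primrec weight :: "com \<Rightarrow> nat" where
  "weight (Write e f) = weight_aexp e + weight_aexp f + 1"
| "weight (Seq C D) = weight C + weight D"
| "weight (Cond p C D) = weight_bexp p + 1 + weight C + weight D"
| "weight (While p C) = weight_bexp p + 1 + weight C"
| "weight Skip = 1"

definition represents :: "store \<Rightarrow> mem \<Rightarrow> bool" where
  "represents s m \<longleftrightarrow> (\<forall>f<64. \<forall>i\<ge>0. m (addr f i) = s f i)"

text \<open>Array 0 keeps the nonnegative addresses and all others have negative ones, where the
  residue modulo 64 reveals the array.\<close>

lemma addr_inj:
  assumes "addr f i = addr f' i'" "f < 64" "f' < 64" "0 \<le> i" "0 \<le> i'"
  shows "f = f' \<and> i = i'"
proof -
  consider "f = 0" "f' = 0" | "f = 0" "0 < f'" | "0 < f" "f' = 0" | "0 < f" "0 < f'" by auto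
  then show ?thesis
  proof cases
    case 4
    then have eq: "int f + i * 64 = int f' + i' * 64" using assms(1) unfolding addr_def by simp
    have "(int f + i * 64) mod 64 = int f" "(int f' + i' * 64) mod 64 = int f'"
      unfolding mod_mult_self1 using assms(2,3) by (simp_all add: mod_pos_pos_trivial)
    with eq have "int f = int f'" by simp
    with eq show ?thesis by simp
  qed (use assms in \<open>auto simp: addr_def\<close>)
qed

lemma represents_update:
  assumes "represents s m" "f < 64" "0 \<le> i"
  shows "represents (s(f := (s f)(i := a))) (m(addr f i := a))"
  unfolding represents_def
proof (intro allI impI)
  fix f' i' assume "f' < (64 :: nat)" "0 \<le> (i' :: int)"
  then show "(m(addr f i := a)) (addr f' i') = (s(f := (s f)(i := a))) f' i'"
    using assms addr_inj[of f i f' i'] unfolding represents_def by auto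
qed

lemma comp_addr:
  assumes "aval a m = i" "safe_aexp g m a" "8 \<le> g"
  shows "aval (comp_addr f a) m = addr f i" "safe_aexp g m (comp_addr f a)"
proof -
  have "int_size 64 \<le> Suc 7" unfolding int_size_le_iff by simp
  then have "int_size 64 \<le> g" using assms(3) by simp
  then show "aval (comp_addr f a) m = addr f i" "safe_aexp g m (comp_addr f a)"
    using assms unfolding comp_addr_def addr_def by auto
qed

lemma comp_ex:
  assumes "represents s m" "8 \<le> g" "ok g s e" "fields_ex e"
  shows "aval (comp_ex e) m = ev s e \<and> safe_aexp g m (comp_ex e)"
  using assms(3,4)
proof (induction e)
  case (Get f e)
  then have e: "aval (comp_ex e) m = ev s e" "safe_aexp g m (comp_ex e)" by auto
  then show ?case using comp_addr[OF e assms(2), of f] Get.prems assms(1) unfolding represents_def by simp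
qed auto

lemma comp_bx:
  assumes "represents s m" "8 \<le> g" "okb g s p" "fields_bx p"
  shows "bval (comp_bx p) m = evb s p \<and> safe_bexp g m (comp_bx p)"
  using assms(3,4)
  by (induction p) (simp_all add: comp_ex[OF assms(1,2)])

lemma wp_mono:
  assumes "wp g c Q s" "\<And>s. Q s \<Longrightarrow> Q' s"
  shows "wp g c Q' s"
  using assms
proof (induction c arbitrary: Q Q' s)
  case (Sq c c')
  then show ?case unfolding wp.simps by blast
next
  case (Wh n p c)
  have "((\<lambda>R s. okb g s p \<and> (if evb s p then wp g c R s else Q s)) ^^ m) (\<lambda>_. False) s \<Longrightarrow>
        ((\<lambda>R s. okb g s p \<and> (if evb s p then wp g c R s else Q' s)) ^^ m) (\<lambda>_. False) s" for m s
  proof (induction m arbitrary: s)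
    case (Suc m)
    show ?case
    proof (cases "evb s p")
      case True
      have "wp g c (((\<lambda>R s. okb g s p \<and> (if evb s p then wp g c R s else Q' s)) ^^ m) (\<lambda>_. False)) s"
      proof (rule Wh.IH)
        show "wp g c (((\<lambda>R s. okb g s p \<and> (if evb s p then wp g c R s else Q s)) ^^ m) (\<lambda>_. False)) s"
          using Suc.prems True by simp
      qed (rule Suc.IH)
      then show ?thesis using Suc.prems True by simp
    next
      case False
      then show ?thesis using Suc.prems Wh.prems(2) by simp
    qed
  qed simp
  then show ?case using Wh.prems(1) unfolding wp.simps by blast
next
  case (If p c c')
  then show ?case unfolding wp.simps by (metis (full_types))
qed auto

lemma budget_mono:
  fixes t n W Z a b :: nat
  assumes "t \<le> n * (2 * W * (Z + a))" "a \<le> b" shows "t \<le> n * (2 * W * (Z + b))"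
proof -
  have "n * (2 * W * (Z + a)) \<le> n * (2 * W * (Z + b))" using assms(2) by (intro mult_left_mono) auto
  with assms(1) show ?thesis by linarith
qed

text \<open>The expressions of one command have weight at most \<open>W\<close>, so a command
  lengthens the contents of memory by at most \<open>g * W\<close>. After \<open>steps c\<close>
  commands this has added up linearly, and each command costs at most \<open>2 * W\<close> times the
  final size bound.\<close>

theorem wp_sound:
  assumes "wp g c Q s" "represents s m" "\<And>a. int_size (m a) \<le> Z"
    and "8 \<le> g" "fields_cm c" "weight (compile c) \<le> W"
  shows "\<exists>t m' s'. exec (compile c) m t m' \<and> represents s' m' \<and> Q s' \<and>
    (\<forall>a. int_size (m' a) \<le> Z + steps c * (g * W)) \<and> t \<le> steps c * (2 * W * (Z + steps c * (g * W)))"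
  using assms(1-3,5,6)
proof (induction c arbitrary: Q s m Z)
  case (Set f i e)
  have e: "aval (comp_ex e) m = ev s e" "safe_aexp g m (comp_ex e)"
    and i: "aval (comp_ex i) m = ev s i" "safe_aexp g m (comp_ex i)"
    using comp_ex[OF Set.prems(2) assms(4), of e] comp_ex[OF Set.prems(2) assms(4), of i] Set.prems by auto
  note a = comp_addr[OF i assms(4), of f]
  let ?A = "comp_addr f (comp_ex i)" and ?X = "Z + g * W"
  have w: "weight_aexp ?A + weight_aexp (comp_ex e) + 1 \<le> W" using Set.prems by simp
  have g0: "0 < g" using assms(4) by simp
  have X: "Z + g * weight_aexp ?A \<le> ?X" "Z + g * weight_aexp (comp_ex e) \<le> ?X"
    using w by (auto intro: mult_left_mono)
  have size: "int_size (aval ?A m) \<le> ?X" "int_size (aval (comp_ex e) m) \<le> ?X"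
    by (rule order_trans[OF int_size_aval[OF a(2) g0 Set.prems(3)] X(1)],
        rule order_trans[OF int_size_aval[OF e(2) g0 Set.prems(3)] X(2)])
  have cost: "acost ?A m \<le> 2 * weight_aexp ?A * ?X" "acost (comp_ex e) m \<le> 2 * weight_aexp (comp_ex e) * ?X"
    using acost_le[OF a(2) g0 Set.prems(3) X(1)] acost_le[OF e(2) g0 Set.prems(3) X(2)] by simp_all
  have "acost ?A m + acost (comp_ex e) m + int_size (aval ?A m) + int_size (aval (comp_ex e) m) \<le>
      2 * (weight_aexp ?A + weight_aexp (comp_ex e) + 1) * ?X"
    using cost size by (simp add: algebra_simps)
  also have "\<dots> \<le> 2 * W * ?X" using w by (intro mult_right_mono mult_left_mono) auto
  finally have t: "acost ?A m + acost (comp_ex e) m + int_size (aval ?A m) + int_size (aval (comp_ex e) m) \<le> 2 * W * ?X" .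
  have "represents (s(f := (s f)(ev s i := ev s e))) (m(aval ?A m := aval (comp_ex e) m))"
    unfolding a(1) e(1) by (rule represents_update) (use Set.prems in auto)
  moreover have "int_size ((m(aval ?A m := aval (comp_ex e) m)) x) \<le> ?X" for x
    using Set.prems(3)[of x] size(2) by (simp add: trans_le_add1)
  moreover have "Q (s(f := (s f)(ev s i := ev s e)))" using Set.prems by simp
  ultimately show ?case using exec.Write[of ?A "comp_ex e" m] t by (simp del: fun_upd_apply) blast
next
  case (Sq c c')
  from Sq.IH(1)[OF _ Sq.prems(2,3), of "wp g c' Q"] Sq.prems obtain t1 m1 s1 where
    1: "exec (compile c) m t1 m1" "represents s1 m1" "wp g c' Q s1"
      "\<And>a. int_size (m1 a) \<le> Z + steps c * (g * W)" "t1 \<le> steps c * (2 * W * (Z + steps c * (g * W)))"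
    by auto
  from Sq.IH(2)[OF 1(3,2,4)] Sq.prems obtain t2 m2 s2 where
    2: "exec (compile c') m1 t2 m2" "represents s2 m2" "Q s2"
      "\<And>a. int_size (m2 a) \<le> Z + steps c * (g * W) + steps c' * (g * W)"
      "t2 \<le> steps c' * (2 * W * (Z + steps c * (g * W) + steps c' * (g * W)))"
    by auto
  let ?X = "Z + (steps c + steps c') * (g * W)"
  have X: "Z + steps c * (g * W) + steps c' * (g * W) = ?X" by (simp add: distrib_right)
  have "t1 + t2 \<le> steps c * (2 * W * ?X) + steps c' * (2 * W * ?X)"
    using 1(5) 2(5) unfolding X
    by (intro add_mono) (auto elim!: order_trans intro!: mult_left_mono simp: distrib_right)
  then have "t1 + t2 \<le> steps (Sq c c') * (2 * W * (Z + steps (Sq c c') * (g * W)))"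
    by (simp add: distrib_right)
  moreover have "exec (compile (Sq c c')) m (t1 + t2) m2" using exec.Seq[OF 1(1) 2(1)] by simp
  moreover have "int_size (m2 a) \<le> Z + steps (Sq c c') * (g * W)" for a using 2(4)[of a] X by simp
  ultimately show ?case using 2 by blast
next
  case (If p c c')
  have g0: "0 < g" using assms(4) by simp
  have p: "bval (comp_bx p) m = evb s p" "safe_bexp g m (comp_bx p)"
    using comp_bx[OF If.prems(2) assms(4), of p] If.prems by auto
  let ?n = "1 + steps c + steps c'"
  let ?X = "Z + ?n * (g * W)"
  have w: "weight_bexp (comp_bx p) + 1 \<le> W" using If.prems by simp
  have X1: "Z + g * weight_bexp (comp_bx p) \<le> Z + g * W" using w by (auto intro: mult_left_mono)
  have "0 < g * W" using g0 w by (metis add_gr_0 less_le_trans nat_0_less_mult_iff zero_less_one)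
  then have "1 \<le> Z + g * W" by linarith
  then have "1 + bcost (comp_bx p) m \<le> 2 * (weight_bexp (comp_bx p) + 1) * (Z + g * W)"
    using bcost_le[OF p(2) g0 If.prems(3) X1] by (simp add: algebra_simps)
  also have "\<dots> \<le> 2 * W * ?X" using w by (intro mult_mono) auto
  finally have pc: "1 + bcost (comp_bx p) m \<le> 2 * W * ?X" .
  show ?case
  proof (cases "evb s p")
    case True
    from If.IH(1)[OF _ If.prems(2,3), of Q] If.prems True obtain t m' s' where
      *: "exec (compile c) m t m'" "represents s' m'" "Q s'"
      "\<And>a. int_size (m' a) \<le> Z + steps c * (g * W)" "t \<le> steps c * (2 * W * (Z + steps c * (g * W)))"
      by auto
    have "t \<le> steps c * (2 * W * ?X)"
      by (rule budget_mono[OF *(5)]) (simp add: distrib_right)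
    then have "1 + bcost (comp_bx p) m + t \<le> ?n * (2 * W * ?X)"
      using pc unfolding distrib_right mult_1_left by linarith
    moreover have "int_size (m' a) \<le> ?X" for a using *(4)[of a] by (simp add: distrib_right)
    moreover have "exec (compile (If p c c')) m (1 + bcost (comp_bx p) m + t) m'"
      using exec.CondTrue[OF _ *(1)] p True by simp
    ultimately show ?thesis using *(2,3) unfolding steps.simps by blast
  next
    case False
    from If.IH(2)[OF _ If.prems(2,3), of Q] If.prems False obtain t m' s' where
      *: "exec (compile c') m t m'" "represents s' m'" "Q s'"
      "\<And>a. int_size (m' a) \<le> Z + steps c' * (g * W)" "t \<le> steps c' * (2 * W * (Z + steps c' * (g * W)))"
      by auto
    have "t \<le> steps c' * (2 * W * ?X)"
      by (rule budget_mono[OF *(5)]) (simp add: distrib_right)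
    then have "1 + bcost (comp_bx p) m + t \<le> ?n * (2 * W * ?X)"
      using pc unfolding distrib_right mult_1_left by linarith
    moreover have "int_size (m' a) \<le> ?X" for a using *(4)[of a] by (simp add: distrib_right)
    moreover have "exec (compile (If p c c')) m (1 + bcost (comp_bx p) m + t) m'"
      using exec.CondFalse[OF _ *(1)] p False by simp
    ultimately show ?thesis using *(2,3) unfolding steps.simps by blast
  qed
next
  case (Wh n p c)
  have g0: "0 < g" using assms(4) by simp
  let ?F = "\<lambda>R s. okb g s p \<and> (if evb s p then wp g c R s else Q s)"
  \<comment> \<open>The size bound \<open>Z\<close> is generalized, as every round starts from the
    sizes that the previous round has left.\<close>
  have "\<exists>t m' s'. exec (While (comp_bx p) (compile c)) m t m' \<and> represents s' m' \<and> Q s' \<and>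
      (\<forall>a. int_size (m' a) \<le> Z + j * (1 + steps c) * (g * W)) \<and>
      t \<le> j * (1 + steps c) * (2 * W * (Z + j * (1 + steps c) * (g * W)))"
    if "(?F ^^ j) (\<lambda>_. False) s" "represents s m" "\<And>a. int_size (m a) \<le> Z" for j s m Z
    using that
  proof (induction j arbitrary: s m Z)
    case (Suc j)
    have p: "bval (comp_bx p) m = evb s p" "safe_bexp g m (comp_bx p)"
      using comp_bx[OF Suc.prems(2) assms(4), of p] Suc.prems(1) Wh.prems by auto
    have w: "weight_bexp (comp_bx p) + 1 \<le> W" using Wh.prems by simp
    have X1: "Z + g * weight_bexp (comp_bx p) \<le> Z + g * W" using w by (auto intro: mult_left_mono)
    have "0 < g * W" using g0 w by (metis add_gr_0 less_le_trans nat_0_less_mult_iff zero_less_one)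
    then have "1 \<le> Z + g * W" by linarith
    then have "1 + bcost (comp_bx p) m \<le> 2 * (weight_bexp (comp_bx p) + 1) * (Z + g * W)"
      using bcost_le[OF p(2) g0 Suc.prems(3) X1] by (simp add: algebra_simps)
    also have "\<dots> \<le> 2 * W * (Z + g * W)" using w by (intro mult_right_mono mult_left_mono) auto
    finally have pc: "1 + bcost (comp_bx p) m \<le> 2 * W * (Z + g * W)" .
    let ?n = "Suc j * (1 + steps c)"
    let ?X = "Z + ?n * (g * W)"
    have "Z + g * W \<le> ?X" by simp
    then have "2 * W * (Z + g * W) \<le> 2 * W * ?X" by (rule mult_left_mono) simp
    with pc have pc: "1 + bcost (comp_bx p) m \<le> 2 * W * ?X" by linarith
    show ?case
    proof (cases "evb s p")
      case True
      have "wp g c ((?F ^^ j) (\<lambda>_. False)) s" using Suc.prems(1) True by simp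
      from Wh.IH[OF this Suc.prems(2,3)] Wh.prems obtain t1 m1 s1 where
        1: "exec (compile c) m t1 m1" "represents s1 m1" "(?F ^^ j) (\<lambda>_. False) s1"
          "\<And>a. int_size (m1 a) \<le> Z + steps c * (g * W)" "t1 \<le> steps c * (2 * W * (Z + steps c * (g * W)))"
        by auto
      from Suc.IH[OF 1(3,2,4)] obtain t2 m2 s2 where
        2: "exec (While (comp_bx p) (compile c)) m1 t2 m2" "represents s2 m2" "Q s2"
          "\<And>a. int_size (m2 a) \<le> Z + steps c * (g * W) + j * (1 + steps c) * (g * W)"
          "t2 \<le> j * (1 + steps c) * (2 * W * (Z + steps c * (g * W) + j * (1 + steps c) * (g * W)))"
        by blast
      have X2: "Z + steps c * (g * W) + j * (1 + steps c) * (g * W) \<le> ?X" by (simp add: algebra_simps)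
      have "t1 \<le> steps c * (2 * W * ?X)"
        by (rule budget_mono[OF 1(5)]) (simp add: algebra_simps)
      moreover have "t2 \<le> j * (1 + steps c) * (2 * W * ?X)"
        using 2(5) by (elim order_trans) (intro mult_left_mono X2; simp)
      ultimately have "1 + bcost (comp_bx p) m + t1 + t2 \<le>
          2 * W * ?X + steps c * (2 * W * ?X) + j * (1 + steps c) * (2 * W * ?X)"
        using pc by linarith
      also have "\<dots> = ?n * (2 * W * ?X)" by (simp only: distrib_right mult_Suc mult_1_left)
      finally have "1 + bcost (comp_bx p) m + t1 + t2 \<le> ?n * (2 * W * ?X)" .
      moreover have "int_size (m2 a) \<le> ?X" for a using 2(4)[of a] X2 by linarith
      moreover have "exec (While (comp_bx p) (compile c)) m (1 + bcost (comp_bx p) m + t1 + t2) m2"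
        using exec.WhileTrue[OF _ 1(1) 2(1)] p True by simp
      ultimately show ?thesis using 2(2,3) by blast
    next
      case False
      have "1 + bcost (comp_bx p) m \<le> ?n * (2 * W * ?X)" using pc by (simp add: trans_le_add1)
      moreover have "int_size (m a) \<le> ?X" for a using Suc.prems(3)[of a] by simp
      moreover have "exec (While (comp_bx p) (compile c)) m (1 + bcost (comp_bx p) m) m"
        using exec.WhileFalse p False by simp
      moreover have "Q s" using Suc.prems(1) False by simp
      ultimately show ?thesis using Suc.prems(2) by blast
    qed
  qed simp
  from this[of "Suc n", OF _ Wh.prems(2,3)] Wh.prems(1) show ?case by simp
next
  case Nop
  have "1 \<le> 2 * W * (Z + g * W)"
  proof -
    have "0 < W" "0 < g" using Nop.prems assms(4) by auto
    then have "0 < 2 * W * (Z + g * W)" by simp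
    then show ?thesis by linarith
  qed
  then show ?case using Nop exec.Skip by (force simp: trans_le_add1)
qed

section \<open>Frame and loop rules\<close>

primrec mods :: "cm \<Rightarrow> nat set" where
  "mods (Set f i e) = {f}"
| "mods (Sq c c') = mods c \<union> mods c'"
| "mods (If p c c') = mods c \<union> mods c'"
| "mods (Wh n p c) = mods c"
| "mods Nop = {}"

definition agree :: "nat set \<Rightarrow> store \<Rightarrow> store \<Rightarrow> bool" where
  "agree F s s' \<longleftrightarrow> (\<forall>f. f \<notin> F \<longrightarrow> s' f = s f)"

lemma agree_refl: "agree F s s" by (simp add: agree_def)

lemma agree_trans: "agree F s s' \<Longrightarrow> agree F s' s'' \<Longrightarrow> agree F s s''" by (simp add: agree_def)

lemma agree_mono: "agree F s s' \<Longrightarrow> F \<subseteq> F' \<Longrightarrow> agree F' s s'" by (auto simp: agree_def)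

lemma agreeD: "agree F s s' \<Longrightarrow> f \<notin> F \<Longrightarrow> s' f = s f" by (simp add: agree_def)

text \<open>The frame condition is syntactic and proved once, so that invariants only have to
  mention the arrays that a program changes.\<close>

lemma wp_frame:
  assumes "wp g c Q s"
  shows "wp g c (\<lambda>s'. Q s' \<and> agree (mods c) s s') s"
  using assms
proof (induction c arbitrary: Q s)
  case (Set f i e)
  then show ?case by (simp add: agree_def)
next
  case (Sq c c')
  then have "wp g c (wp g c' Q) s" by simp
  from Sq.IH(1)[OF this] have "wp g c (\<lambda>s'. wp g c' Q s' \<and> agree (mods c) s s') s" .
  then have "wp g c (wp g c' (\<lambda>s'. Q s' \<and> agree (mods (Sq c c')) s s')) s"
  proof (rule wp_mono)
    fix s1 assume 1: "wp g c' Q s1 \<and> agree (mods c) s s1"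
    then have "wp g c' (\<lambda>s'. Q s' \<and> agree (mods c') s1 s') s1" using Sq.IH(2) by blast
    then show "wp g c' (\<lambda>s'. Q s' \<and> agree (mods (Sq c c')) s s') s1"
      by (rule wp_mono) (use 1 in \<open>auto simp: agree_def\<close>)
  qed
  then show ?case by simp
next
  case (If p c c')
  show ?case
  proof (cases "evb s p")
    case True
    then have "wp g c (\<lambda>s'. Q s' \<and> agree (mods c) s s') s" using If by simp
    then have "wp g c (\<lambda>s'. Q s' \<and> agree (mods (If p c c')) s s') s"
      by (rule wp_mono) (auto simp: agree_def)
    then show ?thesis using If.prems True by simp
  next
    case False
    then have "wp g c' (\<lambda>s'. Q s' \<and> agree (mods c') s s') s" using If by simp
    then have "wp g c' (\<lambda>s'. Q s' \<and> agree (mods (If p c c')) s s') s"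
      by (rule wp_mono) (auto simp: agree_def)
    then show ?thesis using If.prems False by simp
  qed
next
  case (Wh n p c)
  let ?F = "\<lambda>R s. okb g s p \<and> (if evb s p then wp g c R s else Q s)"
  \<comment> \<open>The frame refers to the store \<open>s0\<close> before the loop, which stays
    fixed while \<open>s\<close> runs through the rounds.\<close>
  let ?G = "\<lambda>s0 R s. okb g s p \<and> (if evb s p then wp g c R s else Q s \<and> agree (mods c) s0 s)"
  have "(?F ^^ j) (\<lambda>_. False) s \<Longrightarrow> agree (mods c) s0 s \<Longrightarrow> (?G s0 ^^ j) (\<lambda>_. False) s" for j s0 s
  proof (induction j arbitrary: s)
    case (Suc j)
    show ?case
    proof (cases "evb s p")
      case True
      then have "wp g c ((?F ^^ j) (\<lambda>_. False)) s" using Suc.prems by simp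
      from Wh.IH[OF this] have "wp g c (\<lambda>s'. (?F ^^ j) (\<lambda>_. False) s' \<and> agree (mods c) s s') s" .
      then have "wp g c ((?G s0 ^^ j) (\<lambda>_. False)) s"
      proof (rule wp_mono)
        fix s' assume *: "(?F ^^ j) (\<lambda>_. False) s' \<and> agree (mods c) s s'"
        then have "agree (mods c) s0 s'" using agree_trans Suc.prems(2) by blast
        then show "(?G s0 ^^ j) (\<lambda>_. False) s'" using Suc.IH * by blast
      qed
      then show ?thesis using Suc.prems(1) True by simp
    next
      case False
      then show ?thesis using Suc.prems by simp
    qed
  qed simp
  then show ?case using Wh.prems agree_refl unfolding wp.simps mods.simps by blast
next
  case Nop
  then show ?case by (simp add: agree_refl)
qed

lemma wp_Sq: "wp g (Sq c c') Q = wp g c (wp g c' Q)"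
  by (rule ext) simp

lemma wp_conseq:
  assumes "wp g c Q s" "\<And>s'. Q s' \<Longrightarrow> agree (mods c) s s' \<Longrightarrow> Q' s'"
  shows "wp g c Q' s"
  by (rule wp_mono[OF wp_frame[OF assms(1)]]) (use assms(2) in blast)

text \<open>The index of \<open>I\<close> is the number of iterations still allowed, so a single
  invariant yields correctness, termination and the ghost bound. Each premise may use the frame back
  to the start of the loop.\<close>

lemma wp_Wh:
  assumes "I n s"
    and "\<And>m s'. I m s' \<Longrightarrow> agree (mods c) s s' \<Longrightarrow> okb g s' p"
    and step: "\<And>m s'. I m s' \<Longrightarrow> agree (mods c) s s' \<Longrightarrow> evb s' p \<Longrightarrow> \<exists>m'. m = Suc m' \<and> wp g c (I m') s'"
    and post: "\<And>m s'. I m s' \<Longrightarrow> agree (mods c) s s' \<Longrightarrow> \<not> evb s' p \<Longrightarrow> Q s'"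
  shows "wp g (Wh n p c) Q s"
proof -
  let ?F = "\<lambda>R s. okb g s p \<and> (if evb s p then wp g c R s else Q s)"
  have "I m s' \<Longrightarrow> agree (mods c) s s' \<Longrightarrow> (?F ^^ Suc m) (\<lambda>_. False) s'" for m s'
  proof (induction m arbitrary: s')
    case 0
    have "\<not> evb s' p" using step[OF 0] by blast
    then show ?case using assms(2)[OF 0] post[OF 0] by simp
  next
    case (Suc m)
    show ?case
    proof (cases "evb s' p")
      case True
      then have "wp g c (I m) s'" using step[OF Suc.prems True] by auto
      then have "wp g c ((?F ^^ Suc m) (\<lambda>_. False)) s'"
        by (rule wp_conseq) (use Suc.IH Suc.prems(2) agree_trans in blast)
      then show ?thesis using True assms(2)[OF Suc.prems] by simp
    next
      case False
      then show ?thesis using assms(2)[OF Suc.prems] post[OF Suc.prems] by simp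
    qed
  qed
  then show ?thesis using assms(1) agree_refl unfolding wp.simps by blast
qed

abbreviation V :: "nat \<Rightarrow> ex" where "V f \<equiv> Get f (N 0)"
abbreviation Assign :: "nat \<Rightarrow> ex \<Rightarrow> cm" where "Assign f e \<equiv> Set f (N 0) e"

definition For :: "nat \<Rightarrow> nat \<Rightarrow> ex \<Rightarrow> cm \<Rightarrow> cm" where
  "For n v hi c = Sq (Assign v (N 0)) (Wh n (Lt (V v) hi) (Sq c (Assign v (Plus (V v) (N 1)))))"

lemma mods_For: "mods (For n v hi c) = insert v (mods c)"
  by (auto simp: For_def)

lemma steps_For: "steps (For n v hi c) = 1 + Suc n * (2 + steps c)"
  by (simp add: For_def)

text \<open>The invariant \<open>I i\<close> speaks about the other arrays only, hence the premise on updates of \<open>v\<close>.\<close>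

lemma wp_For:
  assumes init: "I 0 s" and v: "v \<notin> mods c"
    and indep: "\<And>i s x. I i s \<Longrightarrow> I i (s(v := x))"
    and hi: "\<And>s'. agree (insert v (mods c)) s s' \<Longrightarrow> ok g s' hi \<and> ev s' hi = int n"
    and step: "\<And>i s'. i < n \<Longrightarrow> I i s' \<Longrightarrow> agree (insert v (mods c)) s s' \<Longrightarrow> s' v 0 = int i \<Longrightarrow> wp g c (I (Suc i)) s'"
    and post: "\<And>s'. I n s' \<Longrightarrow> agree (insert v (mods c)) s s' \<Longrightarrow> Q s'"
  shows "wp g (For n v hi c) Q s"
proof -
  let ?s = "s(v := (s v)(0 := 0))"
  let ?c = "Sq c (Assign v (Plus (V v) (N 1)))"
  have agr: "agree (insert v (mods c)) s s'" if "agree (mods ?c) ?s s'" for s'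
    using that by (auto simp: agree_def split: if_splits)
  have "wp g (Wh n (Lt (V v) hi) ?c) Q ?s"
  \<comment> \<open>The loop rule counts down while the loop variable counts up, hence
    \<open>n - m\<close>.\<close>
  proof (rule wp_Wh[where I = "\<lambda>m s'. m \<le> n \<and> I (n - m) s' \<and> s' v 0 = int (n - m)"])
    show "n \<le> n \<and> I (n - n) ?s \<and> ?s v 0 = int (n - n)" using indep[OF init] by simp
  next
    fix m s' assume "m \<le> n \<and> I (n - m) s' \<and> s' v 0 = int (n - m)" "agree (mods ?c) ?s s'"
    then show "okb g s' (Lt (V v) hi)" using hi[OF agr] by simp
  next
    fix m s' assume I: "m \<le> n \<and> I (n - m) s' \<and> s' v 0 = int (n - m)" and a: "agree (mods ?c) ?s s'"
      and e: "evb s' (Lt (V v) hi)"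
    then have "n - m < n" using hi[OF agr[OF a]] by simp
    then obtain m' where m: "m = Suc m'" using I by (cases m) auto
    have nm: "Suc (n - m) = n - m'" using m I by auto
    have "wp g c (I (Suc (n - m))) s'"
      by (rule step) (use I agr[OF a] \<open>n - m < n\<close> in auto)
    then have "wp g c (wp g (Assign v (Plus (V v) (N 1)))
        (\<lambda>s'. m' \<le> n \<and> I (n - m') s' \<and> s' v 0 = int (n - m'))) s'"
    proof (rule wp_conseq)
      fix s'' assume J: "I (Suc (n - m)) s''" and "agree (mods c) s' s''"
      then have "s'' v = s' v" using v by (rule_tac agreeD)
      then have "s'' v 0 + 1 = int (n - m')" using I nm by (simp flip: nm)
      then show "wp g (Assign v (Plus (V v) (N 1))) (\<lambda>s'. m' \<le> n \<and> I (n - m') s' \<and> s' v 0 = int (n - m')) s''"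
        using indep[OF J] I m nm by simp
    qed
    then have "wp g ?c (\<lambda>s'. m' \<le> n \<and> I (n - m') s' \<and> s' v 0 = int (n - m')) s'"
      unfolding wp.simps(2) .
    then show "\<exists>m'. m = Suc m' \<and> wp g ?c (\<lambda>s'. m' \<le> n \<and> I (n - m') s' \<and> s' v 0 = int (n - m')) s'"
      using m by blast
  next
    fix m s' assume I: "m \<le> n \<and> I (n - m) s' \<and> s' v 0 = int (n - m)" and a: "agree (mods ?c) ?s s'"
      and e: "\<not> evb s' (Lt (V v) hi)"
    then have "n - m = n" using hi[OF agr[OF a]] by simp
    then have "I n s'" using I by simp
    then show "Q s'" by (rule post[OF _ agr[OF a]])
  qed
  then show ?thesis unfolding For_def wp.simps(2) wp.simps(1) by (simp only: ok.simps ev.simps simp_thms order_refl)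
qed

section \<open>The Hungarian method as a program\<close>

text \<open>Scalars \<open>x_\<dots>\<close> are stored in cell 0 of their array; \<open>a_p j\<close> is -1 for a free column \<open>j\<close>.\<close>

abbreviation "x_n \<equiv> (24::nat)"
abbreviation "x_k \<equiv> (2::nat)"
abbreviation "x_i \<equiv> (3::nat)"
abbreviation "x_j \<equiv> (4::nat)"
abbreviation "x_t \<equiv> (5::nat)"
abbreviation "x_r \<equiv> (6::nat)"
abbreviation "x_K \<equiv> (7::nat)"
abbreviation "x_H \<equiv> (8::nat)"
abbreviation "x_lo \<equiv> (9::nat)"
abbreviation "x_hi \<equiv> (10::nat)"
abbreviation "x_mid \<equiv> (11::nat)"
abbreviation "x_lam \<equiv> (12::nat)"
abbreviation "x_cnt \<equiv> (13::nat)"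
abbreviation "x_lb \<equiv> (14::nat)"
abbreviation "x_j0 \<equiv> (15::nat)"
abbreviation "x_delta \<equiv> (16::nat)"
abbreviation "x_found \<equiv> (17::nat)"
abbreviation "x_j1 \<equiv> (18::nat)"
abbreviation "x_jw \<equiv> (19::nat)"
abbreviation "x_cur \<equiv> (20::nat)"
abbreviation "x_s \<equiv> (21::nat)"
abbreviation "x_a \<equiv> (22::nat)"
abbreviation "x_m \<equiv> (23::nat)"
abbreviation "a_num \<equiv> (31::nat)"
abbreviation "a_E \<equiv> (32::nat)"
abbreviation "a_A \<equiv> (33::nat)"
abbreviation "a_N \<equiv> (34::nat)"
abbreviation "a_C \<equiv> (35::nat)"
abbreviation "a_u \<equiv> (36::nat)"
abbreviation "a_v \<equiv> (37::nat)"
abbreviation "a_p \<equiv> (38::nat)"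
abbreviation "a_used \<equiv> (39::nat)"
abbreviation "a_way \<equiv> (40::nat)"

abbreviation entry_at :: "nat \<Rightarrow> ex \<Rightarrow> ex \<Rightarrow> ex" where
  "entry_at f a b \<equiv> Get f (Plus (Times a (V x_n)) b)"

text \<open>The flag \<open>x_found\<close> stands in for an infinite initial value of
  \<open>x_delta\<close>: the first candidate is always accepted.\<close>

definition scan_cell :: cm where
  "scan_cell = If (Lt (N 0) (Get a_used (V x_j))) Nop
     (Sq (Assign x_cur (Minus (Minus (entry_at a_C (Get a_p (V x_a)) (V x_j))
           (Get a_u (Get a_p (V x_a)))) (Get a_v (V x_j))))
       (If (And (Not (Lt (V x_found) (N 1))) (Not (Lt (V x_cur) (V x_delta)))) Nop
         (Sq (Assign x_delta (V x_cur)) (Sq (Assign x_found (N 1))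
           (Sq (Assign x_j1 (V x_j)) (Assign x_jw (V x_a)))))))"

definition scan_row :: "nat \<Rightarrow> cm" where
  "scan_row n = If (Lt (N 0) (Get a_used (V x_a))) (For n x_j (V x_n) scan_cell) Nop"

definition tree_scan :: "nat \<Rightarrow> cm" where
  "tree_scan n = For (Suc n) x_a (Plus (V x_n) (N 1)) (scan_row n)"

definition update_cell :: cm where
  "update_cell = If (Lt (N 0) (Get a_used (V x_a)))
     (Sq (Set a_u (Get a_p (V x_a)) (Plus (Get a_u (Get a_p (V x_a))) (V x_delta)))
         (Set a_v (V x_a) (Minus (Get a_v (V x_a)) (V x_delta))))
     Nop"

definition tree_update :: "nat \<Rightarrow> cm" where
  "tree_update n = For (Suc n) x_a (Plus (V x_n) (N 1)) update_cell"

definition tree_body :: "nat \<Rightarrow> cm" where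
  "tree_body n = Sq (Set a_used (V x_j0) (N 1)) (Sq (Assign x_found (N 0)) (Sq (tree_scan n)
     (Sq (Set a_way (V x_j1) (V x_jw)) (Sq (tree_update n) (Assign x_j0 (V x_j1))))))"

definition tree_loop :: "nat \<Rightarrow> cm" where
  "tree_loop n = Wh (Suc n) (Lt (N (-1)) (Get a_p (V x_j0))) (tree_body n)"

definition augment_body :: cm where
  "augment_body = Sq (Assign x_j1 (Get a_way (V x_j0))) (Sq (Set a_p (V x_j0) (Get a_p (V x_j1)))
     (Assign x_j0 (V x_j1)))"

definition augment :: "nat \<Rightarrow> cm" where
  "augment n = Wh (Suc n) (Lt (V x_j0) (V x_n)) augment_body"

definition stage :: "nat \<Rightarrow> cm" where
  "stage n = Sq (Set a_p (V x_n) (V x_s))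
     (Sq (For (Suc n) x_a (Plus (V x_n) (N 1)) (Set a_used (V x_a) (N 0)))
     (Sq (Assign x_j0 (V x_n)) (Sq (tree_loop n) (augment n))))"

text \<open>The constant row potential \<open>x_lb\<close> with column potential 0 is a feasible
  start as soon as \<open>x_lb\<close> is below all entries.\<close>

definition hungarian_program :: "nat \<Rightarrow> cm" where
  "hungarian_program n =
     Sq (For n x_i (V x_n) (Set a_u (V x_i) (V x_lb)))
     (Sq (For n x_j (V x_n) (Sq (Set a_v (V x_j) (N 0)) (Set a_p (V x_j) (N (-1)))))
       (For n x_s (V x_n) (stage n)))"

lemma mods_scan_cell: "mods scan_cell = {x_cur, x_delta, x_found, x_j1, x_jw}"
  by (auto simp: scan_cell_def)

lemma mods_scan_row: "mods (scan_row n) = {x_j, x_cur, x_delta, x_found, x_j1, x_jw}"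
  by (auto simp: scan_row_def mods_For mods_scan_cell)

lemma mods_update_cell: "mods update_cell = {a_u, a_v}"
  by (auto simp: update_cell_def)

lemma mods_tree_scan: "mods (tree_scan n) = {x_a, x_j, x_cur, x_delta, x_found, x_j1, x_jw}"
  by (auto simp: tree_scan_def mods_For mods_scan_row)

lemma mods_tree_update: "mods (tree_update n) = {x_a, a_u, a_v}"
  by (auto simp: tree_update_def mods_For mods_update_cell)

lemma mods_tree_loop: "mods (tree_loop n) =
    {a_used, x_a, x_j, x_cur, x_delta, x_found, x_j1, x_jw, a_way, a_u, a_v, x_j0}"
  by (auto simp: tree_loop_def tree_body_def mods_tree_scan mods_tree_update)

lemma mods_augment: "mods (augment n) = {x_j1, a_p, x_j0}"
  by (auto simp: augment_def augment_body_def)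

lemma mods_stage: "mods (stage n) = {a_p, a_used, x_a, x_j, x_cur, x_delta, x_found, x_j1, x_jw, a_way, a_u, a_v, x_j0}"
  by (auto simp: stage_def mods_For mods_tree_loop mods_augment)

lemma mods_hungarian_program: "mods (hungarian_program n) =
   {x_i, x_s, a_p, a_used, x_a, x_j, x_cur, x_delta, x_found, x_j1, x_jw, a_way, a_u, a_v, x_j0}"
  by (auto simp: hungarian_program_def mods_For mods_stage)

section \<open>Verification of the Hungarian program\<close>

text \<open>Loop invariant of the search for the least slack, with \<open>X\<close> the pairs
  visited so far.\<close>

definition best :: "(int \<Rightarrow> int \<Rightarrow> int) \<Rightarrow> (int \<times> int) set \<Rightarrow> store \<Rightarrow> bool" where
  "best slack X s \<longleftrightarrow> (s x_found 0 < 1 \<longrightarrow> X = {}) \<and> (\<not> s x_found 0 < 1 \<longrightarrow>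
     (s x_jw 0, s x_j1 0) \<in> X \<and> s x_delta 0 = slack (s x_jw 0) (s x_j1 0) \<and>
     (\<forall>(a, j)\<in>X. s x_delta 0 \<le> slack a j))"

lemma best_update:
  "f \<notin> {x_found, x_delta, x_j1, x_jw} \<Longrightarrow> best slack X (s(f := x)) = best slack X s"
  by (simp add: best_def)

lemma best_nonempty:
  "best slack X s \<Longrightarrow> X \<noteq> {} \<Longrightarrow> (s x_jw 0, s x_j1 0) \<in> X \<and>
    s x_delta 0 = slack (s x_jw 0) (s x_j1 0) \<and> (\<forall>(a, j)\<in>X. s x_delta 0 \<le> slack a j)"
  unfolding best_def by blast

lemma scan_cell:
  assumes I: "best slack X s" and p: "0 \<le> s a_p (s x_a 0)" and j: "0 \<le> s x_j 0" and a: "0 \<le> s x_a 0"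
    and n: "s x_n 0 = int n" "int_size (int n) \<le> g"
    and slack: "slack (s x_a 0) (s x_j 0) =
      s a_C (s a_p (s x_a 0) * int n + s x_j 0) - s a_u (s a_p (s x_a 0)) - s a_v (s x_j 0)"
    and X': "X' = (if 0 < s a_used (s x_j 0) then X else insert (s x_a 0, s x_j 0) X)"
  shows "wp g scan_cell (best slack X') s"
proof (cases "0 < s a_used (s x_j 0)")
  case True
  then show ?thesis using I X' j by (simp add: scan_cell_def)
next
  case False
  have le: "\<forall>(a, j)\<in>X. slack (s x_a 0) (s x_j 0) \<le> slack a j" 
    if "\<not> s x_found 0 < 1" "slack (s x_a 0) (s x_j 0) < s x_delta 0"
    using I that unfolding best_def by (auto dest: order_trans[OF less_imp_le])
  show ?thesis
    using I p j a n False le unfolding X' scan_cell_def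
    by (auto simp: best_def simp flip: slack)
qed

lemma tree_scan:
  assumes n: "s x_n 0 = int n" "int_size (int n) \<le> g" and found: "s x_found 0 = 0"
    and p: "\<And>a. 0 \<le> a \<Longrightarrow> a \<le> int n \<Longrightarrow> 0 < s a_used a \<Longrightarrow> 0 \<le> s a_p a"
    and slack: "\<And>a j. slack a j = s a_C (s a_p a * int n + j) - s a_u (s a_p a) - s a_v j"
  shows "wp g (tree_scan n) (best slack
    {(a, j). 0 \<le> a \<and> a \<le> int n \<and> 0 < s a_used a \<and> 0 \<le> j \<and> j < int n \<and> \<not> 0 < s a_used j}) s"
proof -
  \<comment> \<open>\<open>X i\<close> collects the pairs whose tree column is below
    \<open>i\<close>; \<open>Y i m\<close> describes the middle of a row, where the targets below
    \<open>m\<close> of column \<open>i\<close> have been added.\<close>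
  define X where "X i = {(a, j). 0 \<le> a \<and> a < int i \<and> 0 < s a_used a \<and> 0 \<le> j \<and> j < int n \<and> \<not> 0 < s a_used j}" for i
  define Y where "Y i m = X i \<union> {(a, j). a = int i \<and> 0 \<le> j \<and> j < int m \<and> \<not> 0 < s a_used j}" for i m
  have int_Suc: "a < int (Suc i) \<longleftrightarrow> a < int i \<or> a = int i" for a i by auto
  have X0: "X 0 = {}" unfolding X_def by auto
  have X_unused: "X (Suc i) = X i" if "\<not> 0 < s a_used (int i)" for i
    using that unfolding X_def int_Suc by auto
  have X_used: "X (Suc i) = Y i n" if "0 < s a_used (int i)" for i
    using that unfolding X_def Y_def int_Suc by auto
  have Y0: "Y i 0 = X i" for i unfolding Y_def by auto
  have Y_Suc: "Y i (Suc m) = (if 0 < s a_used (int m) then Y i m else insert (int i, int m) (Y i m))" for i m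
    unfolding Y_def int_Suc by auto
  have "wp g (tree_scan n) (best slack (X (Suc n))) s"
    unfolding tree_scan_def
  proof (rule wp_For[where I = "\<lambda>i. best slack (X i)"])
    show "best slack (X 0) s" using found by (auto simp: best_def X0)
  next
    fix i s' x assume "best slack (X i) s'"
    then show "best slack (X i) (s'(x_a := x))" by (simp add: best_update)
  next
    fix s' assume "agree (insert x_a (mods (scan_row n))) s s'"
    then have "s' x_n = s x_n" by (rule agreeD) (simp add: mods_scan_row)
    then show "ok g s' (Plus (V x_n) (N 1)) \<and> ev s' (Plus (V x_n) (N 1)) = int (Suc n)" using n by simp
  next
    fix i s'
    assume i: "i < Suc n" and I: "best slack (X i) s'" and a: "s' x_a 0 = int i"
      and ag: "agree (insert x_a (mods (scan_row n))) s s'"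
    have eq: "s' x_n = s x_n" "s' a_used = s a_used" "s' a_p = s a_p" "s' a_u = s a_u" "s' a_v = s a_v" "s' a_C = s a_C"
      by (rule agreeD[OF ag]; simp add: mods_scan_row)+
    show "wp g (scan_row n) (best slack (X (Suc i))) s'"
    proof (cases "0 < s a_used (int i)")
      case False
      then show ?thesis using I a by (simp add: scan_row_def eq X_unused)
    next
      case True
      have "wp g (For n x_j (V x_n) scan_cell) (best slack (Y i n)) s'"
      proof (rule wp_For[where I = "\<lambda>m. best slack (Y i m)"])
        show "best slack (Y i 0) s'" using I by (simp add: Y0)
      next
        fix m s' x assume "best slack (Y i m) s'"
        then show "best slack (Y i m) (s'(x_j := x))" by (simp add: best_update)
      next
        fix s'' assume "agree (insert x_j (mods scan_cell)) s' s''"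
        then have "s'' x_n = s' x_n" by (rule agreeD) (simp add: mods_scan_cell)
        then show "ok g s'' (V x_n) \<and> ev s'' (V x_n) = int n" using n eq by simp
      next
        fix m s'' assume m: "m < n" and J: "best slack (Y i m) s''" and j: "s'' x_j 0 = int m"
          and ag': "agree (insert x_j (mods scan_cell)) s' s''"
        have eq': "s'' x_n = s x_n" "s'' a_used = s a_used" "s'' a_p = s a_p" "s'' a_u = s a_u" "s'' a_v = s a_v"
            "s'' a_C = s a_C" "s'' x_a = s' x_a"
          unfolding eq[symmetric] by (rule agreeD[OF ag']; simp add: mods_scan_cell)+
        show "wp g scan_cell (best slack (Y i (Suc m))) s''"
          by (rule scan_cell[OF J]) (use a j n slack p[of "int i"] True i in \<open>simp_all add: eq' Y_Suc\<close>)
      qed (simp_all add: mods_scan_cell)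
      then show ?thesis using True a by (simp add: scan_row_def eq X_used)
    qed
  qed (simp_all add: mods_scan_row)
  moreover have "X (Suc n) = {(a, j). 0 \<le> a \<and> a \<le> int n \<and> 0 < s a_used a \<and> 0 \<le> j \<and> j < int n \<and> \<not> 0 < s a_used j}"
    unfolding X_def by auto
  ultimately show ?thesis by simp
qed

text \<open>Row potentials are reached through \<open>a_p\<close>; injectivity on the tree ensures
  that no row is raised twice.\<close>

lemma tree_update:
  assumes n: "s x_n 0 = int n"
    and p: "\<And>a. 0 \<le> a \<Longrightarrow> a \<le> int n \<Longrightarrow> 0 < s a_used a \<Longrightarrow> 0 \<le> s a_p a"
    and inj: "inj_on (s a_p) {a. 0 \<le> a \<and> a \<le> int n \<and> 0 < s a_used a}"
  shows "wp g (tree_update n) (\<lambda>s'.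
    (\<forall>i. s' a_u i = (if i \<in> s a_p ` {a. 0 \<le> a \<and> a \<le> int n \<and> 0 < s a_used a} then s a_u i + s x_delta 0 else s a_u i)) \<and>
    (\<forall>j. s' a_v j = (if j \<in> {a. 0 \<le> a \<and> a \<le> int n \<and> 0 < s a_used a} then s a_v j - s x_delta 0 else s a_v j))) s"
proof -
  define U where "U m = {a. 0 \<le> a \<and> a < int m \<and> 0 < s a_used a}" for m
  define I where "I m s' \<longleftrightarrow>
    (\<forall>i. s' a_u i = (if i \<in> s a_p ` U m then s a_u i + s x_delta 0 else s a_u i)) \<and>
    (\<forall>j. s' a_v j = (if j \<in> U m then s a_v j - s x_delta 0 else s a_v j))" for m and s' :: store
  have int_Suc: "a < int (Suc i) \<longleftrightarrow> a < int i \<or> a = int i" for a i by auto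
  have U_Suc: "U (Suc m) = (if 0 < s a_used (int m) then insert (int m) (U m) else U m)" for m
    unfolding U_def int_Suc by auto
  have Un: "U (Suc n) = {a. 0 \<le> a \<and> a \<le> int n \<and> 0 < s a_used a}" unfolding U_def by auto
  have "wp g (tree_update n) (I (Suc n)) s"
    unfolding tree_update_def
  proof (rule wp_For[where I = I])
    show "I 0 s" by (auto simp: I_def U_def)
  next
    fix i s' x assume "I i s'"
    then show "I i (s'(x_a := x))" by (simp add: I_def)
  next
    fix s' assume "agree (insert x_a (mods update_cell)) s s'"
    then have "s' x_n = s x_n" by (rule agreeD) (simp add: mods_update_cell)
    then show "ok g s' (Plus (V x_n) (N 1)) \<and> ev s' (Plus (V x_n) (N 1)) = int (Suc n)" using n by simp
  next
    fix m s'
    assume m: "m < Suc n" and I: "I m s'" and a: "s' x_a 0 = int m"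
      and ag: "agree (insert x_a (mods update_cell)) s s'"
    have eq: "s' a_used = s a_used" "s' a_p = s a_p" "s' x_delta = s x_delta"
      by (rule agreeD[OF ag]; simp add: mods_update_cell)+
    show "wp g update_cell (I (Suc m)) s'"
    proof (cases "0 < s a_used (int m)")
      case False
      then have "I (Suc m) s'" using I unfolding I_def U_Suc by simp
      then show ?thesis using False a by (simp add: update_cell_def eq)
    next
      case True
      have "s a_p (int m) \<notin> s a_p ` U m"
      proof
        assume "s a_p (int m) \<in> s a_p ` U m"
        then obtain a where "a \<in> U m" "s a_p (int m) = s a_p a" by blast
        then have "int m = a" using m True inj_onD[OF inj, of "int m" a] by (simp add: U_def)
        then show False using \<open>a \<in> U m\<close> unfolding U_def by simp
      qed
      moreover have "int m \<notin> U m" unfolding U_def by simp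
      moreover have "0 \<le> s a_p (int m)" using p[of "int m"] m True by simp
      moreover have "I (Suc m) (s'(a_u := (s' a_u)(s a_p (int m) := s' a_u (s a_p (int m)) + s x_delta 0),
          a_v := (s' a_v)(int m := s' a_v (int m) - s x_delta 0)))"
        using I True calculation(1,2) unfolding I_def U_Suc by auto
      ultimately show ?thesis using a True by (simp add: update_cell_def eq)
    qed
  qed (simp_all add: mods_update_cell)
  then show ?thesis unfolding I_def Un .
qed

locale hungarian =
  fixes n :: nat and C :: "int \<Rightarrow> int \<Rightarrow> int" and g :: nat
  assumes g: "int_size (int n) \<le> g"
begin

sublocale assignment "{0..<int n}" "{0..<int n}" "int n" "-1" C
  by unfold_locales auto

abbreviation cols :: "int set" where "cols \<equiv> insert (int n) {0..<int n}"

definition loaded :: "store \<Rightarrow> bool" where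
  "loaded s \<longleftrightarrow> s x_n 0 = int n \<and> (\<forall>i\<in>{0..<int n}. \<forall>j\<in>{0..<int n}. s a_C (i * int n + j) = C i j)"

lemma loaded_cong: "s' x_n = s x_n \<Longrightarrow> s' a_C = s a_C \<Longrightarrow> loaded s' = loaded s"
  by (simp add: loaded_def)

definition used :: "store \<Rightarrow> int set" where
  "used s = {a. 0 \<le> a \<and> a \<le> int n \<and> 0 < s a_used a}"

text \<open>The tree consists of the used columns and the column \<open>x_j0\<close> reached last,
  which is marked only in the next round. The last conjunct counts the rounds that are left.\<close>

definition tree_inv :: "int set \<Rightarrow> nat \<Rightarrow> store \<Rightarrow> bool" where
  "tree_inv Q m s \<longleftrightarrow> loaded s \<and> s x_j0 0 \<in> cols - used s \<and>
     grown Q (insert (s x_j0 0) (used s)) (s a_way) (s a_p) (s a_u) (s a_v) \<and>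
     (\<forall>j\<in>used s. s a_p j \<noteq> -1) \<and> m + card (used s) = Suc n"

lemma tree_loop:
  assumes "tree_inv Q (Suc n) s"
  shows "wp g (tree_loop n) (\<lambda>s'. loaded s' \<and> (\<exists>depth. hole Q (s' x_j0 0) (s' a_way) (s' a_p) (s' a_u) (s' a_v) depth) \<and>
    s' x_j0 0 \<in> cols) s"
  unfolding tree_loop_def
proof (rule wp_Wh[where I = "tree_inv Q"])
  show "tree_inv Q (Suc n) s" by (rule assms)
next
  fix m s' assume "tree_inv Q m s'"
  then show "okb g s' (Lt (N (- 1)) (Get a_p (V x_j0)))" by (auto simp: tree_inv_def)
next
  fix m s' assume I: "tree_inv Q m s'" and "\<not> evb s' (Lt (N (- 1)) (Get a_p (V x_j0)))"
  then have "\<not> -1 < s' a_p (s' x_j0 0)" by simp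
  moreover have gr: "grown Q (insert (s' x_j0 0) (used s')) (s' a_way) (s' a_p) (s' a_u) (s' a_v)" and
     j0: "s' x_j0 0 \<in> cols" using I unfolding tree_inv_def by auto
  then have "s' a_p (s' x_j0 0) \<in> Q \<or> s' a_p (s' x_j0 0) = -1" "Q \<subseteq> {0..<int n}"
    unfolding grown_def covers_def by blast+
  ultimately have "s' a_p (s' x_j0 0) = -1" by auto
  then show "loaded s' \<and> (\<exists>depth. hole Q (s' x_j0 0) (s' a_way) (s' a_p) (s' a_u) (s' a_v) depth) \<and> s' x_j0 0 \<in> cols"
    using I hole_start[OF gr] j0 unfolding tree_inv_def by blast
next
  fix m s' assume I: "tree_inv Q m s'" and "evb s' (Lt (N (- 1)) (Get a_p (V x_j0)))"
  then have pj0: "-1 < s' a_p (s' x_j0 0)" by simp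
  define j0 where "j0 = s' x_j0 0"
  define U where "U = insert j0 (used s')"
  note I' = I[unfolded tree_inv_def, folded j0_def U_def]
  have ld: "loaded s'" and gr: "grown Q U (s' a_way) (s' a_p) (s' a_u) (s' a_v)"
    and card: "m + card (used s') = Suc n" and j0': "j0 \<in> cols - used s'"
    and p\<nu>': "\<forall>j\<in>used s'. s' a_p j \<noteq> -1"
    by (fact I'[THEN conjunct1] I'[THEN conjunct2, THEN conjunct1]
      I'[THEN conjunct2, THEN conjunct2, THEN conjunct1]
      I'[THEN conjunct2, THEN conjunct2, THEN conjunct2, THEN conjunct1]
      I'[THEN conjunct2, THEN conjunct2, THEN conjunct2, THEN conjunct2])+
  have j0: "j0 \<in> cols" "j0 \<notin> used s'" using j0' by blast+
  have p\<nu>: "\<forall>j\<in>U. s' a_p j \<noteq> -1" using p\<nu>' pj0 unfolding U_def j0_def by simp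
  have cov: "covers Q cols (s' a_p)" and Q: "Q \<subseteq> {0..<int n}" and Ucols: "U \<subseteq> cols" and rU: "int n \<in> U"
    using gr unfolding grown_def by simp_all
  have pQ: "s' a_p j \<in> {0..<int n}" if "j \<in> U" for j
  proof -
    have "j \<in> cols" "s' a_p j \<noteq> -1" using that Ucols p\<nu> by blast+
    then have "s' a_p j \<in> Q" using cov unfolding covers_def by blast
    then show ?thesis using Q by blast
  qed
  have finU: "finite (used s')" by (rule finite_subset[of _ "{0..int n}"]) (auto simp: used_def)
  have cardU: "card U = Suc (card (used s'))" unfolding U_def using finU j0 by simp
  \<comment> \<open>The tree cannot have more than \<open>n + 1\<close> columns, so the round about
    to start is still within the ghost bound.\<close>
  have "card U \<le> card cols" by (rule card_mono) (use Ucols in auto)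
  then have "card U \<le> Suc n" by simp
  then obtain m' where m': "m = Suc m'" using card cardU by (cases m) auto
  have "0 \<le> j0" using j0(1) by auto
  define s0 where "s0 = s'(a_used := (s' a_used)(j0 := 1), x_found := (s' x_found)(0 := 0))"
  have U0: "{a. 0 \<le> a \<and> a \<le> int n \<and> 0 < s0 a_used a} = U"
    using j0 unfolding s0_def U_def used_def by auto
  have s0: "s0 x_n 0 = int n" "s0 x_found 0 = 0" "s0 a_p = s' a_p" "s0 a_u = s' a_u" "s0 a_v = s' a_v"
     "s0 a_way = s' a_way" "s0 a_C = s' a_C" "s0 x_n = s' x_n"
    using ld unfolding s0_def loaded_def by simp_all
  let ?slack = "\<lambda>a j. s0 a_C (s0 a_p a * int n + j) - s0 a_u (s0 a_p a) - s0 a_v j"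
  let ?X = "{(a, j). 0 \<le> a \<and> a \<le> int n \<and> 0 < s0 a_used a \<and> 0 \<le> j \<and> j < int n \<and> \<not> 0 < s0 a_used j}"
  have X: "(a, j) \<in> ?X \<longleftrightarrow> a \<in> U \<and> j \<in> {0..<int n} - U" for a j unfolding U0[symmetric] by auto
  have slack_eq: "?slack a j = C (s' a_p a) j - s' a_u (s' a_p a) - s' a_v j" if "a \<in> U" "j \<in> {0..<int n}" for a j
    using ld pQ[OF that(1)] that(2) unfolding loaded_def s0 by simp
  have "wp g (tree_scan n) (best ?slack ?X) s0"
  proof (rule tree_scan[where s = s0 and n = n and g = g and slack = ?slack])
    fix a assume "0 \<le> a" "a \<le> int n" "0 < s0 a_used a"
    then have "a \<in> U" unfolding U0[symmetric] by simp
    then show "0 \<le> s0 a_p a" using pQ[of a] s0 by simp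
  qed (rule s0(1) g s0(2) refl)+
  then have "wp g (tree_scan n) (wp g (Set a_way (V x_j1) (V x_jw)) (wp g (tree_update n)
      (wp g (Assign x_j0 (V x_j1)) (tree_inv Q m')))) s0"
  proof (rule wp_conseq)
    fix s1 assume best: "best ?slack ?X s1" and "agree (mods (tree_scan n)) s0 s1"
    then have ag: "agree {x_a, x_j, x_cur, x_delta, x_found, x_j1, x_jw} s0 s1" by (simp add: mods_tree_scan)
    have s1: "s1 a_p = s' a_p" "s1 a_u = s' a_u" "s1 a_v = s' a_v" "s1 a_way = s' a_way" "s1 a_C = s' a_C"
        "s1 x_n = s' x_n" "s1 a_used = s0 a_used"
      unfolding s0(3-8)[symmetric] by (rule agreeD[OF ag]; simp)+
    define j1 where "j1 = s1 x_j1 0"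
    define jw where "jw = s1 x_jw 0"
    define \<delta> where "\<delta> = s1 x_delta 0"
    \<comment> \<open>Some column is still outside the tree, so the scan has met a candidate and its
      result is meaningful.\<close>
    obtain j where "j \<in> {0..<int n} - U" using unused_exists[OF gr p\<nu>] by blast
    then have "?X \<noteq> {}" using X rU by blast
    from best_nonempty[OF best this]
    have "(jw, j1) \<in> ?X \<and> \<delta> = ?slack jw j1 \<and> (\<forall>(a, j)\<in>?X. \<delta> \<le> ?slack a j)"
      unfolding j1_def jw_def \<delta>_def .
    note b = this[THEN conjunct1] this[THEN conjunct2, THEN conjunct1] this[THEN conjunct2, THEN conjunct2]
    from b(1) have jw: "jw \<in> U" and j1: "j1 \<in> {0..<int n}" "j1 \<notin> U" using X by simp_all
    have \<delta>: "\<delta> = C (s' a_p jw) j1 - s' a_u (s' a_p jw) - s' a_v j1" using b(2) slack_eq[OF jw j1(1)] by simp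
    have min: "\<delta> \<le> C (s' a_p a) j - s' a_u (s' a_p a) - s' a_v j" if "a \<in> U" "j \<in> {0..<int n} - U" for a j
    proof -
      have "(a, j) \<in> ?X" using X that by simp
      then have "\<delta> \<le> ?slack a j" using b(3) by blast
      then show ?thesis using slack_eq[OF that(1)] that(2) by simp
    qed
    define s2 where "s2 = s1(a_way := (s1 a_way)(j1 := jw))"
    have s2: "s2 a_p = s' a_p" "s2 a_u = s' a_u" "s2 a_v = s' a_v" "s2 a_way = (s' a_way)(j1 := jw)" "s2 a_C = s' a_C"
        "s2 x_n = s' x_n" "s2 a_used = s0 a_used" "s2 x_delta 0 = \<delta>" "s2 x_j1 0 = j1"
      unfolding s2_def \<delta>_def j1_def using s1 by simp_all
    have U2: "{a. 0 \<le> a \<and> a \<le> int n \<and> 0 < s2 a_used a} = U" unfolding s2(7) by (rule U0)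
    have "wp g (tree_update n) (\<lambda>s3. (\<forall>i. s3 a_u i = (if i \<in> s2 a_p ` U then s2 a_u i + s2 x_delta 0 else s2 a_u i)) \<and>
        (\<forall>j. s3 a_v j = (if j \<in> U then s2 a_v j - s2 x_delta 0 else s2 a_v j))) s2"
    proof (rule tree_update[where s = s2 and n = n and g = g, unfolded U2])
      show "s2 x_n 0 = int n" using ld s2 unfolding loaded_def by simp
    next
      fix a assume "0 \<le> a" "a \<le> int n" "0 < s2 a_used a"
      then have "a \<in> U" unfolding U2[symmetric] by simp
      then show "0 \<le> s2 a_p a" using pQ[of a] s2 by simp
    next
      show "inj_on (s2 a_p) U"
      proof (rule inj_onI)
        fix x y assume "x \<in> U" "y \<in> U" "s2 a_p x = s2 a_p y"
        moreover from this have "x \<in> cols" "y \<in> cols" "s' a_p x \<noteq> -1" using p\<nu> Ucols by blast+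
          ultimately show "x = y" using covers_inj[OF cov, of x y] s2(1) by simp
      qed
    qed
    then have "wp g (tree_update n) (wp g (Assign x_j0 (V x_j1)) (tree_inv Q m')) s2"
    proof (rule wp_conseq)
      fix s3 assume uv: "(\<forall>i. s3 a_u i = (if i \<in> s2 a_p ` U then s2 a_u i + s2 x_delta 0 else s2 a_u i)) \<and>
        (\<forall>j. s3 a_v j = (if j \<in> U then s2 a_v j - s2 x_delta 0 else s2 a_v j))"
        and "agree (mods (tree_update n)) s2 s3"
      then have ag3: "agree {x_a, a_u, a_v} s2 s3" by (simp add: mods_tree_update)
      have s3: "s3 a_p = s' a_p" "s3 a_way = (s' a_way)(j1 := jw)" "s3 a_C = s' a_C" "s3 x_n = s' x_n"
          "s3 a_used = s0 a_used" "s3 x_j1 = s2 x_j1"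
        unfolding s2(1-7)[symmetric] by (rule agreeD[OF ag3]; simp)+
      have "grown Q (insert j1 U) ((s' a_way)(j1 := jw)) (s' a_p) (s3 a_u) (s3 a_v)"
        by (rule tree_step[OF gr p\<nu> jw j1 \<delta> min]) (use uv s2 in auto)
      then have gr3: "grown Q (insert j1 U) (s3 a_way) (s3 a_p) (s3 a_u) (s3 a_v)" unfolding s3 .
      let ?s4 = "s3(x_j0 := (s3 x_j0)(0 := s3 x_j1 0))"
      have used4: "used ?s4 = U" unfolding used_def using U0 s3(5) by simp
      have "loaded ?s4" using ld s3 by (simp add: loaded_def)
      moreover have "s3 x_j1 0 = j1" using s3 s2 by simp
      ultimately have "tree_inv Q m' ?s4"
        unfolding tree_inv_def used4 using gr3 j1 p\<nu> s3(1) card cardU m' by simp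
      then show "wp g (Assign x_j0 (V x_j1)) (tree_inv Q m') s3" by simp
    qed
    then show "wp g (Set a_way (V x_j1) (V x_jw)) (wp g (tree_update n) (wp g (Assign x_j0 (V x_j1)) (tree_inv Q m'))) s1"
      using j1 unfolding s2_def j1_def jw_def by simp
  qed
  then have "wp g (tree_body n) (tree_inv Q m') s'"
    using \<open>0 \<le> j0\<close> unfolding tree_body_def s0_def j0_def wp_Sq by simp
  with m' show "\<exists>m'. m = Suc m' \<and> wp g (tree_body n) (tree_inv Q m') s'"
    by blast
qed

text \<open>Depths come without an upper bound, so progress is measured by the number of columns of
  smaller depth than the hole.\<close>

lemma augment:
  assumes "loaded s" "s x_j0 0 \<in> cols" "hole Q (s x_j0 0) (s a_way) (s a_p) (s a_u) (s a_v) depth"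
  shows "wp g (augment n) (\<lambda>s'. feasible (s' a_u) (s' a_v) \<and> covers Q {0..<int n} (s' a_p) \<and>
    tight {0..<int n} (s' a_p) (s' a_u) (s' a_v)) s"
  unfolding augment_def
proof (rule wp_Wh[where I = "\<lambda>m s'. s' x_j0 0 \<in> cols \<and>
    hole Q (s' x_j0 0) (s' a_way) (s' a_p) (s' a_u) (s' a_v) depth \<and>
    card {j\<in>cols. depth j < depth (s' x_j0 0)} \<le> m"])
  have "card {j\<in>cols. depth j < depth (s x_j0 0)} \<le> card cols" by (rule card_mono) auto
  then show "s x_j0 0 \<in> cols \<and> hole Q (s x_j0 0) (s a_way) (s a_p) (s a_u) (s a_v) depth \<and>
      card {j\<in>cols. depth j < depth (s x_j0 0)} \<le> Suc n" using assms by simp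
next
  fix m s' assume I: "s' x_j0 0 \<in> cols \<and> hole Q (s' x_j0 0) (s' a_way) (s' a_p) (s' a_u) (s' a_v) depth \<and>
    card {j\<in>cols. depth j < depth (s' x_j0 0)} \<le> m"
    and ag: "agree (mods augment_body) s s'"
  have xn: "s' x_n = s x_n" by (rule agreeD[OF ag]) (simp add: augment_body_def)
  then have n: "s' x_n 0 = int n" using assms(1) by (simp add: loaded_def)
  show "okb g s' (Lt (V x_j0) (V x_n))" by simp
  show "feasible (s' a_u) (s' a_v) \<and> covers Q {0..<int n} (s' a_p) \<and> tight {0..<int n} (s' a_p) (s' a_u) (s' a_v)"
    if "\<not> evb s' (Lt (V x_j0) (V x_n))"
  proof -
    have "s' x_j0 0 = int n" using that I n by auto
    then have "hole Q (int n) (s' a_way) (s' a_p) (s' a_u) (s' a_v) depth" using I by simp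
    then show ?thesis by (rule hole_root)
  qed
  show "\<exists>m'. m = Suc m' \<and> wp g augment_body (\<lambda>s'. s' x_j0 0 \<in> cols \<and>
    hole Q (s' x_j0 0) (s' a_way) (s' a_p) (s' a_u) (s' a_v) depth \<and>
    card {j\<in>cols. depth j < depth (s' x_j0 0)} \<le> m') s'" if "evb s' (Lt (V x_j0) (V x_n))"
  proof -
    define h where "h = s' x_j0 0"
    define w where "w = s' a_way h"
    have h: "h \<in> cols" "h \<noteq> int n" using I that n unfolding h_def by auto
    have hole: "hole Q h (s' a_way) (s' a_p) (s' a_u) (s' a_v) depth" using I unfolding h_def by blast
    note st = hole_step[OF hole h(2), folded w_def]
    have sub: "insert w {j\<in>cols. depth j < depth w} \<subseteq> {j\<in>cols. depth j < depth h}" using st by auto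
    have "Suc (card {j\<in>cols. depth j < depth w}) = card (insert w {j\<in>cols. depth j < depth w})" by simp
    also have "\<dots> \<le> card {j\<in>cols. depth j < depth h}" by (rule card_mono[OF _ sub]) simp
    also have "\<dots> \<le> m" using I unfolding h_def by blast
    finally have m: "Suc (card {j\<in>cols. depth j < depth w}) \<le> m" .
    then obtain m' where m': "m = Suc m'" by (cases m) auto
    have "0 \<le> w" "0 \<le> h" using st(1) h by auto
    then have "wp g augment_body (\<lambda>s'. s' x_j0 0 \<in> cols \<and>
      hole Q (s' x_j0 0) (s' a_way) (s' a_p) (s' a_u) (s' a_v) depth \<and>
      card {j\<in>cols. depth j < depth (s' x_j0 0)} \<le> m') s'"
      using st m m' by (simp add: augment_body_def h_def[symmetric] w_def[symmetric])
    then show ?thesis using m' by blast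
  qed
qed

lemma stage:
  assumes ld: "loaded s" and fe: "feasible (s a_u) (s a_v)" and cov: "covers {0..<int i} {0..<int n} (s a_p)"
    and ti: "tight {0..<int n} (s a_p) (s a_u) (s a_v)" and i: "i < n" "s x_s 0 = int i"
  shows "wp g (stage n) (\<lambda>s'. feasible (s' a_u) (s' a_v) \<and> covers {0..<int (Suc i)} {0..<int n} (s' a_p) \<and>
    tight {0..<int n} (s' a_p) (s' a_u) (s' a_v)) s"
proof -
  have Q: "{0..<int (Suc i)} = insert (int i) {0..<int i}" by auto
  have xn: "s x_n 0 = int n" using ld by (simp add: loaded_def)
  define s1 where "s1 = s(a_p := (s a_p)(int n := int i))"
  have "wp g (For (Suc n) x_a (Plus (V x_n) (N 1)) (Set a_used (V x_a) (N 0)))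
     (\<lambda>s'. \<forall>a. 0 \<le> a \<and> a < int (Suc n) \<longrightarrow> s' a_used a = 0) s1"
  proof (rule wp_For[where I = "\<lambda>m s'. \<forall>a. 0 \<le> a \<and> a < int m \<longrightarrow> s' a_used a = 0"])
    fix s' assume "agree (insert x_a (mods (Set a_used (V x_a) (N 0)))) s1 s'"
    then have "s' x_n = s1 x_n" by (rule agreeD) simp
    then show "ok g s' (Plus (V x_n) (N 1)) \<and> ev s' (Plus (V x_n) (N 1)) = int (Suc n)"
      using xn unfolding s1_def by simp
  qed auto
  then have "wp g (For (Suc n) x_a (Plus (V x_n) (N 1)) (Set a_used (V x_a) (N 0)))
     (wp g (Assign x_j0 (V x_n)) (wp g (tree_loop n) (wp g (augment n)
     (\<lambda>s'. feasible (s' a_u) (s' a_v) \<and> covers {0..<int (Suc i)} {0..<int n} (s' a_p) \<and>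
    tight {0..<int n} (s' a_p) (s' a_u) (s' a_v))))) s1"
  proof (rule wp_conseq)
    fix s2 assume u: "\<forall>a. 0 \<le> a \<and> a < int (Suc n) \<longrightarrow> s2 a_used a = 0"
      and "agree (mods (For (Suc n) x_a (Plus (V x_n) (N 1)) (Set a_used (V x_a) (N 0)))) s1 s2"
    then have ag: "agree {x_a, a_used} s1 s2" by (simp add: mods_For insert_commute)
    have s2: "s2 x_n = s1 x_n" "s2 a_C = s1 a_C" "s2 a_p = s1 a_p" "s2 a_u = s1 a_u" "s2 a_v = s1 a_v"
      by (rule agreeD[OF ag]; simp)+
    define s3 where "s3 = s2(x_j0 := (s2 x_j0)(0 := int n))"
    have s3: "s3 x_n = s x_n" "s3 a_C = s a_C" "s3 a_p = (s a_p)(int n := int i)" "s3 a_u = s a_u" "s3 a_v = s a_v"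
        "s3 x_j0 0 = int n"
      using s2 unfolding s3_def s1_def by simp_all
    have used3: "used s3 = {}" using u unfolding used_def s3_def by fastforce
    have ld3: "loaded s3" using ld s3 by (simp add: loaded_def)
    have "grown {0..<int (Suc i)} {int n} (s3 a_way) (s3 a_p) (s3 a_u) (s3 a_v)"
      unfolding s3 Q by (rule stage_start[OF fe cov ti]) (use i in auto)
    then have "tree_inv {0..<int (Suc i)} (Suc n) s3"
      unfolding tree_inv_def used3 using ld3 s3 by simp
    from tree_loop[OF this] have "wp g (tree_loop n) (wp g (augment n) (\<lambda>s'. feasible (s' a_u) (s' a_v) \<and>
       covers {0..<int (Suc i)} {0..<int n} (s' a_p) \<and> tight {0..<int n} (s' a_p) (s' a_u) (s' a_v))) s3"
      by (rule wp_mono) (use augment in blast)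
    then show "wp g (Assign x_j0 (V x_n)) (wp g (tree_loop n) (wp g (augment n)
     (\<lambda>s'. feasible (s' a_u) (s' a_v) \<and> covers {0..<int (Suc i)} {0..<int n} (s' a_p) \<and>
      tight {0..<int n} (s' a_p) (s' a_u) (s' a_v)))) s2"
      using xn s2 unfolding s3_def s1_def by simp
  qed
  then show ?thesis unfolding stage_def s1_def wp_Sq using xn i by simp
qed

theorem hungarian_program:
  assumes ld: "loaded s" and lb: "\<And>i j. i \<in> {0..<int n} \<Longrightarrow> j \<in> {0..<int n} \<Longrightarrow> s x_lb 0 \<le> C i j"
  shows "wp g (hungarian_program n) (\<lambda>s'. \<exists>u v. dual_optimal (s' a_p) u v) s"
proof -
  have xn: "s x_n 0 = int n" using ld by (simp add: loaded_def)
  let ?Q = "\<lambda>s'. \<exists>u v. dual_optimal (s' a_p) u v"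
  have "wp g (For n x_i (V x_n) (Set a_u (V x_i) (V x_lb))) (\<lambda>s'. \<forall>i. 0 \<le> i \<and> i < int n \<longrightarrow> s' a_u i = s x_lb 0) s"
  proof (rule wp_For[where I = "\<lambda>m s'. \<forall>i. 0 \<le> i \<and> i < int m \<longrightarrow> s' a_u i = s x_lb 0"])
    fix s' assume ag: "agree (insert x_i (mods (Set a_u (V x_i) (V x_lb)))) s s'"
    have "s' x_n = s x_n" by (rule agreeD[OF ag]) simp
    then show "ok g s' (V x_n) \<and> ev s' (V x_n) = int n" using xn by simp
  next
    fix i s' assume "\<forall>j. 0 \<le> j \<and> j < int i \<longrightarrow> s' a_u j = s x_lb 0" "s' x_i 0 = int i"
      and ag: "agree (insert x_i (mods (Set a_u (V x_i) (V x_lb)))) s s'"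
    moreover have "s' x_lb = s x_lb" by (rule agreeD[OF ag]) simp
    ultimately show "wp g (Set a_u (V x_i) (V x_lb)) (\<lambda>s'. \<forall>j. 0 \<le> j \<and> j < int (Suc i) \<longrightarrow> s' a_u j = s x_lb 0) s'"
      by auto
  qed auto
  then have "wp g (For n x_i (V x_n) (Set a_u (V x_i) (V x_lb)))
    (wp g (For n x_j (V x_n) (Sq (Set a_v (V x_j) (N 0)) (Set a_p (V x_j) (N (-1)))))
      (wp g (For n x_s (V x_n) (stage n)) ?Q)) s"
  proof (rule wp_conseq)
    fix s1 assume u1: "\<forall>i. 0 \<le> i \<and> i < int n \<longrightarrow> s1 a_u i = s x_lb 0"
      and "agree (mods (For n x_i (V x_n) (Set a_u (V x_i) (V x_lb)))) s s1"
    then have ag1: "agree {x_i, a_u} s s1" by (simp add: mods_For)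
    have s1: "s1 x_n = s x_n" "s1 a_C = s a_C" by (rule agreeD[OF ag1]; simp)+
    have "wp g (For n x_j (V x_n) (Sq (Set a_v (V x_j) (N 0)) (Set a_p (V x_j) (N (-1)))))
       (\<lambda>s'. \<forall>j. 0 \<le> j \<and> j < int n \<longrightarrow> s' a_v j = 0 \<and> s' a_p j = -1) s1"
    proof (rule wp_For[where I = "\<lambda>m s'. \<forall>j. 0 \<le> j \<and> j < int m \<longrightarrow> s' a_v j = 0 \<and> s' a_p j = -1"])
      fix s' assume ag: "agree (insert x_j (mods (Sq (Set a_v (V x_j) (N 0)) (Set a_p (V x_j) (N (-1)))))) s1 s'"
      have "s' x_n = s1 x_n" by (rule agreeD[OF ag]) simp
      then show "ok g s' (V x_n) \<and> ev s' (V x_n) = int n" using xn s1 by simp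
    qed auto
    then show "wp g (For n x_j (V x_n) (Sq (Set a_v (V x_j) (N 0)) (Set a_p (V x_j) (N (-1)))))
      (wp g (For n x_s (V x_n) (stage n)) ?Q) s1"
    proof (rule wp_conseq)
      fix s2 assume vp: "\<forall>j. 0 \<le> j \<and> j < int n \<longrightarrow> s2 a_v j = 0 \<and> s2 a_p j = -1"
        and "agree (mods (For n x_j (V x_n) (Sq (Set a_v (V x_j) (N 0)) (Set a_p (V x_j) (N (-1)))))) s1 s2"
      then have ag2: "agree {x_j, a_v, a_p} s1 s2" by (simp add: mods_For insert_commute)
      have s2: "s2 x_n = s x_n" "s2 a_C = s a_C" "s2 a_u = s1 a_u"
        unfolding s1[symmetric] by (rule agreeD[OF ag2]; simp)+
      have ld2: "loaded s2" using ld s2 loaded_cong by blast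
      show "wp g (For n x_s (V x_n) (stage n)) ?Q s2"
      proof (rule wp_For[where I = "\<lambda>i s'. feasible (s' a_u) (s' a_v) \<and> covers {0..<int i} {0..<int n} (s' a_p) \<and>
          tight {0..<int n} (s' a_p) (s' a_u) (s' a_v)"])
        show "feasible (s2 a_u) (s2 a_v) \<and> covers {0..<int 0} {0..<int n} (s2 a_p) \<and>
          tight {0..<int n} (s2 a_p) (s2 a_u) (s2 a_v)"
          using u1 vp lb unfolding feasible_def covers_def tight_def s2 by simp
      next
        fix i s' assume I: "feasible (s' a_u) (s' a_v) \<and> covers {0..<int i} {0..<int n} (s' a_p) \<and>
          tight {0..<int n} (s' a_p) (s' a_u) (s' a_v)" and i: "i < n" "s' x_s 0 = int i"
          and ag: "agree (insert x_s (mods (stage n))) s2 s'"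
        have "s' x_n = s2 x_n" "s' a_C = s2 a_C" by (rule agreeD[OF ag]; simp add: mods_stage)+
        then have "loaded s'" using ld2 loaded_cong by blast
        then show "wp g (stage n) (\<lambda>s'. feasible (s' a_u) (s' a_v) \<and> covers {0..<int (Suc i)} {0..<int n} (s' a_p) \<and>
          tight {0..<int n} (s' a_p) (s' a_u) (s' a_v)) s'"
          by (rule stage) (use I i in auto)
      next
        fix s' assume "agree (insert x_s (mods (stage n))) s2 s'"
        then have "s' x_n = s2 x_n" by (rule agreeD) (simp add: mods_stage)
        then show "ok g s' (V x_n) \<and> ev s' (V x_n) = int n" using xn s2 by simp
      next
        fix s' assume "feasible (s' a_u) (s' a_v) \<and> covers {0..<int n} {0..<int n} (s' a_p) \<and>
          tight {0..<int n} (s' a_p) (s' a_u) (s' a_v)"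
        then show "\<exists>u v. dual_optimal (s' a_p) u v" using dual_optimalI by blast
      qed (simp_all add: mods_stage)
    qed
  qed
  then show ?thesis unfolding hungarian_program_def wp_Sq .
qed

end

section \<open>Scaling and perturbation as programs\<close>

text \<open>Multiplying each numerator by all denominators but its own amounts to scaling the whole
  input by the product of all denominators. Each factor is an input number, hence short.\<close>

definition scale_cell :: cm where
  "scale_cell = If (And (Not (Lt (V x_r) (V x_t))) (Not (Lt (V x_t) (V x_r)))) Nop
     (Set a_num (V x_t) (Times (Get a_num (V x_t)) (Get 0 (Plus (N 3) (Plus (V x_r) (V x_r))))))"

definition scale_row :: "nat \<Rightarrow> cm" where
  "scale_row m = Sq (Set a_num (V x_t) (Get 0 (Plus (N 2) (Plus (V x_t) (V x_t)))))
     (For m x_r (V x_m) scale_cell)"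

definition scale_program :: "nat \<Rightarrow> cm" where
  "scale_program n = Sq (Assign x_n (Get 0 (N 0))) (Sq (Assign x_k (Get 0 (N 1)))
     (Sq (Assign x_m (Plus (V x_n) (Plus (V x_n) (V x_n))))
       (For (3 * n) x_t (V x_m) (scale_row (3 * n)))))"

lemma mods_scale_cell: "mods scale_cell = {a_num}"
  by (auto simp: scale_cell_def)

lemma mods_scale_row: "mods (scale_row m) = {a_num, x_r}"
  by (auto simp: scale_row_def mods_For mods_scale_cell)

lemma scale_row:
  assumes m: "s x_m 0 = int m" and t: "s x_t 0 = int t" "t < m"
    and size: "\<And>r. r < m \<Longrightarrow> int_size (s 0 (3 + 2 * int r)) \<le> g"
  shows "wp g (scale_row m) (\<lambda>s'. s' a_num = (s a_num)(int t :=
    s 0 (2 + 2 * int t) * (\<Prod>r\<in>{..<m} - {t}. s 0 (3 + 2 * int r)))) s"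
proof -
  define P where "P q = s 0 (2 + 2 * int t) * (\<Prod>r\<in>{..<q} - {t}. s 0 (3 + 2 * int r))" for q
  have P0: "P 0 = s 0 (2 + 2 * int t)" by (simp add: P_def)
  have P_Suc: "P (Suc q) = (if q = t then P q else P q * s 0 (3 + 2 * int q))" for q
  proof (cases "q = t")
    case True
    then have "{..<Suc q} - {t} = {..<q} - {t}" by auto
    then show ?thesis using True by (simp add: P_def)
  next
    case False
    then have "{..<Suc q} - {t} = insert q ({..<q} - {t})" by auto
    then show ?thesis using False by (simp add: P_def ac_simps)
  qed
  define s1 where "s1 = s(a_num := (s a_num)(int t := s 0 (2 + 2 * int t)))"
  have "wp g (For m x_r (V x_m) scale_cell) (\<lambda>s'. s' a_num = (s a_num)(int t := P m)) s1"
  proof (rule wp_For[where I = "\<lambda>q s'. s' a_num = (s a_num)(int t := P q)"])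
    show "s1 a_num = (s a_num)(int t := P 0)" by (simp add: s1_def P0)
  next
    fix s' assume ag: "agree (insert x_r (mods scale_cell)) s1 s'"
    have "s' x_m = s1 x_m" by (rule agreeD[OF ag]) (simp add: mods_scale_cell)
    then show "ok g s' (V x_m) \<and> ev s' (V x_m) = int m" using m by (simp add: s1_def)
  next
    fix q s' assume q: "q < m" and I: "s' a_num = (s a_num)(int t := P q)" and r: "s' x_r 0 = int q"
      and ag: "agree (insert x_r (mods scale_cell)) s1 s'"
    have "s' x_t = s1 x_t" "s' 0 = s1 0" by (rule agreeD[OF ag]; simp add: mods_scale_cell)+
    then have s': "s' x_t 0 = int t" "s' 0 = s 0" using t by (simp_all add: s1_def)
    show "wp g scale_cell (\<lambda>s'. s' a_num = (s a_num)(int t := P (Suc q))) s'"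
      using r s' I size[OF q] by (auto simp: scale_cell_def P_Suc)
  qed (simp_all add: mods_scale_cell)
  then show ?thesis unfolding scale_row_def wp_Sq s1_def P_def using t by simp
qed

lemma scale_program:
  assumes n: "s 0 0 = int n" and size: "\<And>r. r < 3 * n \<Longrightarrow> int_size (s 0 (3 + 2 * int r)) \<le> g"
  shows "wp g (scale_program n) (\<lambda>s'. s' x_n 0 = int n \<and> s' x_k 0 = s 0 1 \<and>
    (\<forall>t<3 * n. s' a_num (int t) = s 0 (2 + 2 * int t) * (\<Prod>r\<in>{..<3 * n} - {t}. s 0 (3 + 2 * int r)))) s"
proof -
  let ?P = "\<lambda>t. s 0 (2 + 2 * int t) * (\<Prod>r\<in>{..<3 * n} - {t}. s 0 (3 + 2 * int r))"
  define s1 where "s1 = s(x_n := (s x_n)(0 := int n), x_k := (s x_k)(0 := s 0 1), x_m := (s x_m)(0 := 3 * int n))"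
  have "wp g (For (3 * n) x_t (V x_m) (scale_row (3 * n))) (\<lambda>s'. s' x_n 0 = int n \<and> s' x_k 0 = s 0 1 \<and>
      (\<forall>t<3 * n. s' a_num (int t) = ?P t)) s1"
  proof (rule wp_For[where I = "\<lambda>m s'. \<forall>t<m. s' a_num (int t) = ?P t"])
    fix s' assume ag: "agree (insert x_t (mods (scale_row (3 * n)))) s1 s'"
    have "s' x_m = s1 x_m" by (rule agreeD[OF ag]) (simp add: mods_scale_row)
    then show "ok g s' (V x_m) \<and> ev s' (V x_m) = int (3 * n)" by (simp add: s1_def)
  next
    fix t s' assume t: "t < 3 * n" "s' x_t 0 = int t" and I: "\<forall>q<t. s' a_num (int q) = ?P q"
      and ag: "agree (insert x_t (mods (scale_row (3 * n)))) s1 s'"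
    have "s' x_m = s1 x_m" "s' 0 = s1 0" by (rule agreeD[OF ag]; simp add: mods_scale_row)+
    then have s': "s' x_m 0 = int (3 * n)" "s' 0 = s 0" by (simp_all add: s1_def)
    have "wp g (scale_row (3 * n)) (\<lambda>s''. s'' a_num = (s' a_num)(int t :=
      s' 0 (2 + 2 * int t) * (\<Prod>r\<in>{..<3 * n} - {t}. s' 0 (3 + 2 * int r)))) s'"
      by (rule scale_row) (use s' t size in simp_all)
    then show "wp g (scale_row (3 * n)) (\<lambda>s''. \<forall>q<Suc t. s'' a_num (int q) = ?P q) s'"
      by (rule wp_mono) (use I s' in \<open>simp add: less_Suc_eq\<close>)
  next
    fix s' assume I: "\<forall>t<3 * n. s' a_num (int t) = ?P t"
      and ag: "agree (insert x_t (mods (scale_row (3 * n)))) s1 s'"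
    have "s' x_n = s1 x_n" "s' x_k = s1 x_k" by (rule agreeD[OF ag]; simp add: mods_scale_row)+
    then show "s' x_n 0 = int n \<and> s' x_k 0 = s 0 1 \<and> (\<forall>t<3 * n. s' a_num (int t) = ?P t)"
      using I by (simp add: s1_def)
  qed (simp_all add: mods_scale_row)
  then show ?thesis unfolding scale_program_def wp_Sq s1_def using n by (simp add: fun_upd_twist)
qed

section \<open>Ranks of intervals\<close>

text \<open>The length of an interval: in \<open>a_num\<close> the costs \<open>c\<close> are stored
  \<open>n\<close> cells after the costs \<open>b\<close>.\<close>

abbreviation gain :: "ex \<Rightarrow> ex" where
  "gain e \<equiv> Minus (Get a_num (Plus (V x_n) e)) (Get a_num e)"

text \<open>The power \<open>4 ^ rank\<close> is built directly, with one quadrupling for each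
  predecessor; the rank itself is never stored.\<close>

definition rank_cell :: cm where
  "rank_cell = If (And (Not (Lt (gain (V x_i)) (gain (V x_r))))
       (Not (And (Not (Lt (gain (V x_r)) (gain (V x_i)))) (Lt (V x_r) (V x_i))))) Nop
     (Set a_E (V x_i) (Plus (Plus (Get a_E (V x_i)) (Get a_E (V x_i)))
       (Plus (Get a_E (V x_i)) (Get a_E (V x_i)))))"

definition rank_row :: "nat \<Rightarrow> cm" where
  "rank_row n = Sq (Set a_E (V x_i) (N 1)) (For n x_r (V x_n) rank_cell)"

definition rank_program :: "nat \<Rightarrow> cm" where
  "rank_program n = Sq (Assign x_K (N 4))
     (Sq (For n x_i (V x_n) (Assign x_K (Plus (Plus (V x_K) (V x_K)) (Plus (V x_K) (V x_K)))))
       (For n x_i (V x_n) (rank_row n)))"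

lemma mods_rank_cell: "mods rank_cell = {a_E}"
  by (auto simp: rank_cell_def)

lemma mods_rank_row: "mods (rank_row n) = {a_E, x_r}"
  by (auto simp: rank_row_def mods_For mods_rank_cell)

lemma mods_rank_program: "mods (rank_program n) = {x_K, x_i, a_E, x_r}"
  by (auto simp: rank_program_def mods_For mods_rank_row)

text \<open>Longer intervals come first and ties are broken by index. This is a strict linear order
  in which an interval precedes all intervals strictly inside it.\<close>

definition precedes :: "nat \<Rightarrow> (int \<Rightarrow> int) \<Rightarrow> nat \<Rightarrow> nat \<Rightarrow> bool" where
  "precedes n q r i \<longleftrightarrow> q (int (n + i)) - q (int i) < q (int (n + r)) - q (int r) \<or>
     q (int (n + r)) - q (int r) = q (int (n + i)) - q (int i) \<and> r < i"

definition rank_of :: "nat \<Rightarrow> (int \<Rightarrow> int) \<Rightarrow> nat \<Rightarrow> nat" where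
  "rank_of n q i = card {r. r < n \<and> precedes n q r i}"

lemma rank_row:
  assumes n: "s x_n 0 = int n" and i: "s x_i 0 = int i" "i < n"
  shows "wp g (rank_row n) (\<lambda>s'. s' a_E = (s a_E)(int i := 4 ^ rank_of n (s a_num) i)) s"
proof -
  define P where "P m = card {r. r < m \<and> precedes n (s a_num) r i}" for m
  have P_Suc: "P (Suc m) = (if precedes n (s a_num) m i then Suc (P m) else P m)" for m
  proof -
    have "{r. r < Suc m \<and> precedes n (s a_num) r i} = (if precedes n (s a_num) m i
       then insert m {r. r < m \<and> precedes n (s a_num) r i} else {r. r < m \<and> precedes n (s a_num) r i})"
      by (auto simp: less_Suc_eq)
    then show ?thesis by (simp add: P_def)
  qed
  define s1 where "s1 = s(a_E := (s a_E)(int i := 1))"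
  have "wp g (For n x_r (V x_n) rank_cell) (\<lambda>s'. s' a_E = (s a_E)(int i := 4 ^ P n)) s1"
  proof (rule wp_For[where I = "\<lambda>m s'. s' a_E = (s a_E)(int i := 4 ^ P m)"])
    show "s1 a_E = (s a_E)(int i := 4 ^ P 0)" by (simp add: s1_def P_def)
  next
    fix s' assume ag: "agree (insert x_r (mods rank_cell)) s1 s'"
    have "s' x_n = s1 x_n" by (rule agreeD[OF ag]) (simp add: mods_rank_cell)
    then show "ok g s' (V x_n) \<and> ev s' (V x_n) = int n" using n by (simp add: s1_def)
  next
    fix m s' assume m: "m < n" and I: "s' a_E = (s a_E)(int i := 4 ^ P m)" and r: "s' x_r 0 = int m"
      and ag: "agree (insert x_r (mods rank_cell)) s1 s'"
    have "s' x_n = s1 x_n" "s' x_i = s1 x_i" "s' a_num = s1 a_num"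
      by (rule agreeD[OF ag]; simp add: mods_rank_cell)+
    then have s': "s' x_n 0 = int n" "s' x_i 0 = int i" "s' a_num = s a_num" using n i by (simp_all add: s1_def)
    have c: "evb s' (And (Not (Lt (gain (V x_i)) (gain (V x_r))))
       (Not (And (Not (Lt (gain (V x_r)) (gain (V x_i)))) (Lt (V x_r) (V x_i))))) \<longleftrightarrow> \<not> precedes n (s a_num) m i"
      using s' r by (auto simp: precedes_def)
    have o: "okb g s' (And (Not (Lt (gain (V x_i)) (gain (V x_r))))
       (Not (And (Not (Lt (gain (V x_r)) (gain (V x_i)))) (Lt (V x_r) (V x_i)))))"
      using s' r by simp
    show "wp g rank_cell (\<lambda>s'. s' a_E = (s a_E)(int i := 4 ^ P (Suc m))) s'"
      unfolding rank_cell_def wp.simps(3) c using o I s' by (simp add: P_Suc)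
  qed (simp_all add: mods_rank_cell)
  then show ?thesis unfolding rank_row_def wp_Sq s1_def P_def rank_of_def using i by simp
qed

lemma rank_program:
  assumes n: "s x_n 0 = int n"
  shows "wp g (rank_program n) (\<lambda>s'. s' x_K 0 = 4 ^ Suc n \<and>
    (\<forall>i<n. s' a_E (int i) = 4 ^ rank_of n (s a_num) i)) s"
proof -
  define s1 where "s1 = s(x_K := (s x_K)(0 := 4))"
  let ?c = "Assign x_K (Plus (Plus (V x_K) (V x_K)) (Plus (V x_K) (V x_K)))"
  have "wp g (For n x_i (V x_n) ?c) (\<lambda>s'. s' x_K 0 = 4 ^ Suc n) s1"
  proof (rule wp_For[where I = "\<lambda>m s'. s' x_K 0 = 4 ^ Suc m"])
    fix s' assume ag: "agree (insert x_i (mods ?c)) s1 s'"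
    have "s' x_n = s1 x_n" by (rule agreeD[OF ag]) simp
    then show "ok g s' (V x_n) \<and> ev s' (V x_n) = int n" using n by (simp add: s1_def)
  qed (simp_all add: s1_def)
  then have "wp g (For n x_i (V x_n) ?c) (wp g (For n x_i (V x_n) (rank_row n)) (\<lambda>s'. s' x_K 0 = 4 ^ Suc n \<and>
    (\<forall>i<n. s' a_E (int i) = 4 ^ rank_of n (s a_num) i))) s1"
  proof (rule wp_conseq)
    fix s2 assume K: "s2 x_K 0 = 4 ^ Suc n" and "agree (mods (For n x_i (V x_n) ?c)) s1 s2"
    then have ag2: "agree {x_i, x_K} s1 s2" by (simp add: mods_For)
    have "s2 x_n = s1 x_n" "s2 a_num = s1 a_num" by (rule agreeD[OF ag2]; simp)+
    then have s2: "s2 x_n 0 = int n" "s2 a_num = s a_num" using n by (simp_all add: s1_def)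
    show "wp g (For n x_i (V x_n) (rank_row n)) (\<lambda>s'. s' x_K 0 = 4 ^ Suc n \<and>
      (\<forall>i<n. s' a_E (int i) = 4 ^ rank_of n (s a_num) i)) s2"
    proof (rule wp_For[where I = "\<lambda>m s'. \<forall>i<m. s' a_E (int i) = 4 ^ rank_of n (s a_num) i"])
      fix s' assume ag: "agree (insert x_i (mods (rank_row n))) s2 s'"
      have "s' x_n = s2 x_n" by (rule agreeD[OF ag]) (simp add: mods_rank_row)
      then show "ok g s' (V x_n) \<and> ev s' (V x_n) = int n" using s2 by simp
    next
      fix i s' assume i: "i < n" "s' x_i 0 = int i" and I: "\<forall>j<i. s' a_E (int j) = 4 ^ rank_of n (s a_num) j"
        and ag: "agree (insert x_i (mods (rank_row n))) s2 s'"
      have s': "s' x_n = s2 x_n" "s' a_num = s2 a_num" by (rule agreeD[OF ag]; simp add: mods_rank_row)+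
      have "wp g (rank_row n) (\<lambda>s''. s'' a_E = (s' a_E)(int i := 4 ^ rank_of n (s' a_num) i)) s'"
        by (rule rank_row) (use i s' s2 in simp_all)
      then show "wp g (rank_row n) (\<lambda>s''. \<forall>j<Suc i. s'' a_E (int j) = 4 ^ rank_of n (s a_num) j) s'"
        by (rule wp_mono) (use I s' s2 in \<open>simp add: less_Suc_eq\<close>)
    next
      fix s' assume I: "\<forall>i<n. s' a_E (int i) = 4 ^ rank_of n (s a_num) i"
        and ag: "agree (insert x_i (mods (rank_row n))) s2 s'"
      have "s' x_K = s2 x_K" by (rule agreeD[OF ag]) (simp add: mods_rank_row)
      then show "s' x_K 0 = 4 ^ Suc n \<and> (\<forall>i<n. s' a_E (int i) = 4 ^ rank_of n (s a_num) i)"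
        using I K by simp
    qed (simp_all add: mods_rank_row)
  qed
  then show ?thesis unfolding rank_program_def wp_Sq s1_def by simp
qed

lemma rank_of_less: assumes "i < n" shows "rank_of n q i < n"
proof -
  have "{r. r < n \<and> precedes n q r i} \<subseteq> {..<n} - {i}" by (auto simp: precedes_def)
  then have "rank_of n q i \<le> card ({..<n} - {i})" unfolding rank_of_def by (intro card_mono) auto
  also have "\<dots> < n" using assms by simp
  finally show ?thesis .
qed

lemma rank_of_mono:
  assumes "precedes n q i i'" "i < n" shows "rank_of n q i < rank_of n q i'"
  unfolding rank_of_def
proof (rule psubset_card_mono)
  have "precedes n q r i'" if "precedes n q r i" for r
    using that assms(1) unfolding precedes_def by linarith
  moreover have "\<not> precedes n q i i" by (simp add: precedes_def)
  ultimately show "{r. r < n \<and> precedes n q r i} \<subset> {r. r < n \<and> precedes n q r i'}" using assms by blast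
qed simp

lemma precedes_total: "i \<noteq> i' \<Longrightarrow> precedes n q i i' \<or> precedes n q i' i"
  unfolding precedes_def by linarith

lemma rank_of_inj: "inj_on (rank_of n q) {..<n}"
proof (rule inj_onI)
  fix i i' assume i: "i \<in> {..<n}" "i' \<in> {..<n}" "rank_of n q i = rank_of n q i'"
  show "i = i'"
  proof (rule ccontr)
    assume "i \<noteq> i'"
    then show False using precedes_total[of i i' n q] rank_of_mono[of n q i i'] rank_of_mono[of n q i' i] i by auto
  qed
qed

text \<open>If the inner interval precedes the outer one, it is at least as long, and then both ends
  agree.\<close>

lemma rank_of_nested:
  assumes "i < n" "i' < n" "q (int i) \<le> q (int i')" "q (int (n + i')) \<le> q (int (n + i))"
  shows "rank_of n q i \<le> rank_of n q i' \<or> q (int i) = q (int i') \<and> q (int (n + i)) = q (int (n + i'))"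
proof (cases "precedes n q i i' \<or> i = i'")
  case True
  then show ?thesis using rank_of_mono[of n q i i'] assms(1) by auto
next
  case False
  then have "precedes n q i' i" using precedes_total by blast
  then show ?thesis using assms(3,4) unfolding precedes_def by linarith
qed

section \<open>Matrices filled row by row\<close>

text \<open>\<open>I i j\<close> describes the state before cell \<open>(i, j)\<close>; the premise
  \<open>row\<close> identifies the end of a row with the start of the next.\<close>

lemma wp_For2:
  assumes n: "s x_n 0 = int n"
    and v: "x_i \<notin> mods c" "x_j \<notin> mods c" "x_n \<notin> mods c"
    and init: "I 0 0 s"
    and indep: "\<And>i j s x. I i j s \<Longrightarrow> I i j (s(x_i := x))" "\<And>i j s x. I i j s \<Longrightarrow> I i j (s(x_j := x))"
    and step: "\<And>i j s'. i < n \<Longrightarrow> j < n \<Longrightarrow> I i j s' \<Longrightarrow> agree (insert x_i (insert x_j (mods c))) s s' \<Longrightarrow>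
      s' x_i 0 = int i \<Longrightarrow> s' x_j 0 = int j \<Longrightarrow> wp g c (I i (Suc j)) s'"
    and row: "\<And>i s. I i n s \<Longrightarrow> I (Suc i) 0 s"
  shows "wp g (For n x_i (V x_n) (For n x_j (V x_n) c)) (I n 0) s"
proof (rule wp_For[where I = "\<lambda>i. I i 0"])
  fix s' assume ag: "agree (insert x_i (mods (For n x_j (V x_n) c))) s s'"
  have "s' x_n = s x_n" by (rule agreeD[OF ag]) (simp add: mods_For v)
  then show "ok g s' (V x_n) \<and> ev s' (V x_n) = int n" using n by simp
next
  fix i s' assume i: "i < n" "s' x_i 0 = int i" and I: "I i 0 s'"
    and ag: "agree (insert x_i (mods (For n x_j (V x_n) c))) s s'"
  have ag': "agree (insert x_i (insert x_j (mods c))) s s'" using ag by (simp add: mods_For)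
  have xn: "s' x_n = s x_n" by (rule agreeD[OF ag']) (simp add: v)
  show "wp g (For n x_j (V x_n) c) (I (Suc i) 0) s'"
  proof (rule wp_For[where I = "I i"])
    fix s'' assume a: "agree (insert x_j (mods c)) s' s''"
    have "s'' x_n = s' x_n" by (rule agreeD[OF a]) (simp add: v)
    then show "ok g s'' (V x_n) \<and> ev s'' (V x_n) = int n" using n xn by simp
  next
    fix j s'' assume j: "j < n" "I i j s''" "s'' x_j 0 = int j" and a: "agree (insert x_j (mods c)) s' s''"
    have "s'' x_i = s' x_i" by (rule agreeD[OF a]) (simp add: v)
    moreover have "agree (insert x_i (insert x_j (mods c))) s s''"
      by (rule agree_trans[OF ag']) (rule agree_mono[OF a], auto)
    ultimately show "wp g c (I i (Suc j)) s''" using step i j by simp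
  qed (use I v indep row in auto)
qed (use init v indep in \<open>auto simp: mods_For\<close>)

text \<open>The offset \<open>b\<close> is nonzero only for the second half of the output, where it
  is \<open>n * n\<close>.\<close>

definition filled :: "(nat \<Rightarrow> nat \<Rightarrow> int) \<Rightarrow> int \<Rightarrow> nat \<Rightarrow> nat \<Rightarrow> nat \<Rightarrow> (int \<Rightarrow> int) \<Rightarrow> bool" where
  "filled val b n i j f \<longleftrightarrow> (\<forall>i'<n. \<forall>j'<n. i' < i \<or> i' = i \<and> j' < j \<longrightarrow>
     f (b + (int i' * int n + int j')) = val i' j')"

lemma cell_inj:
  assumes "int i * int n + int j = int i' * int n + int j'" "j < n" "j' < n"
  shows "i = i' \<and> j = j'"
proof -
  have "i * n + j = i' * n + j'" using assms(1) by (metis of_nat_add of_nat_eq_iff of_nat_mult)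
  then have "(i * n + j) div n = (i' * n + j') div n" "(i * n + j) mod n = (i' * n + j') mod n" by simp_all
  then show ?thesis using assms(2,3) by simp
qed

lemma cell_less:
  assumes "i < n" "j < n" shows "int i * int n + int j < int n * int n"
proof -
  have "Suc i * n \<le> n * n" using assms(1) by (intro mult_le_mono1) simp
  then have "i * n + j < n * n" using assms(2) by simp
  then show ?thesis by (metis of_nat_add of_nat_less_iff of_nat_mult)
qed

lemma filled_0: "filled val b n 0 0 f"
  by (simp add: filled_def)

lemma filled_row: "filled val b n i n f \<Longrightarrow> filled val b n (Suc i) 0 f"
  by (auto simp: filled_def less_Suc_eq)

lemma filled_cong:
  "(\<And>i j. i < n \<Longrightarrow> j < n \<Longrightarrow> v i j = v' i j) \<Longrightarrow> filled v b n i j f = filled v' b n i j f"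
  by (simp add: filled_def)

lemma filled_update:
  assumes "filled val b n i j f" "i < n" "j < n" "a = b + (int i * int n + int j)" "x = val i j"
  shows "filled val b n i (Suc j) (f(a := x))"
  unfolding filled_def
proof (intro allI impI)
  fix i' j' assume *: "i' < n" "j' < n" "i' < i \<or> i' = i \<and> j' < Suc j"
  show "(f(a := x)) (b + (int i' * int n + int j')) = val i' j'"
  proof (cases "i' = i \<and> j' = j")
    case False
    then have "b + (int i' * int n + int j') \<noteq> a" using cell_inj[of i' n j' i j] * assms by auto
    then show ?thesis using * assms(1) False unfolding filled_def by (auto simp: less_Suc_eq)
  qed (use assms in simp)
qed

lemma filled_other:
  assumes "filled val b n i j f" "a < b \<or> b + int n * int n \<le> a"
  shows "filled val b n i j (f(a := x))"
  unfolding filled_def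
proof (intro allI impI)
  fix i' j' assume *: "i' < n" "j' < n" "i' < i \<or> i' = i \<and> j' < j"
  have "0 \<le> int i' * int n + int j'" by simp
  then have "b + (int i' * int n + int j') \<noteq> a" using cell_less[OF *(1,2)] assms(2) by linarith
  then show "(f(a := x)) (b + (int i' * int n + int j')) = val i' j'"
    using assms(1)[unfolded filled_def, rule_format, OF *] by simp
qed

lemma filled_last: "filled val b n n 0 f \<Longrightarrow> i < n \<Longrightarrow> j < n \<Longrightarrow> f (b + (int i * int n + int j)) = val i j"
  by (simp add: filled_def)

abbreviation cell :: ex where "cell \<equiv> Plus (Times (V x_i) (V x_n)) (V x_j)"

text \<open>The factor 2 of the entries comes from adding each value to itself; \<open>x_H\<close>
  accumulates the bound that delimits the bisection.\<close>

definition matrix_cell :: cm where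
  "matrix_cell =
     (let x = Plus (Times (Times (V x_K) (Get a_num (V x_i))) (Get a_num (Plus (V x_n) (Plus (V x_n) (V x_j)))))
          (Get a_E (V x_i));
          y = Times (Times (V x_K) (Get a_num (Plus (V x_n) (V x_i)))) (Get a_num (Plus (V x_n) (Plus (V x_n) (V x_j))))
      in Sq (Set a_A cell (Plus x x)) (Sq (Set a_N cell (Plus y y))
           (Assign x_H (Plus (V x_H) (Plus (Get a_A cell) (Get a_N cell))))))"

definition matrix_program :: "nat \<Rightarrow> cm" where
  "matrix_program n = Sq (Assign x_H (N 1)) (For n x_i (V x_n) (For n x_j (V x_n) matrix_cell))"

lemma mods_matrix_cell: "mods matrix_cell = {a_A, a_N, x_H}"
  by (auto simp: matrix_cell_def Let_def)

lemma mods_matrix_program: "mods (matrix_program n) = {x_i, x_j, a_A, a_N, x_H}"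
  by (auto simp: matrix_program_def mods_For mods_matrix_cell)

lemma matrix_program:
  assumes n: "s x_n 0 = int n" and size: "\<And>i. 0 \<le> i \<Longrightarrow> int_size (s a_num i) \<le> g" "int_size (int n) \<le> g"
    and A: "\<And>i j. vA i j = 2 * (s x_K 0 * s a_num (int i) * s a_num (int (2 * n + j)) + s a_E (int i))"
    and N: "\<And>i j. vN i j = 2 * (s x_K 0 * s a_num (int (n + i)) * s a_num (int (2 * n + j)))"
  shows "wp g (matrix_program n) (\<lambda>s'. filled vA 0 n n 0 (s' a_A) \<and> filled vN 0 n n 0 (s' a_N) \<and>
    s' x_H 0 = 1 + (\<Sum>i<n. \<Sum>j<n. vA i j + vN i j)) s"
proof -
  define s1 where "s1 = s(x_H := (s x_H)(0 := 1))"
  let ?I = "\<lambda>i j s'. filled vA 0 n i j (s' a_A) \<and> filled vN 0 n i j (s' a_N) \<and>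
    s' x_H 0 = 1 + (\<Sum>i<i. \<Sum>j<n. vA i j + vN i j) + (\<Sum>j<j. vA i j + vN i j)"
  have "wp g (For n x_i (V x_n) (For n x_j (V x_n) matrix_cell)) (?I n 0) s1"
  proof (rule wp_For2[where I = ?I])
    fix i j s' assume ij: "i < n" "j < n" "s' x_i 0 = int i" "s' x_j 0 = int j" and I: "?I i j s'"
      and ag: "agree (insert x_i (insert x_j (mods matrix_cell))) s1 s'"
    have "s' x_n = s1 x_n" "s' x_K = s1 x_K" "s' a_num = s1 a_num" "s' a_E = s1 a_E"
      by (rule agreeD[OF ag]; simp add: mods_matrix_cell)+
    then have s': "s' x_n 0 = int n" "s' x_K = s x_K" "s' a_num = s a_num" "s' a_E = s a_E"
      using n by (simp_all add: s1_def)
    have arg: "2 * int n + int j = int (2 * n + j)" "int n + (int n + int j) = int (2 * n + j)"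
      "int n + int i = int (n + i)" by simp_all
    have vA: "s x_K 0 * s a_num (int i) * s a_num (int (2 * n + j)) + s a_E (int i) +
        (s x_K 0 * s a_num (int i) * s a_num (int (2 * n + j)) + s a_E (int i)) = vA i j"
      unfolding A by simp
    have vN: "s x_K 0 * s a_num (int (n + i)) * s a_num (int (2 * n + j)) +
        s x_K 0 * s a_num (int (n + i)) * s a_num (int (2 * n + j)) = vN i j"
      unfolding N by simp
    have fA: "filled vA 0 n i (Suc j) ((s' a_A)(int i * int n + int j := vA i j))"
      by (rule filled_update) (use I ij in auto)
    have fN: "filled vN 0 n i (Suc j) ((s' a_N)(int i * int n + int j := vN i j))"
      by (rule filled_update) (use I ij in auto)
    show "wp g matrix_cell (?I i (Suc j)) s'"
      unfolding matrix_cell_def Let_def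
      using ij s' size I fA fN by (simp add: vA vN arg del: of_nat_add of_nat_mult)
  qed (auto simp: s1_def n mods_matrix_cell filled_0 filled_row)
  then show ?thesis unfolding matrix_program_def wp_Sq s1_def by simp
qed

section \<open>Programs for one multiplier, for the search and for the output\<close>

definition cost_cell :: cm where
  "cost_cell = Sq (Set a_C cell (Plus (Get a_A cell) (V x_lam)))
     (If (Lt (Get a_N cell) (Get a_C cell)) (Set a_C cell (Get a_N cell)) Nop)"

definition count_cell :: cm where
  "count_cell = If (Lt (Plus (entry_at a_A (Get a_p (V x_j)) (V x_j)) (V x_lam)) (entry_at a_N (Get a_p (V x_j)) (V x_j)))
     (Assign x_cnt (Plus (V x_cnt) (N 1))) Nop"

text \<open>Before the multiplier is added all entries are nonnegative, so the minimum of 0 and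
  \<open>x_lam\<close> is a lower bound on the reduced entries.\<close>

definition search_core :: "nat \<Rightarrow> cm" where
  "search_core n =
     Sq (Assign x_lb (N 0)) (Sq (If (Lt (V x_lam) (N 0)) (Assign x_lb (V x_lam)) Nop)
     (Sq (For n x_i (V x_n) (For n x_j (V x_n) cost_cell))
     (Sq (hungarian_program n)
     (Sq (Assign x_cnt (N 0)) (For n x_j (V x_n) count_cell)))))"

definition search_body :: "nat \<Rightarrow> cm" where
  "search_body n = Sq (Assign x_mid (Div (Plus (V x_lo) (V x_hi)) (N 2)))
     (Sq (Assign x_lam (Plus (Plus (V x_mid) (V x_mid)) (N 1)))
     (Sq (search_core n)
       (If (Lt (V x_k) (V x_cnt)) (Assign x_lo (Plus (V x_mid) (N 1)))
         (If (Lt (V x_cnt) (V x_k)) (Assign x_hi (Minus (V x_mid) (N 1))) Nop))))"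

text \<open>The count starts at -1, which differs from every \<open>k\<close>, so the loop is
  entered.\<close>

definition search_program :: "nat \<Rightarrow> nat \<Rightarrow> cm" where
  "search_program n l = Sq (Assign x_lo (Minus (N 0) (V x_H))) (Sq (Assign x_hi (V x_H))
     (Sq (Assign x_cnt (N (-1)))
       (Wh l (Not (And (Not (Lt (V x_cnt) (V x_k))) (Not (Lt (V x_k) (V x_cnt))))) (search_body n))))"

lemma mods_cost_cell: "mods cost_cell = {a_C}"
  by (auto simp: cost_cell_def)

lemma mods_count_cell: "mods count_cell = {x_cnt}"
  by (auto simp: count_cell_def)

lemma mods_search_core: "mods (search_core n) = {x_lb, x_i, x_j, a_C, x_cnt} \<union> mods (hungarian_program n)"
  by (auto simp: search_core_def mods_For mods_cost_cell mods_count_cell)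

text \<open>The output overwrites the input, which is no longer needed.\<close>

definition output_cell :: cm where
  "output_cell = Sq (Set 0 cell (N 0)) (Sq (Set 0 (Plus (Times (V x_n) (V x_n)) cell) (N 0))
     (If (Not (And (Not (Lt (Get a_p (V x_j)) (V x_i))) (Not (Lt (V x_i) (Get a_p (V x_j)))))) Nop
       (If (Lt (Plus (Get a_A cell) (V x_lam)) (Get a_N cell)) (Set 0 cell (N 1))
         (Set 0 (Plus (Times (V x_n) (V x_n)) cell) (N 1)))))"

definition output_program :: "nat \<Rightarrow> cm" where
  "output_program n = For n x_i (V x_n) (For n x_j (V x_n) output_cell)"

lemma mods_output_cell: "mods output_cell = {0}"
  by (auto simp: output_cell_def)

lemma output_program:
  assumes n: "s x_n 0 = int n" "int_size (int n) \<le> g"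
    and A: "filled vA 0 n n 0 (s a_A)" and N: "filled vN 0 n n 0 (s a_N)"
    and X: "\<And>i j. vX i j = of_bool (s a_p (int j) = int i \<and> vA i j + s x_lam 0 < vN i j)"
    and Y: "\<And>i j. vY i j = of_bool (s a_p (int j) = int i \<and> \<not> vA i j + s x_lam 0 < vN i j)"
  shows "wp g (output_program n) (\<lambda>s'. filled vX 0 n n 0 (s' 0) \<and> filled vY (int n * int n) n n 0 (s' 0)) s"
proof -
  let ?I = "\<lambda>i j s'. filled vX 0 n i j (s' 0) \<and> filled vY (int n * int n) n i j (s' 0)"
  show ?thesis unfolding output_program_def
  proof (rule wp_For2[where I = ?I])
    fix i j s' assume ij: "i < n" "j < n" "s' x_i 0 = int i" "s' x_j 0 = int j" and I: "?I i j s'"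
      and ag: "agree (insert x_i (insert x_j (mods output_cell))) s s'"
    have s': "s' x_n = s x_n" "s' x_lam = s x_lam" "s' a_A = s a_A" "s' a_N = s a_N" "s' a_p = s a_p"
      by (rule agreeD[OF ag]; simp add: mods_output_cell)+
    let ?a = "int i * int n + int j" and ?b = "int n * int n + (int i * int n + int j)"
    have vals: "s a_A ?a = vA i j" "s a_N ?a = vN i j"
      using filled_last[OF A ij(1,2)] filled_last[OF N ij(1,2)] by simp_all
    have lt: "?a < int n * int n" by (rule cell_less[OF ij(1,2)])
    have "0 \<le> ?a" by simp
    then have ab: "?a \<noteq> ?b" using lt by linarith
    have two: "?I i (Suc j) (s'(0 := (s' 0)(?a := vX i j, ?b := vY i j)))"
    proof
      have "filled vX 0 n i (Suc j) ((s' 0)(?a := vX i j))" by (rule filled_update) (use I ij in auto)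
      then have "filled vX 0 n i (Suc j) ((s' 0)(?a := vX i j, ?b := vY i j))" by (rule filled_other) simp
      then show "filled vX 0 n i (Suc j) ((s'(0 := (s' 0)(?a := vX i j, ?b := vY i j))) 0)" by simp
      have "filled vY (int n * int n) n i j ((s' 0)(?a := vX i j))"
        using I lt by (intro filled_other) simp_all
      then have "filled vY (int n * int n) n i (Suc j) ((s' 0)(?a := vX i j, ?b := vY i j))"
        by (rule filled_update) (use ij in auto)
      then show "filled vY (int n * int n) n i (Suc j) ((s'(0 := (s' 0)(?a := vX i j, ?b := vY i j))) 0)" by simp
    qed
    consider (off) "s a_p (int j) \<noteq> int i" | (up) "s a_p (int j) = int i" "vA i j + s x_lam 0 < vN i j"
      | (reg) "s a_p (int j) = int i" "\<not> vA i j + s x_lam 0 < vN i j" by blast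
    then show "wp g output_cell (?I i (Suc j)) s'"
    proof cases
      case off
      then have v: "vX i j = 0" "vY i j = 0" unfolding X Y by simp_all
      have "s a_p (int j) < int i \<or> int i < s a_p (int j)" using off by linarith
      then show ?thesis using two[unfolded v] ij s' n by (simp add: output_cell_def)
    next
      case up
      then have v: "vX i j = 1" "vY i j = 0" unfolding X Y by simp_all
      show ?thesis using two[unfolded v] ij s' n up ab vals by (simp add: output_cell_def fun_upd_twist)
    next
      case reg
      then have v: "vX i j = 0" "vY i j = 1" unfolding X Y by simp_all
      show ?thesis using two[unfolded v] ij s' n reg ab vals by (simp add: output_cell_def)
    qed
  qed (auto simp: n mods_output_cell filled_0 filled_row)
qed

section \<open>Bisection on the multiplier\<close>

lemma bij_betw_int: "bij_betw int {..<n} {0..<int n}"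
  by (rule bij_betw_byWitness[where f' = nat]) auto

lemma bij_betw_nat: "bij_betw nat {0..<int n} {..<n}"
  by (rule bij_betw_byWitness[where f' = int]) auto

locale search = perturbed_data "{..<n}" "{..<n}" B C D rank k
  for n :: nat and B C D :: "nat \<Rightarrow> int" and rank :: "nat \<Rightarrow> nat" and k :: nat +
  fixes g :: nat
  assumes g: "int_size (int n) \<le> g"
begin

definition ready :: "store \<Rightarrow> bool" where
  "ready s \<longleftrightarrow> s x_n 0 = int n \<and> s x_k 0 = int k \<and>
     filled upgraded_entry 0 n n 0 (s a_A) \<and> filled regular_entry 0 n n 0 (s a_N)"

definition plan_of :: "store \<Rightarrow> nat \<Rightarrow> nat" where
  "plan_of s j = nat (s a_p (int j))"

definition upgraded :: "store \<Rightarrow> nat set" where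
  "upgraded s = plan_of s ` {j\<in>{..<n}.
     upgraded_entry (plan_of s j) j + s x_lam 0 < regular_entry (plan_of s j) j}"

text \<open>The multiplier stays in \<open>x_lam\<close>, so that the output program can decide
  again for each cell whether it is upgraded.\<close>

definition solved :: "int \<Rightarrow> store \<Rightarrow> bool" where
  "solved \<mu> s \<longleftrightarrow> s x_lam 0 = 2 * \<mu> + 1 \<and> (\<forall>j<n. 0 \<le> s a_p (int j)) \<and>
     optimal_at \<mu> (upgraded s) (plan_of s) \<and> s x_cnt 0 = int (card (upgraded s))"

lemma cost_loop:
  assumes "ready s"
  shows "wp g (For n x_i (V x_n) (For n x_j (V x_n) cost_cell)) (\<lambda>s'.
    filled (\<lambda>i j. min (upgraded_entry i j + s x_lam 0) (regular_entry i j)) 0 n n 0 (s' a_C)) s"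
proof (rule wp_For2[where I = "\<lambda>i j s'. filled (\<lambda>i j. min (upgraded_entry i j + s x_lam 0) (regular_entry i j)) 0 n i j (s' a_C)"])
  fix i j s' assume ij: "i < n" "j < n" "s' x_i 0 = int i" "s' x_j 0 = int j"
    and I: "filled (\<lambda>i j. min (upgraded_entry i j + s x_lam 0) (regular_entry i j)) 0 n i j (s' a_C)"
    and ag: "agree (insert x_i (insert x_j (mods cost_cell))) s s'"
  have s': "s' x_n = s x_n" "s' x_lam = s x_lam" "s' a_A = s a_A" "s' a_N = s a_N"
    by (rule agreeD[OF ag]; simp add: mods_cost_cell)+
  have A: "s a_A (int i * int n + int j) = upgraded_entry i j" and N: "s a_N (int i * int n + int j) = regular_entry i j"
    using filled_last[of upgraded_entry 0 n "s a_A" i j] filled_last[of regular_entry 0 n "s a_N" i j] assms ij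
    by (simp_all add: ready_def)
  have "filled (\<lambda>i j. min (upgraded_entry i j + s x_lam 0) (regular_entry i j)) 0 n i (Suc j)
     ((s' a_C)(int i * int n + int j := min (upgraded_entry i j + s x_lam 0) (regular_entry i j)))"
    by (rule filled_update[OF I]) (use ij in auto)
  then show "wp g cost_cell (\<lambda>s'. filled (\<lambda>i j. min (upgraded_entry i j + s x_lam 0) (regular_entry i j)) 0 n i (Suc j) (s' a_C)) s'"
    using ij s' A N assms g by (auto simp: cost_cell_def ready_def min_def split: if_splits)
qed (use assms in \<open>auto simp: ready_def mods_cost_cell filled_0 filled_row\<close>)

lemma count_loop:
  assumes "ready s" and p: "\<And>j. j < n \<Longrightarrow> 0 \<le> s a_p (int j) \<and> s a_p (int j) < int n" and "s x_cnt 0 = 0"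
  shows "wp g (For n x_j (V x_n) count_cell) (\<lambda>s'. s' x_cnt 0 = int (card {j\<in>{..<n}.
     upgraded_entry (plan_of s j) j + s x_lam 0 < regular_entry (plan_of s j) j})) s"
proof -
  define P where "P m = card {j\<in>{..<m}. upgraded_entry (plan_of s j) j + s x_lam 0 < regular_entry (plan_of s j) j}" for m
  have P_Suc: "P (Suc m) = (if upgraded_entry (plan_of s m) m + s x_lam 0 < regular_entry (plan_of s m) m
      then Suc (P m) else P m)" for m
  proof -
    let ?T = "\<lambda>j. upgraded_entry (plan_of s j) j + s x_lam 0 < regular_entry (plan_of s j) j"
    have "{j\<in>{..<Suc m}. ?T j} = (if ?T m then insert m {j\<in>{..<m}. ?T j} else {j\<in>{..<m}. ?T j})"
      by (auto simp: less_Suc_eq)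
    then show ?thesis unfolding P_def by simp
  qed
  have "wp g (For n x_j (V x_n) count_cell) (\<lambda>s'. s' x_cnt 0 = int (P n)) s"
  proof (rule wp_For[where I = "\<lambda>m s'. s' x_cnt 0 = int (P m)"])
    show "s x_cnt 0 = int (P 0)" using assms(3) by (simp add: P_def)
  next
    fix s' assume ag: "agree (insert x_j (mods count_cell)) s s'"
    have "s' x_n = s x_n" by (rule agreeD[OF ag]) (simp add: mods_count_cell)
    then show "ok g s' (V x_n) \<and> ev s' (V x_n) = int n" using assms(1) by (simp add: ready_def)
  next
    fix j s' assume j: "j < n" "s' x_j 0 = int j" and I: "s' x_cnt 0 = int (P j)"
      and ag: "agree (insert x_j (mods count_cell)) s s'"
    have s': "s' x_n = s x_n" "s' x_lam = s x_lam" "s' a_A = s a_A" "s' a_N = s a_N" "s' a_p = s a_p"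
      by (rule agreeD[OF ag]; simp add: mods_count_cell)+
    have pj: "s a_p (int j) = int (plan_of s j)" "plan_of s j < n" using p[OF j(1)] by (simp_all add: plan_of_def nat_less_iff)
    have A: "s a_A (int (plan_of s j) * int n + int j) = upgraded_entry (plan_of s j) j"
      and N: "s a_N (int (plan_of s j) * int n + int j) = regular_entry (plan_of s j) j"
      using filled_last[of upgraded_entry 0 n "s a_A" "plan_of s j" j] filled_last[of regular_entry 0 n "s a_N" "plan_of s j" j]
        assms(1) pj(2) j(1)
      by (simp_all add: ready_def)
    show "wp g count_cell (\<lambda>s'. s' x_cnt 0 = int (P (Suc j))) s'"
      using j s' A N pj assms(1) g I by (simp add: count_cell_def ready_def P_Suc)
  qed (simp_all add: mods_count_cell)
  then show ?thesis unfolding P_def .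
qed

text \<open>Transfers the certificate from the machine, where rows and columns are integers, to
  plans on natural numbers.\<close>

lemma solved_if_optimal:
  assumes cnt: "s x_cnt 0 = int (card {j\<in>{..<n}. upgraded_entry (plan_of s j) j + s x_lam 0 < regular_entry (plan_of s j) j})"
    and lam: "s x_lam 0 = 2 * \<mu> + 1"
    and Cc: "Cc = (\<lambda>i j. min (upgraded_entry (nat i) (nat j) + s x_lam 0) (regular_entry (nat i) (nat j)))"
    and asg: "assignment {0..<int n} {0..<int n} (int n) (-1)"
    and opt: "assignment.dual_optimal {0..<int n} {0..<int n} Cc (s a_p) u v"
  shows "solved \<mu> s"
proof -
  interpret assignment "{0..<int n}" "{0..<int n}" "int n" "-1" Cc by (rule asg)
  have bij: "bij_betw (s a_p) {0..<int n} {0..<int n}" using opt unfolding dual_optimal_def by blast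
  have p: "0 \<le> s a_p (int j) \<and> s a_p (int j) < int n" if "j < n" for j
    using bij_betw_apply[OF bij, of "int j"] that by simp
  have b: "bij_betw (plan_of s) {..<n} {..<n}"
    using bij_betw_trans[OF bij_betw_trans[OF bij_betw_int bij] bij_betw_nat]
    unfolding comp_def plan_of_def[abs_def] .
  have cost: "(\<Sum>j\<in>{0..<int n}. Cc (q j) j) = (\<Sum>j<n. min (upgraded_entry (nat (q (int j))) j + s x_lam 0) (regular_entry (nat (q (int j))) j))" for q
    using sum.reindex_bij_betw[OF bij_betw_int, of "\<lambda>j. Cc (q j) j" n] by (simp add: Cc)
  have "optimal_at \<mu> (upgraded s) (plan_of s)"
  proof (rule optimal_atI[OF b lam])
    fix q :: "nat \<Rightarrow> nat" assume q: "bij_betw q {..<n} {..<n}"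
    have "bij_betw (\<lambda>j. int (q (nat j))) {0..<int n} {0..<int n}"
      using bij_betw_trans[OF bij_betw_trans[OF bij_betw_nat q] bij_betw_int] unfolding comp_def .
    from dual_optimal_bij_le[OF opt this]
    show "(\<Sum>j\<in>{..<n}. min (upgraded_entry (plan_of s j) j + s x_lam 0) (regular_entry (plan_of s j) j)) \<le>
        (\<Sum>j\<in>{..<n}. min (upgraded_entry (q j) j + s x_lam 0) (regular_entry (q j) j))"
      unfolding cost by (simp add: plan_of_def)
  qed (simp add: upgraded_def)
  moreover have "card (upgraded s) = card {j\<in>{..<n}. upgraded_entry (plan_of s j) j + s x_lam 0 < regular_entry (plan_of s j) j}"
    unfolding upgraded_def by (rule card_image, rule inj_on_subset[of _ "{..<n}"]) (use b in \<open>auto simp: bij_betw_def\<close>)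
  ultimately show ?thesis using p lam cnt unfolding solved_def by simp
qed

lemma search_core:
  assumes rd: "ready s" and lam: "s x_lam 0 = 2 * \<mu> + 1"
  shows "wp g (search_core n) (solved \<mu>) s"
proof -
  have n: "s x_n 0 = int n" using rd by (simp add: ready_def)
  define s1 where "s1 = s(x_lb := (s x_lb)(0 := min 0 (s x_lam 0)))"
  have rd1: "ready s1" using rd by (simp add: s1_def ready_def)
  let ?c = "\<lambda>i j. min (upgraded_entry i j + s x_lam 0) (regular_entry i j)"
  define Cc where "Cc = (\<lambda>i j. ?c (nat i) (nat j))"
  interpret h: hungarian n Cc g by unfold_locales (rule g)
  have "wp g (For n x_i (V x_n) (For n x_j (V x_n) cost_cell)) (\<lambda>s'. filled ?c 0 n n 0 (s' a_C)) s1"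
    using cost_loop[OF rd1] by (simp add: s1_def)
  then have "wp g (For n x_i (V x_n) (For n x_j (V x_n) cost_cell)) (wp g (hungarian_program n)
     (wp g (Assign x_cnt (N 0)) (wp g (For n x_j (V x_n) count_cell) (solved \<mu>)))) s1"
  proof (rule wp_conseq)
    fix s2 assume f: "filled ?c 0 n n 0 (s2 a_C)" and "agree (mods (For n x_i (V x_n) (For n x_j (V x_n) cost_cell))) s1 s2"
    then have ag2: "agree {x_i, x_j, a_C} s1 s2" by (simp add: mods_For mods_cost_cell)
    have s2: "s2 x_n = s1 x_n" "s2 x_lam = s1 x_lam" "s2 a_A = s1 a_A" "s2 a_N = s1 a_N" "s2 x_k = s1 x_k" "s2 x_lb = s1 x_lb"
      by (rule agreeD[OF ag2]; simp)+
    have rd2: "ready s2" using rd1 s2 by (simp add: ready_def)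
    have "wp g (hungarian_program n) (\<lambda>s'. \<exists>u v. h.dual_optimal (s' a_p) u v) s2"
    proof (rule h.hungarian_program)
      show "h.loaded s2" unfolding h.loaded_def
      proof (intro conjI ballI)
        show "s2 x_n 0 = int n" using rd2 by (simp add: ready_def)
        fix i j assume ij: "i \<in> {0..<int n}" "j \<in> {0..<int n}"
        then show "s2 a_C (i * int n + j) = Cc i j"
          using filled_last[OF f, of "nat i" "nat j"] by (simp add: Cc_def nat_less_iff)
      qed
    next
      fix i j assume ij: "i \<in> {0..<int n}" "j \<in> {0..<int n}"
      then show "s2 x_lb 0 \<le> Cc i j"
        using entries_nonneg[of "nat i" "nat j"] by (auto simp: s2 s1_def Cc_def nat_less_iff min_def)
    qed
    then show "wp g (hungarian_program n) (wp g (Assign x_cnt (N 0)) (wp g (For n x_j (V x_n) count_cell) (solved \<mu>))) s2"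
    proof (rule wp_conseq)
      fix s3 assume "\<exists>u v. h.dual_optimal (s3 a_p) u v" and ag3: "agree (mods (hungarian_program n)) s2 s3"
      then obtain u v where opt: "h.dual_optimal (s3 a_p) u v" by blast
      have s3: "s3 x_n = s2 x_n" "s3 x_lam = s2 x_lam" "s3 a_A = s2 a_A" "s3 a_N = s2 a_N" "s3 x_k = s2 x_k"
        by (rule agreeD[OF ag3]; simp add: mods_hungarian_program)+
      define s4 where "s4 = s3(x_cnt := (s3 x_cnt)(0 := 0))"
      have rd4: "ready s4" using rd2 s3 by (simp add: ready_def s4_def)
      have lam4: "s4 x_lam 0 = s x_lam 0" using s3 s2 by (simp add: s4_def s1_def)
      have opt4: "h.dual_optimal (s4 a_p) u v" using opt by (simp add: s4_def)
      have bij: "bij_betw (s4 a_p) {0..<int n} {0..<int n}" using opt4 unfolding h.dual_optimal_def by blast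
      have "wp g (For n x_j (V x_n) count_cell) (\<lambda>s'. s' x_cnt 0 = int (card {j\<in>{..<n}.
         upgraded_entry (plan_of s4 j) j + s4 x_lam 0 < regular_entry (plan_of s4 j) j})) s4"
      proof (rule count_loop[OF rd4])
        fix j assume "j < n"
        then show "0 \<le> s4 a_p (int j) \<and> s4 a_p (int j) < int n" using bij_betw_apply[OF bij, of "int j"] by simp
      qed (simp add: s4_def)
      then have "wp g (For n x_j (V x_n) count_cell) (solved \<mu>) s4"
      proof (rule wp_conseq)
        fix s5 assume cnt: "s5 x_cnt 0 = int (card {j\<in>{..<n}.
           upgraded_entry (plan_of s4 j) j + s4 x_lam 0 < regular_entry (plan_of s4 j) j})"
          and "agree (mods (For n x_j (V x_n) count_cell)) s4 s5"
        then have ag5: "agree {x_j, x_cnt} s4 s5" by (simp add: mods_For mods_count_cell)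
        have s5: "s5 x_lam = s4 x_lam" "s5 a_p = s4 a_p" by (rule agreeD[OF ag5]; simp)+
        have "plan_of s5 = plan_of s4" using s5 by (simp add: plan_of_def[abs_def])
        then show "solved \<mu> s5"
          using cnt s5 lam lam4 opt4 h.assignment_axioms
          by (intro solved_if_optimal[where Cc = Cc and u = u and v = v]) (simp_all add: Cc_def)
      qed
      then show "wp g (Assign x_cnt (N 0)) (wp g (For n x_j (V x_n) count_cell) (solved \<mu>)) s3"
        by (simp add: s4_def)
    qed
  qed
  then show ?thesis unfolding search_core_def wp_Sq s1_def
    by (cases "s x_lam 0 < 0") (simp_all add: min_def)
qed

text \<open>The interval from \<open>x_lo\<close> to \<open>x_hi\<close> always contains
  \<open>\<mu>\<^sub>0\<close> until the count is right, and the bound on its number of integers is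
  halved in every round. At \<open>\<mu>\<^sub>0\<close> itself the count is \<open>k\<close>, so
  the loop stops before the interval gets empty. The premise on \<open>l\<close> counts the integers
  between \<open>- x_H\<close> and \<open>x_H\<close>.\<close>

theorem search_program:
  assumes rd: "ready s" and H: "s x_H 0 = 1 + (\<Sum>i<n. \<Sum>j<n. upgraded_entry i j + regular_entry i j)"
    and l: "2 * s x_H 0 + 1 < 2 ^ l"
  shows "wp g (search_program n l) (\<lambda>s'. ready s' \<and> (\<exists>\<mu>. solved \<mu> s') \<and> card (upgraded s') = k) s"
proof -
  obtain \<mu>\<^sub>0 where \<mu>\<^sub>0: "\<bar>\<mu>\<^sub>0\<bar> \<le> s x_H 0"
    and le: "\<And>\<mu> S p. optimal_at \<mu> S p \<Longrightarrow> \<mu>\<^sub>0 \<le> \<mu> \<Longrightarrow> card S \<le> k"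
    and ge: "\<And>\<mu> S p. optimal_at \<mu> S p \<Longrightarrow> \<mu> \<le> \<mu>\<^sub>0 \<Longrightarrow> k \<le> card S"
    using multiplier_exists[of "s x_H 0"] plan_cost_less unfolding H by blast
  define I where "I m s' \<longleftrightarrow> ready s' \<and> (if s' x_cnt 0 = int k then \<exists>\<mu>. solved \<mu> s'
     else s' x_lo 0 \<le> \<mu>\<^sub>0 \<and> \<mu>\<^sub>0 \<le> s' x_hi 0 \<and> s' x_hi 0 - s' x_lo 0 + 1 < 2 ^ m)" for m and s' :: store
  define s1 where "s1 = s(x_lo := (s x_lo)(0 := - s x_H 0), x_hi := (s x_hi)(0 := s x_H 0), x_cnt := (s x_cnt)(0 := -1))"
  let ?b = "Not (And (Not (Lt (V x_cnt) (V x_k))) (Not (Lt (V x_k) (V x_cnt))))"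
  have "wp g (Wh l ?b (search_body n)) (\<lambda>s'. ready s' \<and> (\<exists>\<mu>. solved \<mu> s') \<and> card (upgraded s') = k) s1"
  proof (rule wp_Wh[where I = I])
    show "I l s1" using rd \<mu>\<^sub>0 l by (auto simp: I_def s1_def ready_def)
  next
    fix m s' assume "I m s'"
    show "okb g s' ?b" by simp
  next
    fix m s' assume I: "I m s'" and "\<not> evb s' ?b"
    then have "s' x_cnt 0 = int k" using I by (auto simp: I_def ready_def)
    then show "ready s' \<and> (\<exists>\<mu>. solved \<mu> s') \<and> card (upgraded s') = k"
      using I unfolding I_def solved_def by auto
  next
    fix m s' assume I: "I m s'" and "evb s' ?b"
    then have "s' x_cnt 0 \<noteq> int k" by (auto simp: I_def ready_def)
    then have rd': "ready s'" and lo: "s' x_lo 0 \<le> \<mu>\<^sub>0" and hi: "\<mu>\<^sub>0 \<le> s' x_hi 0"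
      and gap: "s' x_hi 0 - s' x_lo 0 + 1 < 2 ^ m" using I unfolding I_def by simp_all
    \<comment> \<open>The interval contains at least \<open>\<mu>\<^sub>0\<close>, which rules out
      \<open>m = 0\<close>.\<close>
    obtain m' where m: "m = Suc m'" using lo hi gap by (cases m) auto
    define \<mu> where "\<mu> = (s' x_lo 0 + s' x_hi 0) div 2"
    define s2 where "s2 = s'(x_mid := (s' x_mid)(0 := \<mu>), x_lam := (s' x_lam)(0 := \<mu> + \<mu> + 1))"
    have rd2: "ready s2" using rd' by (simp add: s2_def ready_def)
    have "wp g (search_core n) (solved \<mu>) s2" by (rule search_core[OF rd2]) (simp add: s2_def)
    then have "wp g (search_core n) (wp g (If (Lt (V x_k) (V x_cnt)) (Assign x_lo (Plus (V x_mid) (N 1)))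
         (If (Lt (V x_cnt) (V x_k)) (Assign x_hi (Minus (V x_mid) (N 1))) Nop)) (I m')) s2"
    proof (rule wp_conseq)
      fix s3 assume sol: "solved \<mu> s3" and ag: "agree (mods (search_core n)) s2 s3"
      have s3: "s3 x_n = s2 x_n" "s3 x_k = s2 x_k" "s3 a_A = s2 a_A" "s3 a_N = s2 a_N" "s3 x_mid = s2 x_mid"
          "s3 x_lo = s2 x_lo" "s3 x_hi = s2 x_hi"
        by (rule agreeD[OF ag]; simp add: mods_search_core mods_hungarian_program)+
      have rd3: "ready s3" using rd2 s3 by (simp add: ready_def)
      have vals: "s3 x_mid 0 = \<mu>" "s3 x_lo 0 = s' x_lo 0" "s3 x_hi 0 = s' x_hi 0" "s3 x_k 0 = int k"
        using s3 rd2 by (simp_all add: s2_def ready_def)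
      have opt: "optimal_at \<mu> (upgraded s3) (plan_of s3)" and cnt: "s3 x_cnt 0 = int (card (upgraded s3))"
        using sol unfolding solved_def by simp_all
      consider (more) "k < card (upgraded s3)" | (less) "card (upgraded s3) < k" | (eq) "card (upgraded s3) = k" by linarith
      then show "wp g (If (Lt (V x_k) (V x_cnt)) (Assign x_lo (Plus (V x_mid) (N 1)))
         (If (Lt (V x_cnt) (V x_k)) (Assign x_hi (Minus (V x_mid) (N 1))) Nop)) (I m') s3"
      proof cases
        \<comment> \<open>Too many upgrades: the price of an upgrade was too low.\<close>
        case more
        then have "\<mu> < \<mu>\<^sub>0" using le[OF opt] by fastforce
        moreover have "s' x_hi 0 - \<mu> < 2 ^ m'" using gap unfolding m \<mu>_def by simp
        ultimately show ?thesis using more vals cnt rd3 hi by (simp add: I_def ready_def)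
      next
        case less
        then have "\<mu>\<^sub>0 < \<mu>" using ge[OF opt] by fastforce
        moreover have "\<mu> - s' x_lo 0 < 2 ^ m'" using gap unfolding m \<mu>_def by simp
        ultimately show ?thesis using less vals cnt rd3 lo by (simp add: I_def ready_def)
      next
        case eq
        then show ?thesis using vals cnt rd3 sol by (auto simp: I_def)
      qed
    qed
    then have "wp g (search_body n) (I m') s'"
      unfolding search_body_def wp_Sq by (simp add: s2_def \<mu>_def)
    then show "\<exists>m'. m = Suc m' \<and> wp g (search_body n) (I m') s'" using m by blast
  qed
  then show ?thesis unfolding search_program_def wp_Sq by (simp add: s1_def fun_upd_twist)
qed

definition outputs_optimum :: "store \<Rightarrow> bool" where
  "outputs_optimum s \<longleftrightarrow> (\<exists>p S \<mu>. optimal_at \<mu> S p \<and> card S = k \<and>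
     filled (\<lambda>i j. of_bool (p j = i \<and> i \<in> S)) 0 n n 0 (s 0) \<and>
     filled (\<lambda>i j. of_bool (p j = i \<and> i \<notin> S)) (int n * int n) n n 0 (s 0))"

lemma output_solution:
  assumes rd: "ready s" and sol: "solved \<mu> s" and card: "card (upgraded s) = k"
  shows "wp g (output_program n) outputs_optimum s"
proof -
  let ?X = "\<lambda>i j. of_bool (s a_p (int j) = int i \<and> upgraded_entry i j + s x_lam 0 < regular_entry i j)"
  let ?Y = "\<lambda>i j. of_bool (s a_p (int j) = int i \<and> \<not> upgraded_entry i j + s x_lam 0 < regular_entry i j)"
  have opt: "optimal_at \<mu> (upgraded s) (plan_of s)" and nn: "\<And>j. j < n \<Longrightarrow> 0 \<le> s a_p (int j)"
    using sol unfolding solved_def by simp_all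
  then have inj: "inj_on (plan_of s) {..<n}" unfolding optimal_at_def bij_betw_def by blast
  have p: "s a_p (int j) = int i \<longleftrightarrow> plan_of s j = i" if "j < n" for i j
    using nn[OF that] unfolding plan_of_def by auto
  have mem: "plan_of s j \<in> upgraded s \<longleftrightarrow> upgraded_entry (plan_of s j) j + s x_lam 0 < regular_entry (plan_of s j) j"
    if "j < n" for j
    using inj that unfolding upgraded_def by (auto simp: inj_on_def)
  have X: "?X i j = of_bool (plan_of s j = i \<and> i \<in> upgraded s)" if "j < n" for i j
    using p[OF that, of i] mem[OF that] by auto
  have Y: "?Y i j = of_bool (plan_of s j = i \<and> i \<notin> upgraded s)" if "j < n" for i j
    using p[OF that, of i] mem[OF that] by auto
  have "wp g (output_program n) (\<lambda>s'. filled ?X 0 n n 0 (s' 0) \<and> filled ?Y (int n * int n) n n 0 (s' 0)) s"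
    by (rule output_program[where vA = upgraded_entry and vN = regular_entry])
       (use rd g in \<open>simp_all add: ready_def\<close>)
  then show ?thesis
  proof (rule wp_mono)
    fix s' :: store assume *: "filled ?X 0 n n 0 (s' 0) \<and> filled ?Y (int n * int n) n n 0 (s' 0)"
    have "filled ?X 0 n n 0 (s' 0) = filled (\<lambda>i j. of_bool (plan_of s j = i \<and> i \<in> upgraded s)) 0 n n 0 (s' 0)"
      by (rule filled_cong) (rule X)
    moreover have "filled ?Y (int n * int n) n n 0 (s' 0) =
        filled (\<lambda>i j. of_bool (plan_of s j = i \<and> i \<notin> upgraded s)) (int n * int n) n n 0 (s' 0)"
      by (rule filled_cong) (rule Y)
    ultimately show "outputs_optimum s'" using * opt card unfolding outputs_optimum_def by blast
  qed
qed

lemma search_output: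
  assumes "ready s" "s x_H 0 = 1 + (\<Sum>i<n. \<Sum>j<n. upgraded_entry i j + regular_entry i j)" "2 * s x_H 0 + 1 < 2 ^ l"
  shows "wp g (search_program n l) (wp g (output_program n) outputs_optimum) s"
  by (rule wp_mono[OF search_program[OF assms]]) (use output_solution in blast)

end

section \<open>The complete program\<close>

context perturbed_data
begin

text \<open>With \<open>E = 0\<close> each term of a plan cost is a cost times a demand, so scaling
  the data by \<open>P\<close> scales all plan costs by \<open>P * P\<close> and preserves
  optimality.\<close>

lemma optimal_at_vertex:
  fixes b c :: "'i \<Rightarrow> real" and d :: "'j \<Rightarrow> real" and P :: real
  assumes inst: "map_upgrades_instance I J b c d k" and P: "0 < P"
    and B: "\<And>i. i \<in> I \<Longrightarrow> of_int (B i) = P * b i" and C: "\<And>i. i \<in> I \<Longrightarrow> of_int (C i) = P * c i"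
    and D: "\<And>j. j \<in> J \<Longrightarrow> of_int (D j) = P * d j"
    and opt: "optimal_at \<mu> S p" "card S = k"
  shows "optimal_integral_vertex I J b c d k (plan_point J S p)"
proof -
  interpret r: upgrade_problem I J b c d k by unfold_locales (rule inst)
  have scale: "of_int (plain.plan_cost S p) = P * P * r.plan_cost S p" if "bij_betw p J I" for S p
  proof -
    have p: "p j \<in> I" if "j \<in> J" for j using \<open>bij_betw p J I\<close> that by (auto simp: bij_betw_def)
    show ?thesis unfolding plain.plan_cost_def r.plan_cost_def
      by (auto simp: sum_distrib_left B[OF p] C[OF p] D intro!: sum.cong)
  qed
  have S: "S \<subseteq> I" and p: "bij_betw p J I" using opt(1) unfolding optimal_at_def by simp_all
  show ?thesis
  proof (rule r.plan_point_optimal[OF S opt(2) p])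
    fix S' p' assume S': "S' \<subseteq> I" "card S' = k" "bij_betw p' J I"
    have "plain.plan_cost S p \<le> plain.plan_cost S' p'"
      using optimal_at_fixed_card[OF opt(1) S'(1) _ S'(3)] S'(2) opt(2) by simp
    then have "real_of_int (plain.plan_cost S p) \<le> real_of_int (plain.plan_cost S' p')" by simp
    then have "P * P * r.plan_cost S p \<le> P * P * r.plan_cost S' p'" unfolding scale[OF p] scale[OF S'(3)] .
    then show "r.plan_cost S p \<le> r.plan_cost S' p'" using P by simp
  qed
qed

end

section \<open>Input encoding and polynomial bounds\<close>

lemma nth_concat_pairs:
  "t < length qs \<Longrightarrow> concat (map (\<lambda>q. [f q, h q]) qs) ! (2 * t) = f (qs ! t) \<and>
     concat (map (\<lambda>q. [f q, h q]) qs) ! Suc (2 * t) = h (qs ! t)"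
proof (induction qs arbitrary: t)
  case (Cons q qs)
  then show ?case by (cases t) auto
qed simp

lemma length_concat_pairs: "length (concat (map (\<lambda>q. [f q, h q]) qs)) = 2 * length qs"
  by (induction qs) auto

lemma load_encode_input:
  fixes k :: nat and bs cs ds :: "rat list"
  assumes "length cs = length bs" "length ds = length bs"
  defines "m \<equiv> load (encode_input (k, bs, cs, ds))"
  shows "m 0 = int (length bs)" "m 1 = int k"
    "\<And>t. t < 3 * length bs \<Longrightarrow> m (2 + 2 * int t) = fst (quotient_of ((bs @ cs @ ds) ! t))"
    "\<And>t. t < 3 * length bs \<Longrightarrow> m (3 + 2 * int t) = snd (quotient_of ((bs @ cs @ ds) ! t))"
proof -
  let ?qs = "bs @ cs @ ds"
  let ?c = "concat (map (\<lambda>q. [fst (quotient_of q), snd (quotient_of q)]) ?qs)"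
  have enc: "encode_input (k, bs, cs, ds) = int (length bs) # int k # ?c" by simp
  have len: "length ?qs = 3 * length bs" using assms by simp
  have lenc: "length ?c = 2 * (3 * length bs)" unfolding length_concat_pairs len by simp
  show "m 0 = int (length bs)" "m 1 = int k" unfolding m_def load_def enc by simp_all
  fix t assume t: "t < 3 * length bs"
  have n: "nat (2 + 2 * int t) = Suc (Suc (2 * t))" "nat (3 + 2 * int t) = Suc (Suc (Suc (2 * t)))" by simp_all
  have "t < length ?qs" using t len by simp
  note c = nth_concat_pairs[OF this, of "\<lambda>q. fst (quotient_of q)" "\<lambda>q. snd (quotient_of q)"]
  show "m (2 + 2 * int t) = fst (quotient_of (?qs ! t))"
    unfolding m_def load_def enc n using c t lenc by (simp del: concat.simps map_append append_assoc)
  show "m (3 + 2 * int t) = snd (quotient_of (?qs ! t))"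
    unfolding m_def load_def enc n using c t lenc by (simp del: concat.simps map_append append_assoc)
qed

lemma int_size_load: "int_size (load xs a) \<le> 1 + (\<Sum>v\<leftarrow>xs. int_size v)"
proof (cases "0 \<le> a \<and> a < int (length xs)")
  case True
  then have "load xs a \<in> set xs" unfolding load_def by (simp add: nat_less_iff)
  then have "int_size (load xs a) \<le> (\<Sum>v\<leftarrow>xs. int_size v)" by (intro member_le_sum_list) auto
  then show ?thesis by simp
next
  case False
  then have "load xs a = 0" unfolding load_def by (simp only: if_False)
  moreover have "int_size 0 = 1" by (simp add: int_size_def floorlog_def)
  ultimately show ?thesis by simp
qed

lemma length_le_sum_int_size: "length xs \<le> (\<Sum>v\<leftarrow>xs. int_size v)"
proof (induction xs)
  case (Cons a xs)
  then show ?case using int_size_pos[of a] by simp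
qed simp

lemma scaled_numerator:
  fixes qs :: "rat list"
  assumes "t < m" "m = length qs"
  shows "real_of_int (fst (quotient_of (qs ! t)) * (\<Prod>r\<in>{..<m} - {t}. snd (quotient_of (qs ! r)))) =
    (\<Prod>r<m. real_of_int (snd (quotient_of (qs ! r)))) * of_rat (qs ! t)"
proof -
  have pos: "0 < snd (quotient_of (qs ! t))" by (rule quotient_of_denom_pos')
  have q: "qs ! t = of_int (fst (quotient_of (qs ! t))) / of_int (snd (quotient_of (qs ! t)))"
    by (rule quotient_of_div) simp
  have "real_of_int (fst (quotient_of (qs ! t))) = real_of_int (snd (quotient_of (qs ! t))) * of_rat (qs ! t)"
    by (subst (3) q) (use pos in \<open>simp add: of_rat_divide\<close>)
  moreover have "(\<Prod>r<m. real_of_int (snd (quotient_of (qs ! r)))) =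
      real_of_int (snd (quotient_of (qs ! t))) * (\<Prod>r\<in>{..<m} - {t}. real_of_int (snd (quotient_of (qs ! r))))"
    by (rule prod.remove) (use assms in auto)
  ultimately show ?thesis by simp
qed

text \<open>Bounds are composed by closure properties, so that no explicit running time polynomial
  has to be written down.\<close>

definition poly_bounded :: "(nat \<Rightarrow> nat) \<Rightarrow> bool" where
  "poly_bounded f \<longleftrightarrow> (\<exists>q :: nat poly. \<forall>x. f x \<le> poly q x)"

lemma poly_bounded_const: "poly_bounded (\<lambda>_. a)"
  unfolding poly_bounded_def by (rule exI[of _ "[:a:]"]) simp

lemma poly_bounded_id: "poly_bounded (\<lambda>x. x)"
  unfolding poly_bounded_def by (rule exI[of _ "[:0, 1:]"]) simp

lemma poly_bounded_add: "poly_bounded f \<Longrightarrow> poly_bounded h \<Longrightarrow> poly_bounded (\<lambda>x. f x + h x)"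
  unfolding poly_bounded_def by (metis add_mono poly_add)

lemma poly_bounded_mult: "poly_bounded f \<Longrightarrow> poly_bounded h \<Longrightarrow> poly_bounded (\<lambda>x. f x * h x)"
  unfolding poly_bounded_def by (metis mult_le_mono poly_mult)

lemma poly_bounded_Suc: "poly_bounded f \<Longrightarrow> poly_bounded (\<lambda>x. Suc (f x))"
  using poly_bounded_add[OF poly_bounded_const[of 1]] by simp

lemmas poly_bounded_intros =
  poly_bounded_const poly_bounded_id poly_bounded_add poly_bounded_mult poly_bounded_Suc

section \<open>The assembled machine program\<close>

text \<open>The three phases are kept apart because the size bound on factors differs: the matrix
  phase multiplies scaled numbers, which may be longer than the input.\<close>

definition prepare_program :: "nat \<Rightarrow> cm" where
  "prepare_program n = Sq (scale_program n) (rank_program n)"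

definition solve_program :: "nat \<Rightarrow> nat \<Rightarrow> cm" where
  "solve_program n l = Sq (search_program n l) (output_program n)"

definition optimizer :: com where
  "optimizer = Seq (compile (prepare_program 0)) (Seq (compile (matrix_program 0)) (compile (solve_program 0 0)))"

lemma compile_For: "compile (For n v hi c) =
    Seq (compile (Assign v (N 0))) (While (comp_bx (Lt (V v) hi)) (Seq (compile c) (compile (Assign v (Plus (V v) (N 1))))))"
  by (simp add: For_def)

text \<open>One machine program has to serve all instances; the ghost bounds can be chosen
  afterwards for each instance.\<close>

lemma compile_ghost:
  "compile (prepare_program n) = compile (prepare_program 0)"
  "compile (matrix_program n) = compile (matrix_program 0)"
  "compile (solve_program n l) = compile (solve_program 0 0)"
  by (simp_all only: prepare_program_def scale_program_def scale_row_def rank_program_def rank_row_def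
      matrix_program_def solve_program_def search_program_def search_body_def search_core_def
      hungarian_program_def stage_def tree_loop_def tree_body_def tree_scan_def scan_row_def tree_update_def augment_def augment_body_def
      output_program_def compile_For compile.simps)

lemma fields_For: "fields_cm (For n v hi c) \<longleftrightarrow> v < 64 \<and> fields_ex hi \<and> fields_cm c"
  by (auto simp: For_def)

lemma fields_programs:
  "fields_cm (prepare_program n)" "fields_cm (matrix_program n)" "fields_cm (solve_program n l)"
  by (simp_all add: prepare_program_def scale_program_def scale_row_def scale_cell_def rank_program_def
      rank_row_def rank_cell_def matrix_program_def matrix_cell_def Let_def solve_program_def
      search_program_def search_body_def search_core_def cost_cell_def count_cell_def
      hungarian_program_def stage_def tree_loop_def tree_body_def tree_scan_def scan_row_def scan_cell_def
      tree_update_def update_cell_def augment_def augment_body_def output_program_def output_cell_def fields_For)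

text \<open>The step count itself serves as \<open>f\<close>: it is polynomial and monotone in
  \<open>n\<close>, so \<open>n\<close> may be replaced by the input length.\<close>

lemma steps_prepare_program:
  obtains f where "poly_bounded f" "\<And>n L. n \<le> L \<Longrightarrow> steps (prepare_program n) \<le> f L"
proof
  show "poly_bounded (\<lambda>n. steps (prepare_program n))"
    by (simp only: prepare_program_def scale_program_def scale_row_def rank_program_def rank_row_def
      steps.simps steps_For) (intro poly_bounded_intros)
  show "steps (prepare_program n) \<le> steps (prepare_program L)" if "n \<le> L" for n L
    by (simp only: prepare_program_def scale_program_def scale_row_def rank_program_def rank_row_def
      steps.simps steps_For) (intro add_mono mult_le_mono Suc_le_mono[THEN iffD2] that order_refl)
qed

lemma steps_matrix_program:
  obtains f where "poly_bounded f" "\<And>n L. n \<le> L \<Longrightarrow> steps (matrix_program n) \<le> f L"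
proof
  show "poly_bounded (\<lambda>n. steps (matrix_program n))"
    by (simp only: matrix_program_def steps.simps steps_For) (intro poly_bounded_intros)
  show "steps (matrix_program n) \<le> steps (matrix_program L)" if "n \<le> L" for n L
    by (simp only: matrix_program_def steps.simps steps_For)
       (intro add_mono mult_le_mono Suc_le_mono[THEN iffD2] that order_refl)
qed

text \<open>The number \<open>l\<close> of bisection rounds depends on the size of the numbers and
  not on \<open>n\<close> alone; it is kept apart and enters linearly.\<close>

lemma steps_solve_program:
  obtains f f' where "poly_bounded f" "poly_bounded f'" "\<And>n l L. n \<le> L \<Longrightarrow> steps (solve_program n l) \<le> f L + l * f' L"
proof
  define f' where "f' n = 1 + steps (search_body n)" for n
  have f'_bounded: "poly_bounded f'"
    unfolding f'_def[abs_def] by (simp only: search_body_def search_core_def hungarian_program_def stage_def tree_loop_def tree_body_def tree_scan_def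
      scan_row_def tree_update_def augment_def augment_body_def steps.simps steps_For) (intro poly_bounded_intros)
  have f'_mono: "f' n \<le> f' L" if "n \<le> L" for n L
    unfolding f'_def by (simp only: search_body_def search_core_def hungarian_program_def stage_def tree_loop_def tree_body_def tree_scan_def
      scan_row_def tree_update_def augment_def augment_body_def steps.simps steps_For)
      (intro add_mono mult_le_mono Suc_le_mono[THEN iffD2] that order_refl)
  have o_bounded: "poly_bounded (\<lambda>n. steps (output_program n))"
    by (simp only: output_program_def steps.simps steps_For) (intro poly_bounded_intros)
  have o_mono: "steps (output_program n) \<le> steps (output_program L)" if "n \<le> L" for n L
    by (simp only: output_program_def steps.simps steps_For)
       (intro add_mono mult_le_mono Suc_le_mono[THEN iffD2] that order_refl)
  show "poly_bounded (\<lambda>n. 3 + f' n + steps (output_program n))"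
    by (intro poly_bounded_intros f'_bounded o_bounded)
  show "poly_bounded f'" by (rule f'_bounded)
  show "steps (solve_program n l) \<le> 3 + f' L + steps (output_program L) + l * f' L" if "n \<le> L" for n l L
  proof -
    have "steps (solve_program n l) = 3 + f' n + steps (output_program n) + l * f' n"
      by (simp add: solve_program_def search_program_def f'_def)
    also have "\<dots> \<le> 3 + f' L + steps (output_program L) + l * f' L"
      using f'_mono[OF that] o_mono[OF that] by (intro add_mono mult_le_mono) auto
    finally show ?thesis .
  qed
qed

lemma represents_memory: "represents (\<lambda>f i. m (addr f i)) m"
  by (simp add: represents_def)

text \<open>Each phase starts from the sizes left by the one before: \<open>L\<close> covers the
  input, \<open>Z1\<close> the scaled numbers and \<open>Z2\<close> the matrix entries. The factor
  bound is \<open>L\<close>, then \<open>Z1\<close>, then \<open>L\<close> again, since the last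
  phase multiplies only by \<open>n\<close>. The 8 in \<open>L\<close> is the size of the constant
  64 in addresses.\<close>

lemma optimizer_correct:
  assumes valid: "(k, bs, cs, ds) \<in> valid_input"
    and L: "L = 8 + (\<Sum>v\<leftarrow>encode_input (k, bs, cs, ds). int_size v)"
    and W: "weight optimizer \<le> W"
    and f1: "\<And>n. n \<le> L \<Longrightarrow> steps (prepare_program n) \<le> f1 L"
    and f2: "\<And>n. n \<le> L \<Longrightarrow> steps (matrix_program n) \<le> f2 L"
    and f3: "\<And>n l. n \<le> L \<Longrightarrow> steps (solve_program n l) \<le> f3 L + l * f4 L"
    and Z1: "Z1 = L + f1 L * (L * W)" and Z2: "Z2 = Z1 + f2 L * (Z1 * W)"
    and T3: "T3 = f3 L + Suc Z2 * f4 L"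
  shows "\<exists>t m. exec optimizer (load (encode_input (k, bs, cs, ds))) t m \<and>
    t \<le> f1 L * (2 * W * Z1) + f2 L * (2 * W * Z2) + T3 * (2 * W * (Z2 + T3 * (L * W))) \<and>
    outputs_optimal_integral_vertex (k, bs, cs, ds) m"
proof -
  define n where "n = length bs"
  define qs where "qs = bs @ cs @ ds"
  define m0 where "m0 = load (encode_input (k, bs, cs, ds))"
  let ?b = "real_of_list bs" and ?c = "real_of_list cs" and ?d = "real_of_list ds"
  have len: "length cs = length bs" "length ds = length bs"
    and inst: "map_upgrades_instance {..<n} {..<n} ?b ?c ?d k"
    using valid unfolding valid_input_def n_def by auto
  have len_qs: "length qs = 3 * n" using len by (simp add: qs_def n_def)
  have num: "m0 (2 + 2 * int t) = fst (quotient_of (qs ! t))"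
    and den: "m0 (3 + 2 * int t) = snd (quotient_of (qs ! t))" if "t < 3 * n" for t
    using load_encode_input(3,4)[OF len, of t] that unfolding m0_def n_def qs_def by blast+
  have m0n: "m0 0 = int n" and m0k: "m0 1 = int k"
    using load_encode_input(1,2)[OF len] unfolding m0_def n_def by blast+
  have size0: "int_size (m0 a) \<le> L" for a
    using int_size_load[of "encode_input (k, bs, cs, ds)" a] unfolding L m0_def by linarith
  have "length (encode_input (k, bs, cs, ds)) = 2 + 2 * length (bs @ cs @ ds)"
    unfolding encode_input.simps length_append length_concat_pairs by simp
  then have "length bs \<le> length (encode_input (k, bs, cs, ds))" by (simp only:) simp
  also have "\<dots> \<le> (\<Sum>v\<leftarrow>encode_input (k, bs, cs, ds). int_size v)" by (rule length_le_sum_int_size)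
  finally have n_L: "n \<le> L" unfolding L n_def by (rule trans_le_add2)
  have L8: "8 \<le> L" unfolding L by simp
  have W1: "weight (compile (prepare_program n)) \<le> W" "weight (compile (matrix_program n)) \<le> W"
    "weight (compile (solve_program n l)) \<le> W" for l
    using W unfolding optimizer_def compile_ghost[of n] compile_ghost(3)[of n l] by simp_all
  define s0 where "s0 = (\<lambda>f i. m0 (addr f i))"
  have s00: "s0 0 = m0" by (simp add: s0_def addr_def)

  let ?num = "\<lambda>t. m0 (2 + 2 * int t) * (\<Prod>r\<in>{..<3 * n} - {t}. m0 (3 + 2 * int r))"
  define Q1 where "Q1 s \<longleftrightarrow> s x_n 0 = int n \<and> s x_k 0 = int k \<and> (\<forall>t<3 * n. s a_num (int t) = ?num t) \<and>
    s x_K 0 = 4 ^ Suc n \<and> (\<forall>i<n. s a_E (int i) = 4 ^ rank_of n (s a_num) i)" for s :: store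
  have "wp L (scale_program n) (\<lambda>s'. s' x_n 0 = int n \<and> s' x_k 0 = int k \<and> (\<forall>t<3 * n. s' a_num (int t) = ?num t)) s0"
    using scale_program[of s0 n L] size0 m0n m0k unfolding s00 by simp
  then have "wp L (prepare_program n) Q1 s0"
    unfolding prepare_program_def wp_Sq
  proof (rule wp_mono)
    fix s assume s: "s x_n 0 = int n \<and> s x_k 0 = int k \<and> (\<forall>t<3 * n. s a_num (int t) = ?num t)"
    then have "wp L (rank_program n) (\<lambda>s'. s' x_K 0 = 4 ^ Suc n \<and> (\<forall>i<n. s' a_E (int i) = 4 ^ rank_of n (s a_num) i)) s"
      by (intro rank_program) simp
    then show "wp L (rank_program n) Q1 s"
    proof (rule wp_conseq)
      fix s' assume e: "s' x_K 0 = 4 ^ Suc n \<and> (\<forall>i<n. s' a_E (int i) = 4 ^ rank_of n (s a_num) i)"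
        and ag: "agree (mods (rank_program n)) s s'"
      have "s' x_n = s x_n" "s' x_k = s x_k" "s' a_num = s a_num" by (rule agreeD[OF ag]; simp add: mods_rank_program)+
      then show "Q1 s'" using s e unfolding Q1_def by simp
    qed
  qed
  from wp_sound[OF this represents_memory[of m0, folded s0_def] size0 L8 fields_programs(1) W1(1)]
  obtain t1 m1 s1 where 1: "exec (compile (prepare_program n)) m0 t1 m1" "represents s1 m1" "Q1 s1"
      "\<And>a. int_size (m1 a) \<le> L + steps (prepare_program n) * (L * W)"
      "t1 \<le> steps (prepare_program n) * (2 * W * (L + steps (prepare_program n) * (L * W)))" by blast
  have st1: "steps (prepare_program n) * (L * W) \<le> f1 L * (L * W)" using f1[OF n_L] by (rule mult_le_mono1)
  have size1: "int_size (m1 a) \<le> Z1" for a using 1(4)[of a] st1 unfolding Z1 by linarith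
  have t1: "t1 \<le> f1 L * (2 * W * Z1)"
  proof -
    have "steps (prepare_program n) * (2 * W * (L + steps (prepare_program n) * (L * W))) \<le> f1 L * (2 * W * Z1)"
      unfolding Z1 using f1[OF n_L] st1 by (intro mult_le_mono add_mono) auto
    then show ?thesis using 1(5) by linarith
  qed
  have L_Z1: "L \<le> Z1" unfolding Z1 by simp
  have cell1: "s1 f i = m1 (addr f i)" if "f < 64" "0 \<le> i" for f i
    using 1(2) that unfolding represents_def by simp

  let ?B = "\<lambda>i. s1 a_num (int i)" and ?C = "\<lambda>i. s1 a_num (int (n + i))" and ?D = "\<lambda>j. s1 a_num (int (2 * n + j))"
  let ?rank = "rank_of n (s1 a_num)"
  \<comment> \<open>The product of all denominators, by which the whole input has been
    scaled.\<close>
  define P where "P = (\<Prod>r<3 * n. real_of_int (snd (quotient_of (qs ! r))))"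
  have P: "0 < P" unfolding P_def by (intro prod_pos) (simp add: quotient_of_denom_pos')
  have val: "real_of_int (s1 a_num (int t)) = P * of_rat (qs ! t)" if "t < 3 * n" for t
  proof -
    have "s1 a_num (int t) = ?num t" using 1(3) that unfolding Q1_def by blast
    also have "\<dots> = fst (quotient_of (qs ! t)) * (\<Prod>r\<in>{..<3 * n} - {t}. snd (quotient_of (qs ! r)))"
      using num den that by simp
    finally show ?thesis using scaled_numerator[OF that len_qs[symmetric]] unfolding P_def by simp
  qed
  have B: "real_of_int (?B i) = P * ?b i" and C: "real_of_int (?C i) = P * ?c i" and D: "real_of_int (?D i) = P * ?d i"
    if "i < n" for i
    using val[of i] val[of "n + i"] val[of "2 * n + i"] that len
    unfolding qs_def real_of_list_def n_def by (simp_all add: nth_append)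
  interpret search n ?B ?C ?D ?rank k L
  proof
    show "int_size (int n) \<le> L" using size0[of 0] m0n by simp
    show "inj_on ?rank {..<n}" by (rule rank_of_inj)
    show "k \<le> card {..<n}" using inst by (simp add: map_upgrades_instance_def)
  next
    fix i assume i: "i \<in> {..<n}"
    then have bc: "0 \<le> ?b i" "?b i \<le> ?c i" using inst unfolding map_upgrades_instance_def by auto
    have "0 \<le> real_of_int (?B i)" using B[of i] bc i P by simp
    then show "0 \<le> ?B i" by simp
    have "real_of_int (?B i) \<le> real_of_int (?C i)" using B[of i] C[of i] bc i P by simp
    then show "?B i \<le> ?C i" by simp
    show "?rank i < card {..<n}" using rank_of_less i by simp
  next
    fix j assume j: "j \<in> {..<n}"
    then have "0 \<le> ?d j" using inst unfolding map_upgrades_instance_def by auto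
    then have "0 \<le> real_of_int (?D j)" using D[of j] j P by simp
    then show "0 \<le> ?D j" by simp
  next
    fix i i' assume "i \<in> {..<n}" "i' \<in> {..<n}" "?B i \<le> ?B i'" "?C i' \<le> ?C i"
    then show "?rank i \<le> ?rank i' \<or> ?B i = ?B i' \<and> ?C i = ?C i'" using rank_of_nested[of i n i' "s1 a_num"] by simp
  qed simp_all

  define Q2 where "Q2 s \<longleftrightarrow> ready s \<and> s x_H 0 = 1 + (\<Sum>i<n. \<Sum>j<n. upgraded_entry i j + regular_entry i j)" for s
  define A1 where "A1 i j = 2 * (s1 x_K 0 * ?B i * ?D j + s1 a_E (int i))" for i j
  define N1 where "N1 i j = 2 * (s1 x_K 0 * ?C i * ?D j)" for i j
  have AN: "A1 i j = upgraded_entry i j" "N1 i j = regular_entry i j" if "i < n" for i j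
    using 1(3) that unfolding Q1_def A1_def N1_def upgraded_entry_def regular_entry_def by simp_all
  have "wp Z1 (matrix_program n) (\<lambda>s'. filled A1 0 n n 0 (s' a_A) \<and> filled N1 0 n n 0 (s' a_N) \<and>
    s' x_H 0 = 1 + (\<Sum>i<n. \<Sum>j<n. A1 i j + N1 i j)) s1"
  proof (rule matrix_program)
    show "s1 x_n 0 = int n" using 1(3) unfolding Q1_def by blast
    show "int_size (s1 a_num i) \<le> Z1" if "0 \<le> i" for i using cell1[of a_num i] that size1 by simp
    show "int_size (int n) \<le> Z1" using size0[of 0] m0n L_Z1 by simp
  qed (simp_all add: A1_def N1_def)
  then have "wp Z1 (matrix_program n) Q2 s1"
  proof (rule wp_conseq)
    fix s assume *: "filled A1 0 n n 0 (s a_A) \<and> filled N1 0 n n 0 (s a_N) \<and>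
        s x_H 0 = 1 + (\<Sum>i<n. \<Sum>j<n. A1 i j + N1 i j)"
      and ag: "agree (mods (matrix_program n)) s1 s"
    have s: "s x_n = s1 x_n" "s x_k = s1 x_k" by (rule agreeD[OF ag]; simp add: mods_matrix_program)+
    have "filled upgraded_entry 0 n n 0 (s a_A)" "filled regular_entry 0 n n 0 (s a_N)"
      using * AN unfolding filled_def by simp_all
    moreover have "(\<Sum>i<n. \<Sum>j<n. A1 i j + N1 i j) = (\<Sum>i<n. \<Sum>j<n. upgraded_entry i j + regular_entry i j)"
      by (intro sum.cong refl) (simp add: AN)
    ultimately show "Q2 s" using * s 1(3) unfolding Q2_def Q1_def ready_def by simp
  qed
  from wp_sound[OF this 1(2) size1 order_trans[OF L8 L_Z1] fields_programs(2) W1(2)]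
  obtain t2 m2 s2 where 2: "exec (compile (matrix_program n)) m1 t2 m2" "represents s2 m2" "Q2 s2"
      "\<And>a. int_size (m2 a) \<le> Z1 + steps (matrix_program n) * (Z1 * W)"
      "t2 \<le> steps (matrix_program n) * (2 * W * (Z1 + steps (matrix_program n) * (Z1 * W)))" by blast
  have st2: "steps (matrix_program n) * (Z1 * W) \<le> f2 L * (Z1 * W)" using f2[OF n_L] by (rule mult_le_mono1)
  have size2: "int_size (m2 a) \<le> Z2" for a using 2(4)[of a] st2 unfolding Z2 by linarith
  have t2: "t2 \<le> f2 L * (2 * W * Z2)"
  proof -
    have "steps (matrix_program n) * (2 * W * (Z1 + steps (matrix_program n) * (Z1 * W))) \<le> f2 L * (2 * W * Z2)"
      unfolding Z2 using f2[OF n_L] st2 by (intro mult_le_mono add_mono) auto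
    then show ?thesis using 2(5) by linarith
  qed

  have "s2 x_H 0 = m2 (addr x_H 0)" using 2(2) unfolding represents_def by simp
  \<comment> \<open>The bit length of \<open>x_H\<close> bounds the number of halvings, so the
    bisection takes polynomially many rounds.\<close>
  then have "int_size (s2 x_H 0) \<le> Suc Z2" using size2[of "addr x_H 0"] by simp
  then have "\<bar>s2 x_H 0\<bar> < 2 ^ Z2" unfolding int_size_le_iff .
  then have l: "2 * s2 x_H 0 + 1 < 2 ^ Suc Z2" by simp
  have "wp L (solve_program n (Suc Z2)) outputs_optimum s2"
    unfolding solve_program_def wp_Sq by (rule search_output) (use 2(3) l in \<open>simp_all add: Q2_def\<close>)
  from wp_sound[OF this 2(2) size2 L8 fields_programs(3) W1(3)]
  obtain t3 m3 s3 where 3: "exec (compile (solve_program n (Suc Z2))) m2 t3 m3" "represents s3 m3" "outputs_optimum s3"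
      "t3 \<le> steps (solve_program n (Suc Z2)) * (2 * W * (Z2 + steps (solve_program n (Suc Z2)) * (L * W)))" by blast
  have t3: "t3 \<le> T3 * (2 * W * (Z2 + T3 * (L * W)))"
  proof -
    have "steps (solve_program n (Suc Z2)) * (2 * W * (Z2 + steps (solve_program n (Suc Z2)) * (L * W))) \<le>
        T3 * (2 * W * (Z2 + T3 * (L * W)))"
      unfolding T3 using f3[OF n_L, of "Suc Z2"] by (intro mult_le_mono add_mono) auto
    then show ?thesis using 3(4) by linarith
  qed

  from 3(3) obtain p S \<mu> where opt: "optimal_at \<mu> S p" "card S = k"
    and X: "filled (\<lambda>i j. of_bool (p j = i \<and> i \<in> S)) 0 n n 0 (s3 0)"
    and Y: "filled (\<lambda>i j. of_bool (p j = i \<and> i \<notin> S)) (int n * int n) n n 0 (s3 0)"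
    unfolding outputs_optimum_def by blast
  have raw: "m3 a = s3 0 a" if "0 \<le> a" for a
  proof -
    have "m3 (addr 0 a) = s3 0 a" using 3(2) that unfolding represents_def by simp
    then show ?thesis by (simp add: addr_def)
  qed
  have "represents_point n m3 (plan_point {..<n} S p)"
    unfolding represents_point_def
  proof (intro allI impI conjI)
    fix i j assume ij: "i < n" "j < n"
    show "entry (fst (plan_point {..<n} S p)) (i, j) = of_int (m3 (int (i * n + j)))"
      using filled_last[OF X ij] ij raw[of "int (i * n + j)"] by (simp add: entry_plan_point)
    have "int (n * n + i * n + j) = int n * int n + (int i * int n + int j)" by simp
    then have "m3 (int (n * n + i * n + j)) = s3 0 (int n * int n + (int i * int n + int j))"
      using raw[of "int (n * n + i * n + j)"] by (simp add: add.assoc)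
    then show "entry (snd (plan_point {..<n} S p)) (i, j) = of_int (m3 (int (n * n + i * n + j)))"
      using filled_last[OF Y ij] ij by (simp add: entry_plan_point)
  qed
  moreover have "optimal_integral_vertex {..<n} {..<n} ?b ?c ?d k (plan_point {..<n} S p)"
    by (rule optimal_at_vertex[OF inst P _ _ _ opt]) (use B C D in auto)
  ultimately have "outputs_optimal_integral_vertex (k, bs, cs, ds) m3"
    unfolding outputs_optimal_integral_vertex.simps n_def by blast
  moreover have "exec optimizer m0 (t1 + (t2 + t3)) m3"
    unfolding optimizer_def compile_ghost[of n, symmetric] compile_ghost(3)[of n "Suc Z2", symmetric]
    by (rule exec.Seq[OF 1(1) exec.Seq[OF 2(1) 3(1)]])
  moreover have "t1 + (t2 + t3) \<le> f1 L * (2 * W * Z1) + f2 L * (2 * W * Z2) + T3 * (2 * W * (Z2 + T3 * (L * W)))"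
    using t1 t2 t3 by linarith
  ultimately show ?thesis unfolding m0_def by blast
qed

theorem theorem3p1:
  shows "(\<forall>(I :: 'i set) (J :: 'j set) b c d k. map_upgrades_instance I J b c d k \<longrightarrow>
            (\<exists>z. optimal_integral_vertex I J b c d k z)) \<and>
         solvable_in_polynomial_time valid_input encode_input outputs_optimal_integral_vertex"
proof
  show "\<forall>(I :: 'i set) (J :: 'j set) b c d k. map_upgrades_instance I J b c d k \<longrightarrow>
      (\<exists>z. optimal_integral_vertex I J b c d k z)"
  proof (intro allI impI)
    fix I :: "'i set" and J :: "'j set" and b c d k
    assume "map_upgrades_instance I J b c d k"
    then interpret upgrade_problem I J b c d k by unfold_locales
    show "\<exists>z. optimal_integral_vertex I J b c d k z" by (rule optimal_integral_vertex_exists)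
  qed
  obtain f1 where f1: "poly_bounded f1" "\<And>n L. n \<le> L \<Longrightarrow> steps (prepare_program n) \<le> f1 L"
    using steps_prepare_program by blast
  obtain f2 where f2: "poly_bounded f2" "\<And>n L. n \<le> L \<Longrightarrow> steps (matrix_program n) \<le> f2 L"
    using steps_matrix_program by blast
  obtain f3 f4 where f34: "poly_bounded f3" "poly_bounded f4"
      "\<And>n l L. n \<le> L \<Longrightarrow> steps (solve_program n l) \<le> f3 L + l * f4 L"
    using steps_solve_program by blast
  define W where "W = weight optimizer"
  define Z1 where "Z1 L = L + f1 L * (L * W)" for L
  define Z2 where "Z2 L = Z1 L + f2 L * (Z1 L * W)" for L
  define T3 where "T3 L = f3 L + Suc (Z2 L) * f4 L" for L
  define T where "T L = f1 L * (2 * W * Z1 L) + f2 L * (2 * W * Z2 L) + T3 L * (2 * W * (Z2 L + T3 L * (L * W)))" for L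
  have "poly_bounded Z1" unfolding Z1_def[abs_def] by (intro poly_bounded_intros f1)
  then have "poly_bounded Z2" unfolding Z2_def[abs_def] by (intro poly_bounded_intros f2)
  then have "poly_bounded T3" unfolding T3_def[abs_def] by (intro poly_bounded_intros f34)
  then have "poly_bounded T" unfolding T_def[abs_def]
    by (intro poly_bounded_intros f1 f2 \<open>poly_bounded Z1\<close> \<open>poly_bounded Z2\<close>)
  then obtain q :: "nat poly" where q: "\<And>L. T L \<le> poly q L" unfolding poly_bounded_def by blast
  show "solvable_in_polynomial_time valid_input encode_input outputs_optimal_integral_vertex"
    unfolding solvable_in_polynomial_time_def
  \<comment> \<open>All bounds are in terms of \<open>L\<close>, which is the input length plus 8;
    hence the substitution into \<open>q\<close>.\<close>
  proof (rule exI[of _ optimizer], rule exI[of _ "pcompose q [:8, 1:]"], rule ballI)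
    fix a assume a: "a \<in> valid_input"
    obtain k bs cs ds where a_eq: "a = (k, bs, cs, ds)" by (cases a)
    let ?L = "8 + (\<Sum>v\<leftarrow>encode_input a. int_size v)"
    have "\<exists>t m. exec optimizer (load (encode_input (k, bs, cs, ds))) t m \<and> t \<le> f1 ?L * (2 * W * Z1 ?L) +
        f2 ?L * (2 * W * Z2 ?L) + T3 ?L * (2 * W * (Z2 ?L + T3 ?L * (?L * W))) \<and>
        outputs_optimal_integral_vertex (k, bs, cs, ds) m"
      by (rule optimizer_correct[where ?f3.0 = f3 and ?f4.0 = f4])
         (fact a[unfolded a_eq] f1(2) f2(2) f34(3) order_refl[of W, unfolded W_def]
           arg_cong[OF a_eq, of "\<lambda>a. 8 + (\<Sum>v\<leftarrow>encode_input a. int_size v)"] Z1_def Z2_def T3_def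
          | simp add: W_def)+
    then obtain t m where "exec optimizer (load (encode_input a)) t m" "outputs_optimal_integral_vertex a m"
      "t \<le> T ?L" unfolding a_eq T_def by blast
    moreover have "T (8 + (\<Sum>v\<leftarrow>encode_input a. int_size v)) \<le> poly (pcompose q [:8, 1:]) (\<Sum>v\<leftarrow>encode_input a. int_size v)"
      using q[of "8 + (\<Sum>v\<leftarrow>encode_input a. int_size v)"] by (simp add: poly_pcompose)
    ultimately show "\<exists>t m. exec optimizer (load (encode_input a)) t m \<and>
        t \<le> poly (pcompose q [:8, 1:]) (\<Sum>v\<leftarrow>encode_input a. int_size v) \<and> outputs_optimal_integral_vertex a m"
      using order_trans by blast
  qed
qed

end
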